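(* Let $A$ be a $d$-dimensional configuration of $n$ points. Then $\deg(A)\le 1$ if and only if, after deleting repetitions of points from $A$, one of the following holds: (1) $d\le 1$; or (2) $d\ge 2$ and $A$ is a $k$-fold pyramid (for some $k\ge 0$) over a two-dimensional point configuration without interior points; or (3) $d\ge 3$ and $\mathrm{conv}(A)$ is a $k$-fold pyramid (for some $k\ge 0$) over a prism over a simplex, with the non-vertex points of $A$ all on the vertical edges of the prism; or (4) $d\ge 3$ and $\mathrm{conv}(A)$ is a simplex with all non-vertex points of $A$ on the edges of $\mathrm{conv}(A)$ adjacent to one vertex $a$ of $\mathrm{conv}(A)$.
   Context: A $d$-dimensional point configuration is a finite family $A$ of points whose affine span is $\mathbb{R}^d$; repeated points are allowed (treated as distinct labelled elements). A non-empty subset $S\subseteq A$ is an interior face of $A$ if $\mathrm{conv}(S)$ is not contained in the boundary of $\mathrm{conv}(A)$. The degree $\deg(A)$ is the maximal codimension $d-\dim\mathrm{conv}(S)$ of an interior face $S$ of $A$. A point configuration $A'$ is a pyramid over $A$ if $A'=A\cup\{p\}$ with $p\notin \mathrm{aff}(A)$; a $k$-fold pyramid is obtained by iterating this $k$ times ($k=0$ meaning the configuration itself). Similarly a polytope $P'$ is a pyramid over a polytope $P$ if $P'=\mathrm{conv}(P\cup\{p\})$ with $p\notin\mathrm{aff}(P)$. A two-dimensional configuration is without interior points if none of its points lies in the interior of its convex hull (relative to its affine hull). A prism over a simplex is a polytope combinatorially equivalent to $\Delta\times[0,1]$, where $\Delta$ is a simplex; its vertical edges are the edges corresponding to $\{v\}\times[0,1]$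 with $v$ a vertex of $\Delta$. *)

theory Defs
  imports "HOL-Analysis.Analysis"
begin

text \<open>
  A point configuration with possibly repeated points is a family \<open>a\<close> indexed by a finite set \<open>I\<close>;
  its sub-configurations are the index sets \<open>S \<subseteq> I\<close>, and \<open>a ` I\<close> is the configuration after
  deleting repetitions.  The ambient space may be larger than the affine span of the configuration,
  so boundaries and interiors are taken relative to the affine hull. If the affine span is the whole
  space, \<open>rel_frontier\<close> and \<open>rel_interior\<close> are the ordinary \<open>frontier\<close> and \<open>interior\<close>. This includes
  dimension 0, whereas a type of class \<open>euclidean_space\<close> has dimension at least 1.
\<close>

definition interior_face :: "'i set \<Rightarrow> ('i \<Rightarrow> 'a::euclidean_space) \<Rightarrow> 'i set \<Rightarrow> bool" where
  "interior_face I a S \<longleftrightarrow>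
     S \<noteq> {} \<and> S \<subseteq> I \<and> \<not> convex hull (a ` S) \<subseteq> rel_frontier (convex hull (a ` I))"

text \<open>For finite non-empty \<open>I\<close> the maximum ranges over a finite set that contains 0, since \<open>I\<close>
  itself is an interior face.\<close>

definition config_degree :: "'i set \<Rightarrow> ('i \<Rightarrow> 'a::euclidean_space) \<Rightarrow> int" where
  "config_degree I a =
     Max {aff_dim (a ` I) - aff_dim (convex hull (a ` S)) | S. interior_face I a S}"

text \<open>Both pyramid relations take the pyramid first and the base second, so \<open>(R ^^ k) X B\<close> says
  that \<open>X\<close> is a \<open>k\<close>-fold pyramid over \<open>B\<close>.\<close>

definition config_pyramid :: "'a::euclidean_space set \<Rightarrow> 'a set \<Rightarrow> bool" where
  "config_pyramid A' A \<longleftrightarrow> (\<exists>p. p \<notin> affine hull A \<and> A' = A \<union> {p})"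

definition polytope_pyramid :: "'a::euclidean_space set \<Rightarrow> 'a set \<Rightarrow> bool" where
  "polytope_pyramid P' P \<longleftrightarrow>
     polytope P \<and> (\<exists>p. p \<notin> affine hull P \<and> P' = convex hull (P \<union> {p}))"

definition without_interior_points :: "'a::euclidean_space set \<Rightarrow> bool" where
  "without_interior_points A \<longleftrightarrow> A \<inter> rel_interior (convex hull A) = {}"

text \<open>Combinatorial equivalence is isomorphism of face lattices. The isomorphism is kept as explicit
  data because it determines which edges of a prism are vertical; for a quadrilateral, either
  pair of opposite edges can be chosen.\<close>

definition face_lattice_iso ::
    "('a::euclidean_space set \<Rightarrow> 'b::euclidean_space set) \<Rightarrow> 'a set \<Rightarrow> 'b set \<Rightarrow> bool" where
  "face_lattice_iso \<phi> P Q \<longleftrightarrow>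
     bij_betw \<phi> {F. F face_of P} {G. G face_of Q} \<and>
     (\<forall>F G. F face_of P \<longrightarrow> G face_of P \<longrightarrow> (F \<subseteq> G \<longleftrightarrow> \<phi> F \<subseteq> \<phi> G))"

text \<open>Taking \<open>\<Delta>\<close> in the space of \<open>P\<close> is no restriction, as \<open>\<Delta>\<close> has smaller dimension than \<open>P\<close>.
  The library relation \<open>simplex\<close> admits the empty set as a simplex of dimension -1; the
  natural number \<open>m\<close> excludes it.\<close>

definition prism_over_simplex ::
    "'a::euclidean_space set \<Rightarrow> ('a set \<Rightarrow> ('a \<times> real) set) \<Rightarrow> 'a set \<Rightarrow> bool" where
  "prism_over_simplex \<Delta> \<phi> P \<longleftrightarrow>
     polytope P \<and> (\<exists>m::nat. int m simplex \<Delta>) \<and> face_lattice_iso \<phi> P (\<Delta> \<times> {0..1})"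

definition vertical_edges ::
    "'a::euclidean_space set \<Rightarrow> ('a set \<Rightarrow> ('a \<times> real) set) \<Rightarrow> 'a set \<Rightarrow> 'a set set" where
  "vertical_edges \<Delta> \<phi> P =
     {E. E face_of P \<and> (\<exists>v. v extreme_point_of \<Delta> \<and> \<phi> E = {v} \<times> {0..1})}"

definition nonvertex_points :: "'a::euclidean_space set \<Rightarrow> 'a set" where
  "nonvertex_points A = {x \<in> A. \<not> x extreme_point_of (convex hull A)}"

end

theory Submission
  imports Defs
begin

text \<open>
  Sufficiency. In each of the cases (3) and (4) there are \<open>d\<close> proper faces of \<open>conv A\<close> such that every
  point of \<open>A\<close> lies on all but at most one of them (a weak Cayley decomposition). An interior face has a
  point off each of these faces, and such points are affinely independent, so it has codimension at most 1.

  Necessity. The key observation is that an affine dependency of \<open>A\<close> with support \<open>C\<close> and negative part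
  \<open>N\<close> satisfies \<open>dim C \<le> card N\<close>: otherwise \<open>N\<close> together with the missing points of a basis is an
  interior face of codimension at least 2. Fix an affine basis \<open>B \<subseteq> A\<close>. By the observation every further
  point has two or three non-zero barycentric coordinates, and the supports meet pairwise. If their union
  has at most three elements, this is case (2), the other elements of \<open>B\<close> being apices. Otherwise either they are pairs with a common element or they are all of the form
  \<open>{b0, b1}\<close> or \<open>{b0, b1, k}\<close>, with a constant ratio of the coordinates at \<open>b0\<close> and \<open>b1\<close> in the latter
  case. Hence \<open>A\<close> lies on \<open>d\<close> independent lines through a common, possibly infinite, point. The observation,
  applied to two and to three of these lines, shows that on each line \<open>A\<close> is on one side of that point.
  If the point belongs to \<open>A\<close>, this is case (4), if not, it is case (3).
\<close>

section \<open>Configurations of degree at most one\<close>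

text \<open>Negating a dependency exchanges its positive and negative parts. Adding the bounds for
  both signs gives \<open>2 * dim C \<le> card C\<close>, so most of the necessity argument counts
  points against rank. A point with \<open>k\<close> non-zero coordinates yields a dependency of
  \<open>k + 1\<close> points of dimension \<open>k - 1\<close>, whence \<open>k \<le> 3\<close>.
  Two points whose supports share a basis element can be combined so that this element cancels; the
  count then leaves at most two coordinates in which they are not proportional. This rigidity is the
  source of the common point of the lines, which in the case of triples is a combination of
  \<open>b0\<close> and \<open>b1\<close> in the constant ratio. The obstacle is that this point may
  be finite or at infinity. The polytope is a prism only combinatorially: its vertical edges need
  not be parallel. Homogeneous coordinates (\<open>u\<close>, \<open>\<eta>\<close>) treat both
  situations at once, and the face lattice is read off from the linear relations between the ends of
  the vertical edges, which have the same signs as in the standard prism.\<close>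

definition degree_le_one :: "'a::euclidean_space set \<Rightarrow> bool" where
  "degree_le_one A \<longleftrightarrow>
     (\<forall>S\<subseteq>A. S \<noteq> {} \<longrightarrow> \<not> convex hull S \<subseteq> rel_frontier (convex hull A) \<longrightarrow>
        aff_dim A \<le> aff_dim S + 1)"

lemma config_degree_le_one_iff:
  fixes a :: "'i \<Rightarrow> 'a::euclidean_space"
  assumes "finite I" "I \<noteq> {}"
  shows "config_degree I a \<le> 1 \<longleftrightarrow> degree_le_one (a ` I)"
proof -
  let ?X = "{aff_dim (a ` I) - aff_dim (convex hull (a ` S)) | S. interior_face I a S}"
  have "?X \<subseteq> (\<lambda>S. aff_dim (a ` I) - aff_dim (convex hull (a ` S))) ` Pow I"
    by (auto simp: interior_face_def)
  then have fin: "finite ?X"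
    by (rule finite_subset) (use assms in simp)
  have "\<not> convex hull (a ` I) \<subseteq> rel_frontier (convex hull (a ` I))"
    using assms rel_interior_eq_empty[of "convex hull (a ` I)"] rel_interior_subset[of "convex hull (a ` I)"]
    by (auto simp: rel_frontier_def)
  then have "interior_face I a I"
    using assms by (simp add: interior_face_def)
  then have "?X \<noteq> {}" by blast
  then have "config_degree I a \<le> 1 \<longleftrightarrow> (\<forall>S. interior_face I a S \<longrightarrow> aff_dim (a ` I) \<le> aff_dim (a ` S) + 1)"
    unfolding config_degree_def Max_le_iff[OF fin \<open>?X \<noteq> {}\<close>]
    by (fastforce simp: aff_dim_convex_hull)
  also have "\<dots> \<longleftrightarrow> degree_le_one (a ` I)"
    unfolding degree_le_one_def interior_face_def all_subset_image by blast
  finally show ?thesis .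
qed

text \<open>The relative frontier is a union of proper faces. One of them contains a relative
  interior point of \<open>convex hull S\<close>, and a face that meets the relative interior of a
  convex subset contains that subset; so a single proper face suffices.\<close>

lemma convex_hull_subset_rel_frontier_iff:
  fixes P :: "'a::euclidean_space set"
  assumes "polytope P" "S \<subseteq> P" "S \<noteq> {}"
  shows "convex hull S \<subseteq> rel_frontier P \<longleftrightarrow> (\<exists>F. F face_of P \<and> F \<noteq> P \<and> S \<subseteq> F)"
proof
  assume L: "convex hull S \<subseteq> rel_frontier P"
  have "rel_interior (convex hull S) \<noteq> {}"
    using assms by (simp add: rel_interior_eq_empty)
  then obtain x where x: "x \<in> rel_interior (convex hull S)" by blast
  then have "x \<in> rel_frontier P"
    using L rel_interior_subset by blast
  then obtain F where F: "F face_of P" "F \<noteq> P" "x \<in> F"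
    using rel_frontier_of_polyhedron_alt[OF polytope_imp_polyhedron[OF assms(1)]] by auto
  have "convex hull S \<subseteq> P"
    using assms by (simp add: hull_minimal polytope_imp_convex)
  then have "convex hull S \<subseteq> F"
    using subset_of_face_of[OF F(1)] F(3) x by blast
  then show "\<exists>F. F face_of P \<and> F \<noteq> P \<and> S \<subseteq> F"
    using F(1,2) \<open>convex hull S \<subseteq> F\<close> hull_subset[of S convex] by (meson order_trans)
next
  assume "\<exists>F. F face_of P \<and> F \<noteq> P \<and> S \<subseteq> F"
  then obtain F where F: "F face_of P" "F \<noteq> P" "S \<subseteq> F" by blast
  then have "convex hull S \<subseteq> F"
    by (simp add: face_of_imp_convex hull_minimal)
  then show "convex hull S \<subseteq> rel_frontier P"
    using face_of_subset_rel_frontier[OF F(1,2)] by blast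
qed

lemma degree_le_one_iff:
  fixes A :: "'a::euclidean_space set"
  assumes "finite A"
  shows "degree_le_one A \<longleftrightarrow>
    (\<forall>S\<subseteq>A. S \<noteq> {} \<longrightarrow> (\<forall>F. F face_of convex hull A \<longrightarrow> S \<subseteq> F \<longrightarrow> F = convex hull A) \<longrightarrow>
       aff_dim A \<le> aff_dim S + 1)"
proof -
  have "convex hull S \<subseteq> rel_frontier (convex hull A) \<longleftrightarrow>
      \<not> (\<forall>F. F face_of convex hull A \<longrightarrow> S \<subseteq> F \<longrightarrow> F = convex hull A)" if "S \<subseteq> A" "S \<noteq> {}" for S
    using convex_hull_subset_rel_frontier_iff[of "convex hull A" S] that assms
    by (meson hull_subset order_trans polytope_convex_hull)
  then show ?thesis
    unfolding degree_le_one_def by (intro iff_allI imp_cong refl) blast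
qed

text \<open>The functionals of a weak Cayley decomposition are encoded by the faces on which they vanish.\<close>

definition weak_cayley :: "'a::euclidean_space set \<Rightarrow> 'a set \<Rightarrow> nat \<Rightarrow> bool" where
  "weak_cayley P X n \<longleftrightarrow>
     (\<exists>F :: nat \<Rightarrow> 'a set. (\<forall>i<n. F i face_of P \<and> F i \<noteq> P) \<and>
        (\<forall>x\<in>X. \<forall>i<n. \<forall>j<n. i \<noteq> j \<longrightarrow> x \<in> F i \<or> x \<in> F j))"

lemma weak_cayley_degree_le_one:
  fixes A :: "'a::euclidean_space set"
  assumes "finite A" "weak_cayley (convex hull A) A n" "aff_dim A \<le> int n"
  shows "degree_le_one A"
  unfolding degree_le_one_iff[OF assms(1)]
proof (intro allI impI)
  fix S assume S: "S \<subseteq> A" "S \<noteq> {}"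
    and int: "\<forall>F. F face_of convex hull A \<longrightarrow> S \<subseteq> F \<longrightarrow> F = convex hull A"
  obtain F :: "nat \<Rightarrow> 'a set" where F: "\<And>i. i < n \<Longrightarrow> F i face_of convex hull A \<and> F i \<noteq> convex hull A"
    and cov: "\<And>x i j. x \<in> A \<Longrightarrow> i < n \<Longrightarrow> j < n \<Longrightarrow> i \<noteq> j \<Longrightarrow> x \<in> F i \<or> x \<in> F j"
    using assms(2) unfolding weak_cayley_def by metis
  have "\<exists>x\<in>S. x \<notin> F i" if "i < n" for i
    using int F[OF that] by blast
  then obtain x where x: "\<And>i. i < n \<Longrightarrow> x i \<in> S \<and> x i \<notin> F i"
    by metis
  \<comment> \<open>A point misses at most one of the faces, and \<open>x j\<close> already misses
    \<open>F j\<close>.\<close>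
  have xF: "x j \<in> F i" if "i < n" "j < n" "i \<noteq> j" for i j
    using cov[of "x j" i j] x[of j] that S by auto
  have inj: "inj_on x {..<n}"
    by (rule inj_onI) (metis lessThan_iff x xF)
  have "\<not> affine_dependent (x ` {..<n})"
    unfolding affine_dependent_def
  proof clarify
    fix i assume i: "i < n" and h: "x i \<in> affine hull (x ` {..<n} - {x i})"
    \<comment> \<open>All the other points lie in \<open>F i\<close>, and the affine hull of a face
      meets the polytope in that face only; \<open>x i\<close> is outside it.\<close>
    have "x ` {..<n} - {x i} \<subseteq> F i"
      using xF i by auto
    then have "x i \<in> affine hull (F i)"
      using h hull_mono by blast
    moreover have "x i \<in> convex hull A"
      using x[OF i] S hull_subset by fastforce
    ultimately have "x i \<in> F i"
      using face_of_imp_eq_affine_Int[of "convex hull A" "F i"] F[OF i] by auto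
    then show False using x[OF i] by blast
  qed
  then have n: "int n = aff_dim (x ` {..<n}) + 1"
    using aff_dim_affine_independent card_image[OF inj] by force
  have "x ` {..<n} \<subseteq> S"
    using x by auto
  then have "aff_dim (x ` {..<n}) + 1 \<le> aff_dim S + 1"
    by (simp add: aff_dim_subset)
  with n show "aff_dim A \<le> aff_dim S + 1"
    using assms(3) by linarith
qed

section \<open>Pyramids, polygons and low dimension\<close>

lemma convex_hull_insert_face_neq:
  fixes P :: "'a::euclidean_space set"
  assumes "convex P" "F face_of P" "F \<noteq> P" "p \<notin> affine hull P"
  shows "convex hull (insert p F) \<noteq> convex hull (insert p P)"
proof
  assume eq: "convex hull (insert p F) = convex hull (insert p P)"
  have "p \<notin> affine hull F"
    using assms face_of_imp_subset hull_mono by blast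
  then have "aff_dim (convex hull (insert p F)) = aff_dim F + 1"
    by (simp add: aff_dim_convex_hull aff_dim_insert)
  moreover have "aff_dim (convex hull (insert p P)) = aff_dim P + 1"
    using assms by (simp add: aff_dim_convex_hull aff_dim_insert)
  ultimately show False
    using face_of_aff_dim_lt[OF assms(1-3)] eq by simp
qed

text \<open>The base is a proper face of the pyramid, so an interior face must contain the apex.
  Removing the apex leaves an interior face of the base of the same codimension, because the cone
  over a proper face of the base is a proper face of the pyramid.\<close>

lemma degree_le_one_insert:
  fixes B :: "'a::euclidean_space set"
  assumes "finite B" "p \<notin> affine hull B" "degree_le_one B"
  shows "degree_le_one (insert p B)"
proof (cases "B = {}")
  case True
  then show ?thesis
    by (auto simp: degree_le_one_def subset_singleton_iff)
next
  case False
  have finS: "finite (insert p B)" using assms by simp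
  show ?thesis
    unfolding degree_le_one_iff[OF finS]
  proof (intro allI impI)
    fix S assume S: "S \<subseteq> insert p B" "S \<noteq> {}"
      and int: "\<forall>F. F face_of convex hull (insert p B) \<longrightarrow> S \<subseteq> F \<longrightarrow> F = convex hull (insert p B)"
    note faces = face_of_convex_hull_insert_eq[OF assms(1,2)]
    have ph: "p \<notin> affine hull (convex hull B)"
      using assms(2) by (simp add: affine_hull_convex_hull)
    have Bface: "convex hull B face_of convex hull (insert p B)"
      unfolding faces by (simp add: face_of_refl)
    have "convex hull B \<noteq> convex hull (insert p B)"
      by (metis aff_dim_convex_hull aff_dim_insert assms(2) less_irrefl less_add_one)
    then have "\<not> S \<subseteq> B"
      using int Bface hull_subset by fast
    then have pS: "p \<in> S" using S by blast
    define T where "T = S - {p}"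
    have T: "T \<subseteq> B" "S = insert p T" using S pS by (auto simp: T_def)
    have pT: "p \<notin> affine hull T" using assms(2) hull_mono[OF T(1), of affine] by blast
    have ext: "F = convex hull B" if F: "F face_of convex hull B" "T \<subseteq> F" for F
    proof (rule ccontr)
      assume ne: "F \<noteq> convex hull B"
      have "convex hull (insert p F) face_of convex hull (insert p B)"
        using faces F by blast
      moreover have "S \<subseteq> convex hull (insert p F)"
        using F T hull_subset by fastforce
      ultimately have "convex hull (insert p F) = convex hull (insert p B)"
        using int by blast
      also have "\<dots> = convex hull (insert p (convex hull B))"
        by (rule hull_insert)
      finally show False
        using convex_hull_insert_face_neq[OF _ F(1) ne ph] by simp
    qed
    have "T \<noteq> {}"
    proof
      assume "T = {}"
      then have "convex hull B = {}" using ext[of "{}"] by simp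
      then show False using False by simp
    qed
    then have "aff_dim B \<le> aff_dim T + 1"
      using assms(3) ext T unfolding degree_le_one_iff[OF assms(1)] by blast
    then show "aff_dim (insert p B) \<le> aff_dim S + 1"
      using T pT assms(2) by (simp add: aff_dim_insert)
  qed
qed

lemma config_pyramid_subset:
  assumes "(config_pyramid ^^ k) A B"
  shows "B \<subseteq> A"
  using assms
proof (induction k arbitrary: A)
  case (Suc k)
  then obtain C where "config_pyramid A C" "(config_pyramid ^^ k) C B"
    by (meson relpowp_Suc_E2)
  then show ?case using Suc.IH[of C] unfolding config_pyramid_def by auto
qed simp

lemma degree_le_one_config_pyramid:
  assumes "(config_pyramid ^^ k) A B" "finite A" "degree_le_one B"
  shows "degree_le_one A"
  using assms(1,2)
proof (induction k arbitrary: A)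
  case 0
  then show ?case using assms(3) by simp
next
  case (Suc k)
  then obtain C where C: "config_pyramid A C" "(config_pyramid ^^ k) C B"
    by (meson relpowp_Suc_E2)
  then obtain p where p: "p \<notin> affine hull C" "A = insert p C"
    unfolding config_pyramid_def by auto
  then show ?case
    using Suc.IH[OF C(2)] Suc.prems(2) degree_le_one_insert by auto
qed

text \<open>In the plane an interior face of codimension 2 is a single point of the configuration in
  the interior.\<close>

lemma degree_le_one_polygon:
  fixes B :: "'a::euclidean_space set"
  assumes "finite B" "aff_dim B = 2" "without_interior_points B"
  shows "degree_le_one B"
  unfolding degree_le_one_def
proof (intro allI impI)
  fix S assume S: "S \<subseteq> B" "S \<noteq> {}" "\<not> convex hull S \<subseteq> rel_frontier (convex hull B)"
  have "\<not> (\<exists>y. S = {y})"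
  proof clarify
    fix y assume "S = {y}"
    moreover from this have "y \<in> convex hull B" "y \<in> B"
      using S hull_inc by auto
    ultimately show False
      using S(3) assms(3) closure_subset[of "convex hull B"]
      by (auto simp: without_interior_points_def rel_frontier_def)
  qed
  then have "aff_dim S \<noteq> 0" by (simp add: aff_dim_eq_0)
  moreover have "aff_dim S \<ge> 0" using S(2) aff_dim_negative_iff not_less by blast
  ultimately show "aff_dim B \<le> aff_dim S + 1" using assms(2) by linarith
qed

lemma degree_le_one_if_aff_dim_le_one:
  fixes A :: "'a::euclidean_space set"
  assumes "aff_dim A \<le> 1"
  shows "degree_le_one A"
  unfolding degree_le_one_def
proof (intro allI impI)
  fix S :: "'a set" assume "S \<noteq> {}"
  then have "0 \<le> aff_dim S" using aff_dim_negative_iff[of S] by linarith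
  then show "aff_dim A \<le> aff_dim S + 1" using assms by linarith
qed

text \<open>The new decomposition consists of the cones over the old faces and the base itself. The
  apex lies on every cone, while a covered point of the base lies on the base and keeps its
  incidences. The covered set \<open>Y\<close> gains each apex, so that in the end it contains all
  vertices of the iterated pyramid.\<close>

lemma polytope_pyramid_weak_cayley:
  assumes "(polytope_pyramid ^^ k) Q P" "weak_cayley P X n" "X \<subseteq> P" "{x. x extreme_point_of P} \<subseteq> X"
    "polytope P"
  shows "\<exists>Y. X \<subseteq> Y \<and> Y \<subseteq> Q \<and> {x. x extreme_point_of Q} \<subseteq> Y \<and> weak_cayley Q Y (n + k) \<and>
    aff_dim Q = aff_dim P + int k \<and> polytope Q"
  using assms(1)
proof (induction k arbitrary: Q)
  case 0
  then show ?case using assms by auto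
next
  case (Suc k)
  then obtain R where R: "polytope_pyramid Q R" "(polytope_pyramid ^^ k) R P"
    by (meson relpowp_Suc_E2)
  then obtain p where p: "p \<notin> affine hull R" "Q = convex hull (insert p R)"
    unfolding polytope_pyramid_def by auto
  obtain Y where Y: "X \<subseteq> Y" "Y \<subseteq> R" "{x. x extreme_point_of R} \<subseteq> Y" "weak_cayley R Y (n + k)"
    "aff_dim R = aff_dim P + int k" "polytope R"
    using Suc.IH[OF R(2)] by blast
  obtain F :: "nat \<Rightarrow> 'a set" where F: "\<And>i. i < n + k \<Longrightarrow> F i face_of R \<and> F i \<noteq> R"
    and cov: "\<And>x i j. x \<in> Y \<Longrightarrow> i < n + k \<Longrightarrow> j < n + k \<Longrightarrow> i \<noteq> j \<Longrightarrow> x \<in> F i \<or> x \<in> F j"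
    using Y(4) unfolding weak_cayley_def by metis
  define G where "G i = (if i < n + k then convex hull (insert p (F i)) else R)" for i
  obtain V where V: "finite V" "R = convex hull V"
    using Y(6) unfolding polytope_def by blast
  have pV: "p \<notin> affine hull V" using p V by (simp add: affine_hull_convex_hull)
  have Q: "Q = convex hull (insert p V)"
    unfolding p(2) V(2) by (metis hull_insert)
  have faces: "T face_of Q \<longleftrightarrow> T face_of R \<or> (\<exists>T'. T' face_of R \<and> T = convex hull (insert p T'))" for T
    unfolding Q V(2) by (rule face_of_convex_hull_insert_eq[OF V(1) pV])
  have convR: "convex R" using Y(6) polytope_imp_convex by blast
  have Gface: "G i face_of Q \<and> G i \<noteq> Q" if "i < n + Suc k" for i
  proof (cases "i < n + k")
    case True
    then show ?thesis
      using convex_hull_insert_face_neq[OF convR _ _ p(1)] F[OF True] faces p(2) by (auto simp: G_def)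
  next
    case False
    have "R face_of R" using convR by (simp add: face_of_refl)
    moreover have "p \<in> Q" unfolding p(2) by (simp add: hull_inc)
    moreover have "p \<notin> R" using p(1) by (auto intro: hull_inc)
    ultimately show ?thesis using False faces by (auto simp: G_def)
  qed
  have Gcov: "x \<in> G i \<or> x \<in> G j"
    if x: "x \<in> insert p Y" and ij: "i < n + Suc k" "j < n + Suc k" "i \<noteq> j" for x i j
  proof -
    have sub: "insert p (F i) \<subseteq> G i" if "i < n + k" for i
      using that hull_subset unfolding G_def by metis
    have "x \<in> R" if "x \<in> Y" using that Y(2) by blast
    then show ?thesis
      using x sub[of i] sub[of j] cov[of x i j] ij by (cases "i < n + k"; cases "j < n + k") (auto simp: G_def)
  qed
  have "weak_cayley Q (insert p Y) (n + Suc k)"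
    unfolding weak_cayley_def using Gface Gcov by blast
  moreover have "R \<subseteq> Q" "p \<in> Q"
    unfolding p(2) using hull_subset[of "insert p R" convex] by auto
  then have "insert p Y \<subseteq> Q" using Y(2) by blast
  moreover have "{x. x extreme_point_of Q} \<subseteq> insert p Y"
  proof clarify
    fix x assume x: "x extreme_point_of Q" "x \<notin> Y"
    then have "x \<in> insert p R" unfolding p(2) by (metis extreme_point_of_convex_hull)
    moreover have "x \<notin> R"
    proof
      assume "x \<in> R"
      then have "x extreme_point_of R"
        using x(1) \<open>R \<subseteq> Q\<close> unfolding extreme_point_of_def by blast
      then show False using x Y(3) by blast
    qed
    ultimately show "x = p" by blast
  qed
  moreover have "aff_dim Q = aff_dim P + int (Suc k)"
    unfolding p(2) using p(1) Y(5) by (simp add: aff_dim_convex_hull aff_dim_insert)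
  moreover have "polytope Q"
    unfolding Q using V by (simp add: polytope_convex_hull)
  ultimately show ?case
    using Y(1) by (intro exI[of _ "insert p Y"]) auto
qed

text \<open>A face has a chain of faces whose dimensions rise by one; its image is a strict chain,
  along which dimensions rise by at least one. The inequality is what bounds the dimension of a
  combinatorial prism.\<close>

lemma face_lattice_iso_aff_dim_le:
  assumes iso: "face_lattice_iso \<phi> P Q" and "polytope P" "convex Q" "F face_of P"
  shows "aff_dim F \<le> aff_dim (\<phi> F)"
proof -
  have \<phi>: "\<phi> F face_of Q" if "F face_of P" for F
    using iso that unfolding face_lattice_iso_def bij_betw_def by blast
  have mono: "\<phi> F \<subset> \<phi> G" if "F face_of P" "G face_of P" "F \<subset> G" for F G
    using iso that unfolding face_lattice_iso_def by (metis psubsetE psubsetI order_refl)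
  \<comment> \<open>The shift by one starts the induction at the empty face, which has dimension
    -1.\<close>
  have "aff_dim F \<le> aff_dim (\<phi> F)" if "F face_of P" "nat (aff_dim F + 1) = n" for F n
    using that
  proof (induction n arbitrary: F)
    case 0
    then show ?case using aff_dim_geq[of F] aff_dim_geq[of "\<phi> F"] by linarith
  next
    case (Suc n)
    \<comment> \<open>\<open>facet_of\<close> excludes the empty face, so a vertex is treated
      separately.\<close>
    have "\<exists>G. G face_of F \<and> G \<subset> F \<and> aff_dim G = aff_dim F - 1"
    proof (cases "aff_dim F = 0")
      case True
      then show ?thesis by (intro exI[of _ "{}"]) auto
    next
      case False
      then have "aff_dim F > 0" using Suc.prems(2) by linarith
      then obtain G where "G facet_of F"
        using polytope_facet_exists[of F] face_of_polytope_polytope[OF assms(2) Suc.prems(1)] by blast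
      then show ?thesis
        by (intro exI[of _ G]) (auto simp: facet_of_def dest: face_of_imp_subset)
    qed
    then obtain G where G: "G face_of F" "G \<subset> F" "aff_dim G = aff_dim F - 1" by blast
    have GP: "G face_of P" using G Suc.prems face_of_trans by blast
    have "aff_dim G \<le> aff_dim (\<phi> G)"
      using Suc.IH[OF GP] Suc.prems(2) G(3) by linarith
    moreover have sub: "\<phi> G \<subset> \<phi> F" using mono[OF GP Suc.prems(1) G(2)] .
    have "\<phi> G face_of \<phi> F"
      using \<phi>[OF GP] \<phi>[OF Suc.prems(1)] sub face_of_face by blast
    then have "aff_dim (\<phi> G) < aff_dim (\<phi> F)"
      using face_of_aff_dim_lt[of "\<phi> F" "\<phi> G"] \<phi>[OF Suc.prems(1)] sub face_of_imp_convex by blast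
    ultimately show ?case using G(3) by linarith
  qed
  then show ?thesis using assms(4) by blast
qed

section \<open>Pyramids over prisms and star-shaped simplices have degree at most one\<close>

lemma weak_cayley_mono:
  assumes "weak_cayley P X n" "Y \<subseteq> X"
  shows "weak_cayley P Y n"
proof -
  obtain F where F: "\<forall>i<n. F i face_of P \<and> F i \<noteq> P"
    "\<forall>x\<in>X. \<forall>i<n. \<forall>j<n. i \<noteq> j \<longrightarrow> x \<in> F i \<or> x \<in> F j"
    using assms(1) unfolding weak_cayley_def by (elim exE conjE)
  then show ?thesis
    using assms(2) unfolding weak_cayley_def by (intro exI[of _ F] conjI ballI) auto
qed

text \<open>The bottom copy of \<open>C\<close> and one point of the top copy span everything
  affinely, since \<open>(p, 1) = (p, 0) + (c, 1) - (c, 0)\<close>.\<close>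

lemma aff_dim_convex_hull_Times_unit_le:
  fixes C :: "'a::euclidean_space set"
  assumes "finite C" "C \<noteq> {}"
  shows "aff_dim ((convex hull C) \<times> {0..1::real}) \<le> int (card C)"
proof -
  obtain c where c: "c \<in> C" using assms by blast
  let ?D = "insert (c, 1) ((\<lambda>p. (p, 0::real)) ` C)"
  have "C \<times> {0, 1} \<subseteq> affine hull ?D"
  proof clarify
    fix p :: 'a and t :: real
    assume p: "p \<in> C" and t: "t \<in> {0, 1}"
    have "1 *\<^sub>R (p, 0) + 1 *\<^sub>R (c, 1) + (- 1) *\<^sub>R (c, 0) \<in> affine hull ?D"
      using p c by (intro mem_affine_3) (auto intro: hull_inc)
    moreover have "(p, 0) \<in> affine hull ?D"
      using p by (auto intro: hull_inc)
    ultimately show "(p, t) \<in> affine hull ?D"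
      using t by auto
  qed
  moreover have "convex hull {0, 1} = {0..1::real}"
    by (metis closed_segment_eq_real_ivl segment_convex_hull zero_le_one)
  then have "(convex hull C) \<times> {0..1::real} = convex hull (C \<times> {0, 1})"
    by (simp only: convex_hull_Times)
  ultimately have "aff_dim ((convex hull C) \<times> {0..1::real}) \<le> aff_dim ?D"
    using aff_dim_subset[of "C \<times> {0, 1}" "affine hull ?D"] by (simp add: aff_dim_convex_hull)
  also have "\<dots> \<le> int (card ?D) - 1"
    using assms by (intro aff_dim_le_card) auto
  also have "card ?D \<le> card C + 1"
    using assms by (simp add: card_insert_if card_image_le le_SucI)
  finally show ?thesis by simp
qed

text \<open>The side faces away from each vertex of \<open>\<Delta>\<close> form the decomposition:
  the vertical edge over \<open>w\<close> lies in all of them except the one belonging to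
  \<open>w\<close>. Their number \<open>m + 1\<close> is also the dimension bound for the
  prism.\<close>

lemma prism_weak_cayley:
  fixes P :: "'a::euclidean_space set"
  assumes "prism_over_simplex \<Delta> \<phi> P"
  defines "X \<equiv> \<Union>(vertical_edges \<Delta> \<phi> P)"
  shows "\<exists>n. weak_cayley P X n \<and> aff_dim P \<le> int n \<and> {x. x extreme_point_of P} \<subseteq> X \<and> X \<subseteq> P"
proof -
  let ?Q = "\<Delta> \<times> {0..1::real}"
  obtain m :: nat where P: "polytope P" and m: "int m simplex \<Delta>" and iso: "face_lattice_iso \<phi> P ?Q"
    using assms unfolding prism_over_simplex_def by blast
  obtain C where C: "finite C" "\<not> affine_dependent C" "card C = m + 1" "\<Delta> = convex hull C"
    using m unfolding simplex by fastforce
  have "C \<noteq> {}" using C(3) by auto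
  have bij: "bij_betw \<phi> {F. F face_of P} {G. G face_of ?Q}"
    and le: "\<And>F G. F face_of P \<Longrightarrow> G face_of P \<Longrightarrow> F \<subseteq> G \<longleftrightarrow> \<phi> F \<subseteq> \<phi> G"
    using iso unfolding face_lattice_iso_def by blast+
  have \<phi>: "\<phi> F face_of ?Q" if "F face_of P" for F
    using bij that unfolding bij_betw_def by blast
  have surj: "\<exists>F. F face_of P \<and> \<phi> F = G" if "G face_of ?Q" for G
  proof -
    have "G \<in> \<phi> ` {F. F face_of P}" using bij that unfolding bij_betw_def by blast
    then show ?thesis by auto
  qed
  have convQ: "convex ?Q" using C by (simp add: convex_Times)
  have unit_face: "({0..1}::real set) face_of {0..1}"
    by (simp add: face_of_refl)
  have faceT: "G \<times> {0..1} face_of ?Q" if "G face_of \<Delta>" for G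
    using face_of_Times[OF that unit_face] .
  have ext: "v extreme_point_of \<Delta> \<longleftrightarrow> v \<in> C" for v
    using extreme_point_of_convex_hull_affine_independent[OF C(2)] C(4) by simp
  have opp: "convex hull (C - {v}) face_of \<Delta>" for v
    using face_of_convex_hull_affine_independent[OF C(2)] C(4) by blast
  \<comment> \<open>\<open>F v\<close> is the face of \<open>P\<close> corresponding to the prism
    over the face of \<open>\<Delta>\<close> opposite \<open>v\<close>.\<close>
  have "\<exists>F. F face_of P \<and> \<phi> F = (convex hull (C - {v})) \<times> {0..1}" for v
    by (intro surj faceT opp)
  then obtain F where F: "\<And>v. F v face_of P" "\<And>v. \<phi> (F v) = (convex hull (C - {v})) \<times> {0..1}"
    by metis
  have FP: "F v \<noteq> P" if "v \<in> C" for v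
  proof
    assume FvP: "F v = P"
    obtain G where G: "G face_of P" "\<phi> G = ?Q"
      using surj[OF face_of_refl[OF convQ]] by blast
    then have "?Q \<subseteq> (convex hull (C - {v})) \<times> {0..1}"
      using le[OF G(1) F(1)[of v]] face_of_imp_subset[OF G(1)] F(2)[of v] G(2) FvP by simp
    then have "convex hull C \<subseteq> convex hull (C - {v})"
      using C(4) by (auto simp: times_subset_iff)
    moreover have "v \<notin> convex hull (C - {v})"
      using C(2) that unfolding affine_dependent_def
      using convex_hull_subset_affine_hull by blast
    moreover have "v \<in> convex hull C" using that by (simp add: hull_inc)
    ultimately show False by blast
  qed
  obtain e where e: "bij_betw e {..<m+1} C"
    using C(1,3) by (metis ex_bij_betw_nat_finite lessThan_atLeast0)
  have eC: "e i \<in> C" if "i < m+1" for i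
    using e that unfolding bij_betw_def by blast
  have einj: "e i \<noteq> e j" if "i < m+1" "j < m+1" "i \<noteq> j" for i j
    using e that unfolding bij_betw_def inj_on_def by blast
  have cov: "x \<in> F v" if "E face_of P" "\<phi> E = {w} \<times> {0..1}" "w \<in> C" "w \<noteq> v" "x \<in> E" for E w v x
  proof -
    have "w \<in> convex hull (C - {v})" using that by (simp add: hull_inc)
    then have "E \<subseteq> F v" using le[OF that(1) F(1)] that(2) F(2) by auto
    then show ?thesis using that by blast
  qed
  have "weak_cayley P X (m+1)"
    unfolding weak_cayley_def
  proof (intro exI[of _ "\<lambda>i. F (e i)"] conjI allI impI ballI)
    fix x i j assume x: "x \<in> X" and ij: "i < m+1" "j < m+1" "i \<noteq> j"
    obtain E w where E: "E face_of P" "w \<in> C" "\<phi> E = {w} \<times> {0..1}" "x \<in> E"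
      using x ext unfolding X_def vertical_edges_def by blast
    then show "x \<in> F (e i) \<or> x \<in> F (e j)"
      using cov[of E w "e i" x] cov[of E w "e j" x] einj[OF ij] by metis
  qed (use F FP eC in auto)
  moreover have "aff_dim P \<le> int (m+1)"
  proof -
    have PP: "P face_of P" using P polytope_imp_convex face_of_refl by blast
    have "aff_dim P \<le> aff_dim (\<phi> P)"
      by (rule face_lattice_iso_aff_dim_le[OF iso P convQ PP])
    also have "\<dots> \<le> aff_dim ?Q"
      using \<phi>[OF PP] by (simp add: aff_dim_subset face_of_imp_subset)
    also have "\<dots> \<le> int (card C)"
      using aff_dim_convex_hull_Times_unit_le[OF C(1) \<open>C \<noteq> {}\<close>] C(4) by simp
    finally show ?thesis using C(3) by simp
  qed
  moreover have "{x. x extreme_point_of P} \<subseteq> X"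
  proof clarify
    fix x assume "x extreme_point_of P"
    then have xP: "{x} face_of P" by (simp add: face_of_singleton)
    have ne: "\<phi> G \<noteq> {}" if G: "G face_of P" "G \<noteq> {}" for G
    proof
      assume "\<phi> G = {}"
      then have "\<phi> G \<subseteq> \<phi> {}" by simp
      then show False using le[OF G(1), of "{}"] G(2) by auto
    qed
    have emp: "\<phi> {} = {}"
    proof -
      obtain G where G: "G face_of P" "\<phi> G = {}" using surj[of "{}"] by auto
      then have "G = {}" using ne[of G] by blast
      then show ?thesis using G by simp
    qed
    have "polytope ({0..1}::real set)"
      using polytope_interval[of 0 "1::real"] by (simp add: cbox_interval)
    then have "polytope ?Q"
      using C(1,4) by (simp add: polytope_Times polytope_convex_hull)
    then have px: "polytope (\<phi> {x})"
      using \<phi>[OF xP] by (rule face_of_polytope_polytope)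
    then obtain y where y: "y extreme_point_of \<phi> {x}"
      using extreme_point_exists_convex[OF polytope_imp_compact polytope_imp_convex ne[OF xP]] by auto
    then have yx: "{y} face_of \<phi> {x}" by (simp add: face_of_singleton)
    then have yQ: "{y} face_of ?Q" using \<phi>[OF xP] face_of_trans by blast
    obtain v t where vt: "y = (v, t)" by (cases y)
    have "{v} \<times> {t} face_of ?Q" using yQ vt by simp
    then have "{v} face_of \<Delta>" "{t} face_of {0..1}"
      using face_of_Times_eq[of "{v}" "{t}" \<Delta> "{0..1}"] by auto
    then have "t \<in> {0..1}"
      using face_of_imp_subset by blast
    obtain E where E: "E face_of P" "\<phi> E = {v} \<times> {0..1}"
      using surj[OF faceT[OF \<open>{v} face_of \<Delta>\<close>]] by blast
    obtain G where G: "G face_of P" "\<phi> G = {y}" using surj[OF yQ] by blast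
    \<comment> \<open>The face with image \<open>{y}\<close> is non-empty and contained in
      \<open>{x}\<close>. Hence \<open>\<phi>\<close> sends the vertex \<open>x\<close> to a vertex,
      which lies on a vertical edge.\<close>
    have "G \<subseteq> {x}" using le[OF G(1) xP] G(2) face_of_imp_subset[OF yx] by simp
    moreover have "G \<noteq> {}" using G(2) emp by auto
    ultimately have "\<phi> {x} = {y}" using G by (metis subset_singletonD)
    then have "{x} \<subseteq> E" using le[OF xP E(1)] E(2) vt \<open>t \<in> {0..1}\<close> by auto
    then show "x \<in> X"
      using E \<open>{v} face_of \<Delta>\<close> unfolding X_def vertical_edges_def face_of_singleton by blast
  qed
  moreover have "X \<subseteq> P"
    unfolding X_def vertical_edges_def using face_of_imp_subset by blast
  ultimately show ?thesis by blast
qed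

text \<open>The \<open>d\<close> facets opposite the vertices other than \<open>v\<close> form the
  decomposition: a point of the edge from \<open>v\<close> to \<open>w\<close> can miss only the
  facet opposite \<open>w\<close>, and a vertex only the facet opposite itself.\<close>

lemma simplex_star_weak_cayley:
  fixes P :: "'a::euclidean_space set"
  assumes "int d simplex P" and v: "v extreme_point_of P"
  shows "weak_cayley P (\<Union>{E. E edge_of P \<and> v \<in> E} \<union> {x. x extreme_point_of P}) d"
proof -
  obtain C where C: "finite C" "\<not> affine_dependent C" "card C = d + 1" "P = convex hull C"
    using assms(1) unfolding simplex by fastforce
  have ext: "x extreme_point_of P \<longleftrightarrow> x \<in> C" for x
    using extreme_point_of_convex_hull_affine_independent[OF C(2)] C(4) by simp
  have vC: "v \<in> C" using v ext by blast
  have "card (C - {v}) = d" using C vC by simp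
  then obtain e where e: "bij_betw e {..<d} (C - {v})"
    using C(1) by (metis ex_bij_betw_nat_finite lessThan_atLeast0 finite_Diff)
  have eC: "e i \<in> C" "e i \<noteq> v" if "i < d" for i
    using e that unfolding bij_betw_def by blast+
  have einj: "e i \<noteq> e j" if "i < d" "j < d" "i \<noteq> j" for i j
    using e that unfolding bij_betw_def inj_on_def by blast
  define F where "F w = convex hull (C - {w})" for w
  have faces: "T face_of P \<longleftrightarrow> (\<exists>c\<subseteq>C. T = convex hull c)" for T
    using face_of_convex_hull_affine_independent[OF C(2)] C(4) by simp
  show ?thesis
    unfolding weak_cayley_def
  proof (intro exI[of _ "\<lambda>i. F (e i)"] conjI allI impI ballI)
    fix i assume i: "i < d"
    show "F (e i) face_of P" unfolding faces F_def by blast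
    have "e i \<notin> F (e i)"
      using C(2) eC[OF i] unfolding affine_dependent_def F_def
      using convex_hull_subset_affine_hull by blast
    moreover have "e i \<in> P" using eC[OF i] C(4) by (simp add: hull_inc)
    ultimately show "F (e i) \<noteq> P" by blast
  next
    fix x i j assume x: "x \<in> \<Union>{E. E edge_of P \<and> v \<in> E} \<union> {x. x extreme_point_of P}"
      and ij: "i < d" "j < d" "i \<noteq> j"
    have "\<exists>w. \<forall>u\<in>C. u \<noteq> w \<longrightarrow> u \<noteq> v \<longrightarrow> x \<in> F u"
    proof (cases "x extreme_point_of P")
      case True
      then have "x \<in> C" using ext by blast
      then show ?thesis
        by (intro exI[of _ x]) (simp add: F_def hull_inc)
    next
      case False
      then obtain E where E: "E face_of P" "aff_dim E = 1" "v \<in> E" "x \<in> E"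
        using x by (auto simp: edge_of_def)
      then obtain c where c: "c \<subseteq> C" "E = convex hull c"
        using faces by blast
      have "v extreme_point_of E"
        using v E face_of_imp_subset unfolding extreme_point_of_def by blast
      then have vc: "v \<in> c" using c(2) extreme_point_of_convex_hull by blast
      have "aff_dim c = int (card c) - 1"
        using C(2) c(1) affine_dependent_subset affine_independent_iff_card by blast
      then have "card c = 2" using E(2) c(2) by (simp add: aff_dim_convex_hull)
      then obtain w where w: "c = {v, w}"
        using vc by (metis card_2_iff doubleton_eq_iff insertE singletonD)
      have "x \<in> F u" if "u \<noteq> w" "u \<noteq> v" for u
      proof -
        have "c \<subseteq> C - {u}" using c(1) w that by blast
        then show ?thesis using hull_mono[of c "C - {u}" convex] E(4) c(2) by (auto simp: F_def)
      qed
      then show ?thesis by blast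
    qed
    then show "x \<in> F (e i) \<or> x \<in> F (e j)"
      using eC einj ij by metis
  qed
qed

lemma degree_le_one_prism_pyramid:
  fixes A :: "'a::euclidean_space set"
  assumes "finite A" "(polytope_pyramid ^^ k) (convex hull A) P" "prism_over_simplex \<Delta> \<phi> P"
    "nonvertex_points A \<subseteq> \<Union>(vertical_edges \<Delta> \<phi> P)"
  shows "degree_le_one A"
proof -
  obtain n where n: "weak_cayley P (\<Union>(vertical_edges \<Delta> \<phi> P)) n" "aff_dim P \<le> int n"
    "{x. x extreme_point_of P} \<subseteq> \<Union>(vertical_edges \<Delta> \<phi> P)" "\<Union>(vertical_edges \<Delta> \<phi> P) \<subseteq> P"
    using prism_weak_cayley[OF assms(3)] by blast
  have "polytope P" using assms(3) by (simp add: prism_over_simplex_def)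
  from polytope_pyramid_weak_cayley[OF assms(2) n(1,4,3) this] obtain Y where
    Y: "\<Union>(vertical_edges \<Delta> \<phi> P) \<subseteq> Y" "{x. x extreme_point_of (convex hull A)} \<subseteq> Y"
      "weak_cayley (convex hull A) Y (n + k)" "aff_dim (convex hull A) = aff_dim P + int k"
    by blast
  have "A \<subseteq> Y"
    using assms(4) Y(1,2) unfolding nonvertex_points_def by blast
  then have "weak_cayley (convex hull A) A (n + k)"
    by (rule weak_cayley_mono[OF Y(3)])
  moreover have "aff_dim A \<le> int (n + k)"
    using Y(4) n(2) by (simp add: aff_dim_convex_hull)
  ultimately show ?thesis
    by (rule weak_cayley_degree_le_one[OF assms(1)])
qed

lemma degree_le_one_simplex_star:
  fixes A :: "'a::euclidean_space set"
  assumes "finite A" "int d simplex (convex hull A)" "v extreme_point_of (convex hull A)"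
    "nonvertex_points A \<subseteq> \<Union>{E. E edge_of (convex hull A) \<and> v \<in> E}"
  shows "degree_le_one A"
proof -
  have "A \<subseteq> \<Union>{E. E edge_of (convex hull A) \<and> v \<in> E} \<union> {x. x extreme_point_of (convex hull A)}"
    using assms(4) unfolding nonvertex_points_def by blast
  then have "weak_cayley (convex hull A) A d"
    by (rule weak_cayley_mono[OF simplex_star_weak_cayley[OF assms(2,3)]])
  moreover have "aff_dim A \<le> int d"
    using aff_dim_simplex[OF assms(2)] by (simp add: aff_dim_convex_hull)
  ultimately show ?thesis
    by (rule weak_cayley_degree_le_one[OF assms(1)])
qed

section \<open>Face lattices of prisms\<close>

text \<open>Moving one point of \<open>G\<close> to the origin turns affine into linear
  independence, where prescribed values extend to a linear form; the adjoint at 1 represents this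
  form as an inner product.\<close>

lemma affine_functional_exists:
  fixes G :: "'a::euclidean_space set" and h :: "'a \<Rightarrow> real"
  assumes "\<not> affine_dependent G"
  shows "\<exists>w e. \<forall>g\<in>G. w \<bullet> g + e = h g"
proof (cases "G = {}")
  case False
  then obtain a where a: "a \<in> G" by blast
  have "independent ((\<lambda>x. - a + x) ` (G - {a}))"
    using affine_dependent_iff_dependent2[OF a] assms by blast
  then obtain F :: "'a \<Rightarrow> real" where F: "linear F" "\<And>y. y \<in> (\<lambda>x. - a + x) ` (G - {a}) \<Longrightarrow> F y = h (y + a) - h a"
    using linear_independent_extend[of "(\<lambda>x. - a + x) ` (G - {a})" "\<lambda>y. h (y + a) - h a"] by blast
  have w: "adjoint F 1 \<bullet> x = F x" for x
    using adjoint_works[OF F(1), of x 1] by (simp add: inner_commute)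
  have "F (g - a) = h g - h a" if "g \<in> G" for g
  proof (cases "g = a")
    case True
    then show ?thesis using F(1) by (simp add: linear_0)
  next
    case False
    then have "g - a \<in> (\<lambda>x. - a + x) ` (G - {a})" using that by force
    then show ?thesis using F(2)[of "g - a"] by simp
  qed
  then have "\<forall>g\<in>G. adjoint F 1 \<bullet> g + (h a - F a) = h g"
    unfolding w linear_diff[OF F(1)] by (metis add_diff_eq diff_add_cancel add.commute)
  then show ?thesis by blast
qed simp

text \<open>For finite \<open>V\<close> a face is the hull of its trace on \<open>V\<close>, so this
  family of subsets is a combinatorial model of the face lattice. Two polytopes can then be compared
  through a map between their generating points.\<close>

definition face_traces :: "'a::euclidean_space set \<Rightarrow> 'a set set" where
  "face_traces V = {F \<inter> V | F. F face_of convex hull V}"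

lemma face_trace_of_functional:
  fixes V :: "'a::euclidean_space set"
  assumes "\<And>v. v \<in> V \<Longrightarrow> 0 \<le> w \<bullet> v + e"
  shows "{v \<in> V. w \<bullet> v + e = 0} \<in> face_traces V"
proof -
  have "convex hull V \<subseteq> {x. w \<bullet> x \<ge> - e}"
  proof (rule hull_minimal)
    show "V \<subseteq> {x. w \<bullet> x \<ge> - e}"
      using assms by (force simp: minus_le_iff)
  qed (rule convex_halfspace_ge)
  then have "convex hull V \<inter> {x. w \<bullet> x = - e} face_of convex hull V"
    by (intro face_of_Int_supporting_hyperplane_ge) auto
  moreover have "{v \<in> V. w \<bullet> v + e = 0} = convex hull V \<inter> {x. w \<bullet> x = - e} \<inter> V"
    using hull_subset[of V convex] by (auto simp: eq_neg_iff_add_eq_0)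
  ultimately show ?thesis unfolding face_traces_def by blast
qed

lemma face_eq_convex_hull_trace:
  fixes V :: "'a::euclidean_space set"
  assumes "finite V" "F face_of convex hull V"
  shows "F = convex hull (F \<inter> V)"
proof -
  obtain S where S: "S \<subseteq> V" "F = convex hull S"
    using face_of_convex_hull_subset[OF finite_imp_compact[OF assms(1)] assms(2)] by blast
  then have "S \<subseteq> F \<inter> V" using hull_subset[of S convex] by blast
  then have "F \<subseteq> convex hull (F \<inter> V)" using hull_mono[of S "F \<inter> V" convex] S(2) by simp
  moreover have "convex hull (F \<inter> V) \<subseteq> F"
    using assms(2) by (intro hull_minimal) (auto simp: face_of_imp_convex)
  ultimately show ?thesis by blast
qed

lemma face_lattice_iso_of_traces:
  fixes V :: "'a::euclidean_space set" and W :: "'b::euclidean_space set"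
  assumes fin: "finite V" "finite W" and inj: "inj_on g V"
    and traces: "(`) g ` face_traces V = face_traces W"
  shows "face_lattice_iso (\<lambda>F. convex hull (g ` (F \<inter> V))) (convex hull V) (convex hull W)"
proof -
  define \<phi> where "\<phi> F = convex hull (g ` (F \<inter> V))" for F
  have \<phi>: "\<phi> F face_of convex hull W" "\<phi> F \<inter> W = g ` (F \<inter> V)" if F: "F face_of convex hull V" for F
  proof -
    have "g ` (F \<inter> V) \<in> face_traces W" using F traces unfolding face_traces_def by blast
    then obtain G where G: "G face_of convex hull W" "G \<inter> W = g ` (F \<inter> V)"
      unfolding face_traces_def by auto
    then have "\<phi> F = G"
      using face_eq_convex_hull_trace[OF fin(2) G(1)] by (simp add: \<phi>_def)
    then show "\<phi> F face_of convex hull W" "\<phi> F \<inter> W = g ` (F \<inter> V)" using G by auto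
  qed
  have le: "F \<subseteq> G \<longleftrightarrow> \<phi> F \<subseteq> \<phi> G" if F: "F face_of convex hull V" and G: "G face_of convex hull V" for F G
  proof
    assume "F \<subseteq> G"
    then show "\<phi> F \<subseteq> \<phi> G" unfolding \<phi>_def by (intro hull_mono image_mono) blast
  next
    assume "\<phi> F \<subseteq> \<phi> G"
    then have "g ` (F \<inter> V) \<subseteq> g ` (G \<inter> V)" using \<phi>(2)[OF F] \<phi>(2)[OF G] by blast
    then have "F \<inter> V \<subseteq> G \<inter> V" using inj by (simp add: inj_on_image_subset_iff)
    then show "F \<subseteq> G"
      using face_eq_convex_hull_trace[OF fin(1) F] face_eq_convex_hull_trace[OF fin(1) G]
        hull_mono[of "F \<inter> V" "G \<inter> V" convex] by simp
  qed
  have surj: "\<exists>F. F face_of convex hull V \<and> G = \<phi> F" if G: "G face_of convex hull W" for G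
  proof -
    have "G \<inter> W \<in> (`) g ` face_traces V" unfolding traces using G unfolding face_traces_def by blast
    then obtain F where "F face_of convex hull V" "G \<inter> W = g ` (F \<inter> V)"
      unfolding face_traces_def by auto
    then show ?thesis
      using face_eq_convex_hull_trace[OF fin(2) G] by (auto simp: \<phi>_def)
  qed
  have "inj_on \<phi> {F. F face_of convex hull V}"
  proof (rule inj_onI)
    fix F G assume "F \<in> {F. F face_of convex hull V}" "G \<in> {F. F face_of convex hull V}" "\<phi> F = \<phi> G"
    then show "F = G" using le[of F G] le[of G F] by simp
  qed
  moreover have "\<phi> ` {F. F face_of convex hull V} = {G. G face_of convex hull W}"
    using \<phi>(1) surj by auto
  ultimately show ?thesis
    unfolding face_lattice_iso_def bij_betw_def \<phi>_def[abs_def, symmetric] using le by blast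
qed

text \<open>The lines through \<open>p j\<close> and \<open>q j\<close> all pass through the point with homogeneous coordinates
  \<open>(u, \<eta>)\<close>, which is a direction if \<open>\<eta> = 0\<close>.\<close>

locale prism_vertices =
  fixes J :: "'j set" and p q :: "'j \<Rightarrow> 'a::euclidean_space" and l m :: "'j \<Rightarrow> real" and u :: 'a and \<eta> :: real
  assumes finite_J: "finite J"
    and l_pos: "j \<in> J \<Longrightarrow> l j > 0" and m_pos: "j \<in> J \<Longrightarrow> m j > 0"
    and point_eq: "j \<in> J \<Longrightarrow> m j *\<^sub>R q j - l j *\<^sub>R p j = u"
    and height_eq: "j \<in> J \<Longrightarrow> m j - l j = \<eta>"
    and functional: "(\<And>j. j \<in> J \<Longrightarrow> m j * \<beta> j - l j * \<alpha> j = c) \<Longrightarrow>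
      \<exists>w e. \<forall>j\<in>J. w \<bullet> p j + e = \<alpha> j \<and> w \<bullet> q j + e = \<beta> j"
begin

text \<open>The locale lets values be prescribed at all \<open>p j\<close> and \<open>q j\<close> as
  soon as \<open>m j * \<beta> j - l j * \<alpha> j\<close> is a constant \<open>c\<close>. The
  choices \<open>c = 0\<close>, \<open>1\<close> and \<open>- 1\<close> give non-negative
  functionals vanishing exactly on the vertical edges over \<open>X\<close>, on the
  \<open>p\<close>-ends over \<open>X\<close> and on the \<open>q\<close>-ends over
  \<open>X\<close>.\<close>

lemma functional_both: "\<exists>w e. \<forall>j\<in>J. w \<bullet> p j + e = (if j \<in> X then 0 else m j) \<and> w \<bullet> q j + e = (if j \<in> X then 0 else l j)"
  by (rule functional[of _ _ 0]) auto

lemma functional_bottom: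
  "\<exists>w e. \<forall>j\<in>J. w \<bullet> p j + e = (if j \<in> X then 0 else 1) \<and> w \<bullet> q j + e = (if j \<in> X then 1 / m j else (1 + l j) / m j)"
  by (rule functional[of _ _ 1]) (use m_pos in fastforce)

lemma functional_top:
  "\<exists>w e. \<forall>j\<in>J. w \<bullet> p j + e = (if j \<in> X then 1 / l j else (1 + m j) / l j) \<and> w \<bullet> q j + e = (if j \<in> X then 0 else 1)"
  by (rule functional[of _ _ "- 1"]) (use l_pos in fastforce)

lemma p_neq_q:
  assumes "i \<in> J" "j \<in> J"
  shows "p i \<noteq> q j"
proof
  assume eq: "p i = q j"
  obtain w e where "\<forall>j\<in>J. w \<bullet> p j + e = (if j \<in> J then 0 else 1) \<and> w \<bullet> q j + e = (if j \<in> J then 1 / m j else (1 + l j) / m j)"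
    using functional_bottom[of J] by blast
  then have "w \<bullet> p i + e = 0" "w \<bullet> q j + e = 1 / m j" using assms by auto
  then show False using eq m_pos[OF assms(2)] by simp
qed

lemma inj_p: "inj_on p J" and inj_q: "inj_on q J"
proof -
  have "p i \<noteq> p j \<and> q i \<noteq> q j" if ij: "i \<in> J" "j \<in> J" "i \<noteq> j" for i j
  proof -
    obtain w e where "\<forall>k\<in>J. w \<bullet> p k + e = (if k \<in> {i} then 0 else m k) \<and> w \<bullet> q k + e = (if k \<in> {i} then 0 else l k)"
      using functional_both[of "{i}"] by blast
    then have "w \<bullet> p i + e = 0" "w \<bullet> q i + e = 0" "w \<bullet> p j + e = m j" "w \<bullet> q j + e = l j"
      using ij by auto
    then show ?thesis using l_pos[OF ij(2)] m_pos[OF ij(2)] by auto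
  qed
  then show "inj_on p J" "inj_on q J" unfolding inj_on_def by blast+
qed

text \<open>Every set on the right is the zero set of one of the three functionals above.
  Conversely, subtracting the relations for \<open>i\<close> and \<open>j\<close> gives
  \<open>m i q i + l j p j = m j q j + l i p i\<close> with positive coefficients of equal sum. So
  the segments from \<open>q i\<close> to \<open>p j\<close> and from \<open>q j\<close> to
  \<open>p i\<close> cross, and a face containing \<open>p i\<close> and \<open>q j\<close> also
  contains \<open>q i\<close> and \<open>p j\<close>.\<close>

lemma face_traces_eq:
  "face_traces (p ` J \<union> q ` J) = {p ` X | X. X \<subseteq> J} \<union> {q ` X | X. X \<subseteq> J} \<union> {p ` X \<union> q ` X | X. X \<subseteq> J}"
  (is "?L = ?R")
proof
  show "?L \<subseteq> ?R"
  proof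
    fix T assume "T \<in> ?L"
    then obtain F where F: "F face_of convex hull (p ` J \<union> q ` J)" "T = F \<inter> (p ` J \<union> q ` J)"
      unfolding face_traces_def by blast
    define X where "X = {j \<in> J. p j \<in> F}"
    define Y where "Y = {j \<in> J. q j \<in> F}"
    have T: "T = p ` X \<union> q ` Y" unfolding F(2) X_def Y_def by blast
    have XY: "j \<in> X \<and> i \<in> Y" if ij: "i \<in> X" "j \<in> Y" for i j
    proof -
      have J: "i \<in> J" "j \<in> J" and inF: "p i \<in> F" "q j \<in> F" using ij by (auto simp: X_def Y_def)
      let ?s = "m i + l j"
      have s: "?s = m j + l i" "?s > 0"
        using height_eq[OF J(1)] height_eq[OF J(2)] m_pos[OF J(1)] l_pos[OF J(2)] by auto
      \<comment> \<open>The crossing point of the two segments.\<close>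
      define x where "x = (m i / ?s) *\<^sub>R q i + (l j / ?s) *\<^sub>R p j"
      have "?s *\<^sub>R x = m i *\<^sub>R q i + l j *\<^sub>R p j"
        using s(2) by (simp add: x_def scaleR_add_right)
      also have "\<dots> = m j *\<^sub>R q j + l i *\<^sub>R p i"
        using point_eq[OF J(1)] point_eq[OF J(2)] by (simp add: algebra_simps)
      finally have "x = (1 / ?s) *\<^sub>R (m j *\<^sub>R q j + l i *\<^sub>R p i)"
        using s(2) by (metis (no_types, lifting) divide_inverse less_irrefl mult_1 real_vector_affinity_eq scaleR_left_imp_eq inverse_eq_divide scaleR_one scaleR_scaleR left_inverse)
      then have "x = (m j / ?s) *\<^sub>R q j + (l i / ?s) *\<^sub>R p i"
        by (simp add: scaleR_add_right)
      moreover have "m j / ?s + l i / ?s = 1"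
        using s by (simp add: add_divide_distrib[symmetric])
      ultimately have xF: "x \<in> F"
        using inF face_of_imp_convex[OF F(1)] m_pos[OF J(2)] l_pos[OF J(1)] s(2)
        by (simp add: convex_def)
      have "m i / ?s = 1 - l j / ?s" using s(2) by (simp add: field_simps)
      then have "x \<in> open_segment (q i) (p j)"
        unfolding in_segment x_def using p_neq_q[OF J(2,1)] m_pos[OF J(1)] l_pos[OF J(2)] s(2)
        by (intro conjI exI[of _ "l j / ?s"]) auto
      then have "q i \<in> F \<and> p j \<in> F"
        using face_ofD[OF F(1)] xF J by (meson UnI1 UnI2 hull_inc imageI)
      then show ?thesis using J by (simp add: X_def Y_def)
    qed
    \<comment> \<open>If both ends occur in the face, the exchange property forces the same indices
      at both ends.\<close>
    consider "X = {}" | "Y = {}" | "X = Y"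
      using XY by blast
    then show "T \<in> ?R"
    proof cases
      case 1
      then have "T = q ` Y" "Y \<subseteq> J" using T by (auto simp: Y_def)
      then show ?thesis by blast
    next
      case 2
      then have "T = p ` X" "X \<subseteq> J" using T by (auto simp: X_def)
      then show ?thesis by blast
    next
      case 3
      then have "T = p ` X \<union> q ` X" "X \<subseteq> J" using T by (auto simp: X_def)
      then show ?thesis by blast
    qed
  qed
  have nonneg: "0 \<le> l j" "0 \<le> m j" "l j \<noteq> 0" "m j \<noteq> 0" "1 + l j > 0" "1 + m j > 0" if "j \<in> J" for j
    using l_pos[OF that] m_pos[OF that] by auto
  show "?R \<subseteq> ?L"
  proof -
    have "p ` X \<in> ?L" if X: "X \<subseteq> J" for X
    proof -
      obtain w e where w: "\<And>j. j \<in> J \<Longrightarrow> w \<bullet> p j + e = (if j \<in> X then 0 else 1) \<and>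
          w \<bullet> q j + e = (if j \<in> X then 1 / m j else (1 + l j) / m j)"
        using functional_bottom[of X] by blast
      have qpos: "w \<bullet> q j + e > 0" if "j \<in> J" for j
        using w[OF that] nonneg[OF that] m_pos[OF that] by auto
      have "{v \<in> p ` J \<union> q ` J. w \<bullet> v + e = 0} = p ` X"
        using w qpos X by (fastforce split: if_splits)
      moreover have "{v \<in> p ` J \<union> q ` J. w \<bullet> v + e = 0} \<in> ?L"
        using w qpos by (intro face_trace_of_functional) (auto intro: less_imp_le)
      ultimately show ?thesis by simp
    qed
    moreover have "q ` X \<in> ?L" if X: "X \<subseteq> J" for X
    proof -
      obtain w e where w: "\<And>j. j \<in> J \<Longrightarrow> w \<bullet> p j + e = (if j \<in> X then 1 / l j else (1 + m j) / l j) \<and>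
          w \<bullet> q j + e = (if j \<in> X then 0 else 1)"
        using functional_top[of X] by blast
      have ppos: "w \<bullet> p j + e > 0" if "j \<in> J" for j
        using w[OF that] nonneg[OF that] l_pos[OF that] by auto
      have "{v \<in> p ` J \<union> q ` J. w \<bullet> v + e = 0} = q ` X"
        using w ppos X by (fastforce split: if_splits)
      moreover have "{v \<in> p ` J \<union> q ` J. w \<bullet> v + e = 0} \<in> ?L"
        using w ppos by (intro face_trace_of_functional) (auto intro: less_imp_le)
      ultimately show ?thesis by simp
    qed
    moreover have "p ` X \<union> q ` X \<in> ?L" if X: "X \<subseteq> J" for X
    proof -
      obtain w e where w: "\<And>j. j \<in> J \<Longrightarrow> w \<bullet> p j + e = (if j \<in> X then 0 else m j) \<and>
          w \<bullet> q j + e = (if j \<in> X then 0 else l j)"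
        using functional_both[of X] by blast
      have "{v \<in> p ` J \<union> q ` J. w \<bullet> v + e = 0} = p ` X \<union> q ` X"
      proof -
        have "w \<bullet> p j + e = 0 \<longleftrightarrow> j \<in> X" "w \<bullet> q j + e = 0 \<longleftrightarrow> j \<in> X" if "j \<in> J" for j
          using w[OF that] nonneg[OF that] by (auto split: if_splits)
        then show ?thesis using X by blast
      qed
      moreover have "{v \<in> p ` J \<union> q ` J. w \<bullet> v + e = 0} \<in> ?L"
        using w nonneg by (intro face_trace_of_functional) auto
      ultimately show ?thesis by simp
    qed
    ultimately show ?thesis by blast
  qed
qed

end

text \<open>Affine independence leaves the values at all \<open>p j\<close> and at
  \<open>q j0\<close> free. The relation for \<open>j0\<close> then makes the functional take the
  value \<open>c\<close> on the homogeneous vector (\<open>u\<close>, \<open>\<eta>\<close>), and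
  the relations for the other indices force the desired values at \<open>q j\<close>.\<close>

lemma prism_vertices_functional:
  fixes p q :: "'j \<Rightarrow> 'a::euclidean_space"
  assumes lm: "\<And>j. j \<in> J \<Longrightarrow> m j > 0" "\<And>j. j \<in> J \<Longrightarrow> m j *\<^sub>R q j - l j *\<^sub>R p j = u"
      "\<And>j. j \<in> J \<Longrightarrow> m j - l j = \<eta>"
    and j0: "j0 \<in> J" and inj: "inj_on p J" "q j0 \<notin> p ` J"
    and ind: "\<not> affine_dependent (insert (q j0) (p ` J))"
    and c: "\<And>j. j \<in> J \<Longrightarrow> m j * \<beta> j - l j * \<alpha> j = c"
  shows "\<exists>w e. \<forall>j\<in>J. w \<bullet> p j + e = \<alpha> j \<and> w \<bullet> q j + e = \<beta> j"
proof -
  define h where "h x = (if x = q j0 then \<beta> j0 else \<alpha> (the_inv_into J p x))" for x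
  obtain w e where we: "\<And>g. g \<in> insert (q j0) (p ` J) \<Longrightarrow> w \<bullet> g + e = h g"
    using affine_functional_exists[OF ind, of h] by blast
  have p: "w \<bullet> p j + e = \<alpha> j" if "j \<in> J" for j
  proof -
    have "p j \<noteq> q j0" using that inj(2) by (metis imageI)
    then show ?thesis using we[of "p j"] that inj(1) by (simp add: h_def the_inv_into_f_f)
  qed
  have "w \<bullet> q j0 + e = \<beta> j0"
    using we[of "q j0"] by (simp add: h_def)
  moreover have u: "m j * (w \<bullet> q j + e) - l j * (w \<bullet> p j + e) = w \<bullet> u + \<eta> * e" if "j \<in> J" for j
    unfolding lm(2)[OF that, symmetric] lm(3)[OF that, symmetric] by (simp add: inner_diff_right algebra_simps)
  ultimately have ue: "w \<bullet> u + \<eta> * e = c"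
    using c[OF j0] p[OF j0] u[OF j0] by simp
  have "w \<bullet> q j + e = \<beta> j" if "j \<in> J" for j
  proof -
    have "m j * (w \<bullet> q j + e) = m j * \<beta> j"
      using u[OF that] ue c[OF that] unfolding p[OF that] by linarith
    then show ?thesis using lm(1)[OF that] by simp
  qed
  then show ?thesis using p by blast
qed

lemma (in prism_vertices) prism_over_simplex_exists:
  assumes "J \<noteq> {}" and ind: "\<not> affine_dependent (p ` J)"
  shows "\<exists>\<Delta> \<phi>. prism_over_simplex \<Delta> \<phi> (convex hull (p ` J \<union> q ` J)) \<and>
    (\<forall>j\<in>J. convex hull {p j, q j} \<in> vertical_edges \<Delta> \<phi> (convex hull (p ` J \<union> q ` J)))"
proof -
  let ?V = "p ` J \<union> q ` J"
  define p' where "p' j = (p j, 0::real)" for j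
  define q' where "q' j = (p j, 1::real)" for j
  let ?W = "p' ` J \<union> q' ` J"
  interpret std: prism_vertices J p' q' "\<lambda>_. 1" "\<lambda>_. 1" "(0, 1)" 0
  proof
    fix \<alpha> \<beta> :: "'j \<Rightarrow> real" and c
    assume c: "\<And>j. j \<in> J \<Longrightarrow> 1 * \<beta> j - 1 * \<alpha> j = c"
    obtain w e where we: "\<And>g. g \<in> p ` J \<Longrightarrow> w \<bullet> g + e = \<alpha> (the_inv_into J p g)"
      using affine_functional_exists[OF ind, of "\<lambda>g. \<alpha> (the_inv_into J p g)"] by blast
    then have "w \<bullet> p j + e = \<alpha> j" if "j \<in> J" for j
      using that inj_p by (simp add: the_inv_into_f_f)
    \<comment> \<open>The constant difference \<open>c\<close> between top and bottom values is the
      slope in the vertical coordinate.\<close>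
    then have "\<forall>j\<in>J. (w, c) \<bullet> p' j + e = \<alpha> j \<and> (w, c) \<bullet> q' j + e = \<beta> j"
      using c by (force simp: p'_def q'_def)
    then show "\<exists>w e. \<forall>j\<in>J. w \<bullet> p' j + e = \<alpha> j \<and> w \<bullet> q' j + e = \<beta> j" by blast
  qed (auto simp: finite_J p'_def q'_def)
  define g where "g x = (if x \<in> p ` J then (x, 0) else q' (the_inv_into J q x))" for x
  have gp: "g (p j) = p' j" and gq: "g (q j) = q' j" if "j \<in> J" for j
  proof -
    show "g (p j) = p' j" using that by (simp add: g_def p'_def)
    have "q j \<notin> p ` J" using p_neq_q that by force
    then show "g (q j) = q' j" using that inj_q by (simp add: g_def the_inv_into_f_f)
  qed
  have gX: "g ` p ` X = p' ` X" "g ` q ` X = q' ` X" if "X \<subseteq> J" for X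
    using that gp gq by (force simp: image_image)+
  have inj: "inj_on g ?V"
  proof (rule inj_onI)
    fix x y assume x: "x \<in> ?V" and y: "y \<in> ?V" and eq: "g x = g y"
    consider i j where "i \<in> J" "j \<in> J" "x = p i" "y = p j" | i j where "i \<in> J" "j \<in> J" "x = p i" "y = q j"
      | i j where "i \<in> J" "j \<in> J" "x = q i" "y = p j" | i j where "i \<in> J" "j \<in> J" "x = q i" "y = q j"
      using x y by blast
    then show "x = y"
    proof cases
      case 1 then show ?thesis using eq gp by (simp add: p'_def)
    next
      case 2 then show ?thesis using eq gp gq by (simp add: p'_def q'_def)
    next
      case 3 then show ?thesis using eq gp gq by (simp add: p'_def q'_def)
    next
      case 4 then show ?thesis using eq gq inj_p by (simp add: q'_def inj_on_eq_iff)
    qed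
  qed
  have traces: "(`) g ` face_traces ?V = face_traces ?W"
  proof
    show "(`) g ` face_traces ?V \<subseteq> face_traces ?W"
      unfolding face_traces_eq std.face_traces_eq by (auto simp: image_Un gX)
    show "face_traces ?W \<subseteq> (`) g ` face_traces ?V"
    proof
      fix T assume "T \<in> face_traces ?W"
      then obtain X where X: "X \<subseteq> J" "T = p' ` X \<or> T = q' ` X \<or> T = p' ` X \<union> q' ` X"
        unfolding std.face_traces_eq by blast
      then have "T = g ` (p ` X) \<or> T = g ` (q ` X) \<or> T = g ` (p ` X \<union> q ` X)"
        by (simp add: image_Un gX)
      then show "T \<in> (`) g ` face_traces ?V"
        using X(1) unfolding face_traces_eq by blast
    qed
  qed
  define \<phi> where "\<phi> F = convex hull (g ` (F \<inter> ?V))" for F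
  define \<Delta> where "\<Delta> = convex hull (p ` J)"
  have unit: "convex hull {0, 1} = {0..1::real}"
    by (metis closed_segment_eq_real_ivl segment_convex_hull zero_le_one)
  have W: "convex hull ?W = \<Delta> \<times> {0..1}"
  proof -
    have "?W = p ` J \<times> {0, 1}" by (auto simp: p'_def q'_def)
    then show ?thesis by (simp only: convex_hull_Times unit \<Delta>_def)
  qed
  have "face_lattice_iso \<phi> (convex hull ?V) (\<Delta> \<times> {0..1})"
    unfolding \<phi>_def W[symmetric] using finite_J by (intro face_lattice_iso_of_traces inj traces) auto
  moreover have "int (card J - 1) simplex \<Delta>"
    unfolding \<Delta>_def using ind assms(1) finite_J inj_p
    by (intro simplex_convex_hull) (simp add: card_image of_nat_diff Suc_leI card_gt_0_iff)
  ultimately have "prism_over_simplex \<Delta> \<phi> (convex hull ?V)"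
    unfolding prism_over_simplex_def using finite_J by (auto intro: polytope_convex_hull)
  moreover have "convex hull {p j, q j} \<in> vertical_edges \<Delta> \<phi> (convex hull ?V)" if j: "j \<in> J" for j
  proof -
    have "p ` {j} \<union> q ` {j} \<in> face_traces ?V"
      unfolding face_traces_eq using j by blast
    then obtain F where F: "F face_of convex hull ?V" "F \<inter> ?V = {p j, q j}"
      unfolding face_traces_def by auto
    have "F = convex hull {p j, q j}"
      using face_eq_convex_hull_trace[OF _ F(1)] finite_J F(2) by simp
    moreover have "\<phi> F = {p j} \<times> {0..1}"
    proof -
      have "\<phi> F = convex hull {p' j, q' j}"
        unfolding \<phi>_def F(2) using gp gq j by simp
      also have "{p' j, q' j} = {p j} \<times> {0, 1}" by (auto simp: p'_def q'_def)
      finally show ?thesis by (simp only: convex_hull_Times unit convex_hull_singleton)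
    qed
    moreover have "p j extreme_point_of \<Delta>"
      unfolding \<Delta>_def using extreme_point_of_convex_hull_affine_independent[OF ind] j by blast
    ultimately show ?thesis
      unfolding vertical_edges_def using F(1) by blast
  qed
  ultimately show ?thesis by blast
qed

section \<open>Iterated pyramids over a base with independent apices\<close>

lemma not_in_hull_if_independent_insert:
  fixes G :: "'a::euclidean_space set"
  assumes "\<not> affine_dependent (insert k G)" "k \<notin> G"
  shows "k \<notin> affine hull G"
  using assms unfolding affine_dependent_def by (metis Diff_insert_absorb insertI1)

text \<open>The base \<open>V\<close> may be affinely dependent; the independent set
  \<open>G\<close> with the same affine hull replaces it when apices are tested.\<close>

lemma pyramid_apex_not_in_hull:
  fixes G :: "'a::euclidean_space set"
  assumes "\<not> affine_dependent (G \<union> insert k K)" "k \<notin> G \<union> K" "affine hull V = affine hull G"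
  shows "k \<notin> affine hull (V \<union> K)"
proof -
  have "affine hull (V \<union> K) = affine hull (G \<union> K)"
    by (metis assms(3) hull_Un_left)
  moreover have "k \<notin> affine hull (G \<union> K)"
    using assms(1,2) by (intro not_in_hull_if_independent_insert) auto
  ultimately show ?thesis by simp
qed

lemma config_pyramid_iterate:
  fixes G :: "'a::euclidean_space set"
  assumes "finite K" "\<not> affine_dependent (G \<union> K)" "G \<inter> K = {}" "affine hull V = affine hull G"
  shows "(config_pyramid ^^ card K) (V \<union> K) V"
  using assms(1-3)
proof (induction K)
  case (insert k K)
  have "\<not> affine_dependent (G \<union> K)"
    using insert.prems(1) affine_dependent_subset[of "G \<union> K" "G \<union> insert k K"] by blast
  then have "(config_pyramid ^^ card K) (V \<union> K) V"
    using insert by blast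
  moreover have "k \<notin> affine hull (V \<union> K)"
    using insert assms(4) by (intro pyramid_apex_not_in_hull) auto
  then have "config_pyramid (V \<union> insert k K) (V \<union> K)"
    unfolding config_pyramid_def by auto
  ultimately show ?case
    using insert.hyps relpowp_Suc_I2[of config_pyramid "V \<union> insert k K" "V \<union> K" "card K" V] by simp
qed simp

lemma polytope_pyramid_iterate:
  fixes G :: "'a::euclidean_space set"
  assumes "finite K" "\<not> affine_dependent (G \<union> K)" "G \<inter> K = {}" "affine hull V = affine hull G" "finite V"
  shows "(polytope_pyramid ^^ card K) (convex hull (V \<union> K)) (convex hull V)"
  using assms(1-3)
proof (induction K)
  case (insert k K)
  have "\<not> affine_dependent (G \<union> K)"
    using insert.prems(1) affine_dependent_subset[of "G \<union> K" "G \<union> insert k K"] by blast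
  then have "(polytope_pyramid ^^ card K) (convex hull (V \<union> K)) (convex hull V)"
    using insert by blast
  moreover have "k \<notin> affine hull (convex hull (V \<union> K))"
    unfolding affine_hull_convex_hull
    using insert assms(4) by (intro pyramid_apex_not_in_hull) auto
  moreover have "convex hull (V \<union> insert k K) = convex hull (convex hull (V \<union> K) \<union> {k})"
    by (metis Un_insert_right hull_insert insert_is_Un sup_commute)
  ultimately have "polytope_pyramid (convex hull (V \<union> insert k K)) (convex hull (V \<union> K))"
    unfolding polytope_pyramid_def using insert.hyps(1) assms(5) by (auto intro: polytope_convex_hull)
  then show ?case
    using insert.hyps \<open>(polytope_pyramid ^^ card K) (convex hull (V \<union> K)) (convex hull V)\<close>
      relpowp_Suc_I2[of polytope_pyramid "convex hull (V \<union> insert k K)" "convex hull (V \<union> K)" "card K" "convex hull V"]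
    by simp
qed simp

section \<open>From rays or lines through a common point to simplices and prisms\<close>

lemma independent_if_card_le:
  fixes G :: "'a::euclidean_space set"
  assumes "finite G" "int (card G) \<le> aff_dim G + 1"
  shows "\<not> affine_dependent G"
  using assms aff_dim_le_card[OF assms(1)] by (auto simp: affine_independent_iff_card)

text \<open>The farthest point of \<open>A\<close> on each ray from \<open>v\<close>, together with
  \<open>v\<close>, generates the hull. These are at most \<open>aff_dim A + 1\<close> points, so
  they are affinely independent, and all of \<open>A\<close> lies on the edges at
  \<open>v\<close>.\<close>

lemma simplex_star_exists:
  fixes A :: "'a::euclidean_space set"
  assumes A: "finite A" and v: "v \<in> A" and J: "J \<subseteq> A" "int (card J) = aff_dim A"
    and rays: "\<And>x. x \<in> A \<Longrightarrow> \<exists>j\<in>J. \<exists>t\<ge>0. x = (1 - t) *\<^sub>R v + t *\<^sub>R j"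
  shows "aff_dim A simplex (convex hull A) \<and>
    (\<exists>v. v extreme_point_of (convex hull A) \<and> nonvertex_points A \<subseteq> \<Union>{E. E edge_of (convex hull A) \<and> v \<in> E})"
proof -
  have finJ: "finite J" using A J(1) finite_subset by blast
  define ray where "ray j t = (1 - t) *\<^sub>R v + t *\<^sub>R j" for j t
  have ray_diff: "ray j t - v = t *\<^sub>R (j - v)" for j t
    by (simp add: ray_def algebra_simps)
  \<comment> \<open>Otherwise all rays would stay in the affine hull of \<open>J\<close>, whose
    dimension is less than \<open>card J\<close>.\<close>
  have "v \<notin> J"
  proof
    assume "v \<in> J"
    have "A \<subseteq> affine hull J"
    proof
      fix x assume "x \<in> A"
      then obtain j t where "j \<in> J" "x = (1 - t) *\<^sub>R v + t *\<^sub>R j" using rays by blast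
      moreover have "(1 - t) *\<^sub>R v + t *\<^sub>R j \<in> affine hull J"
        using \<open>v \<in> J\<close> \<open>j \<in> J\<close> by (intro mem_affine[OF affine_affine_hull]) (auto intro: hull_inc)
      ultimately show "x \<in> affine hull J" by simp
    qed
    then have "aff_dim A \<le> aff_dim J" by (metis aff_dim_affine_hull aff_dim_subset)
    also have "\<dots> \<le> int (card J) - 1" using finJ by (rule aff_dim_le_card)
    finally show False using J(2) by simp
  qed
  define R where "R j = {t. 0 \<le> t \<and> ray j t \<in> A}" for j
  have R: "finite (R j)" "1 \<in> R j" if "j \<in> J" for j
  proof -
    have "inj (ray j)"
      using that \<open>v \<notin> J\<close> by (intro injI) (metis diff_eq_diff_eq ray_diff right_minus_eq scaleR_right_imp_eq)
    then have "finite (ray j -` A)" using A by (rule finite_vimageI[rotated])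
    then show "finite (R j)" by (rule rev_finite_subset) (auto simp: R_def)
    show "1 \<in> R j" using that J(1) by (auto simp: R_def ray_def)
  qed
  define T where "T j = Max (R j)" for j
  define w where "w j = ray j (T j)" for j
  have T: "T j \<ge> 1" "w j \<in> A" if "j \<in> J" for j
  proof -
    show "T j \<ge> 1" unfolding T_def using R[OF that] by simp
    have "T j \<in> R j" unfolding T_def using R[OF that] by (intro Max_in) auto
    then show "w j \<in> A" by (simp add: R_def w_def)
  qed
  define G where "G = insert v (w ` J)"
  have finG: "finite G" using finJ by (simp add: G_def)
  have seg: "\<exists>j\<in>J. x \<in> convex hull {v, w j}" if xA: "x \<in> A" for x
  proof -
    obtain j t where jt: "j \<in> J" "t \<ge> 0" "x = ray j t" using rays[OF xA] by (auto simp: ray_def)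
    then have "t \<le> T j" unfolding T_def using xA R by (intro Max_ge) (auto simp: R_def)
    moreover have "x - v = (t / T j) *\<^sub>R (w j - v)"
      unfolding jt(3) w_def ray_diff using T(1)[OF jt(1)] by simp
    then have "x = (1 - t / T j) *\<^sub>R v + (t / T j) *\<^sub>R w j"
      by (simp add: algebra_simps)
    ultimately show ?thesis
      using T(1)[OF jt(1)] jt(1,2) by (intro bexI[of _ j]) (auto simp: convex_hull_2_alt intro!: exI[of _ "t / T j"] simp: algebra_simps)
  qed
  have GA: "G \<subseteq> A" using v T by (auto simp: G_def)
  have "A \<subseteq> convex hull G"
  proof
    fix x assume "x \<in> A"
    then obtain j where "j \<in> J" "x \<in> convex hull {v, w j}" using seg by blast
    then show "x \<in> convex hull G" using hull_mono[of "{v, w j}" G convex] by (auto simp: G_def)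
  qed
  then have hull: "convex hull A = convex hull G"
    using GA by (metis hull_hull hull_mono subset_antisym)
  have dim: "aff_dim G = aff_dim A" using hull by (metis aff_dim_convex_hull)
  have card_le: "card G \<le> card J + 1"
    unfolding G_def using finJ by (metis Suc_eq_plus1 card_image_le card_insert_le_m1 card_insert_if finite_imageI le_SucI Suc_le_mono)
  then have ind: "\<not> affine_dependent G"
    using finG dim J(2) by (intro independent_if_card_le) auto
  have cardG: "int (card G) = aff_dim A + 1"
    using aff_dim_affine_independent[OF ind] dim by simp
  have "aff_dim A simplex (convex hull A)"
    unfolding hull using ind cardG by (intro simplex_convex_hull) auto
  moreover have "v extreme_point_of (convex hull A)"
    unfolding hull using extreme_point_of_convex_hull_affine_independent[OF ind] by (simp add: G_def)
  moreover have "nonvertex_points A \<subseteq> \<Union>{E. E edge_of (convex hull A) \<and> v \<in> E}"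
  proof
    fix x assume "x \<in> nonvertex_points A"
    then have x: "x \<in> A" "\<not> x extreme_point_of (convex hull A)" by (auto simp: nonvertex_points_def)
    obtain j where j: "j \<in> J" "x \<in> convex hull {v, w j}" using seg[OF x(1)] by blast
    have "w j \<noteq> v"
      using ray_diff[of j "T j"] T(1)[OF j(1)] j(1) \<open>v \<notin> J\<close> by (auto simp: w_def)
    then have "aff_dim (convex hull {v, w j}) = 1" by (simp add: aff_dim_convex_hull aff_dim_2)
    moreover have "convex hull {v, w j} face_of convex hull A"
      unfolding hull face_of_convex_hull_affine_independent[OF ind] using j(1) by (intro exI[of _ "{v, w j}"]) (auto simp: G_def)
    ultimately have "convex hull {v, w j} edge_of convex hull A" "v \<in> convex hull {v, w j}"
      by (auto simp: edge_of_def intro: hull_inc)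
    then show "x \<in> \<Union>{E. E edge_of (convex hull A) \<and> v \<in> E}" using j(2) by blast
  qed
  ultimately show ?thesis by blast
qed

text \<open>The point of the line through \<open>j\<close> and \<open>(u, \<eta>)\<close> with parameter \<open>r\<close> is
  \<open>(r u + j) / (1 + r \<eta>)\<close>; the smallest and largest parameters give the end points of the vertical edges.\<close>

lemma prism_pyramid_exists:
  fixes A :: "'a::euclidean_space set"
  assumes A: "finite A" and J: "J \<subseteq> A" "int (card J) = aff_dim A"
    and u: "\<And>x. x \<in> A \<Longrightarrow> u \<noteq> \<eta> *\<^sub>R x"
    and lines: "\<And>x. x \<in> A \<Longrightarrow> \<exists>j\<in>J. \<exists>s \<gamma>. \<gamma> > 0 \<and> s * \<eta> + \<gamma> = 1 \<and> x = s *\<^sub>R u + \<gamma> *\<^sub>R j"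
    and j0: "j0 \<in> J" and z: "z \<in> A" "sz \<noteq> 0" "\<gamma>z > 0" "sz * \<eta> + \<gamma>z = 1" "z = sz *\<^sub>R u + \<gamma>z *\<^sub>R j0"
  shows "\<exists>k P \<Delta> \<phi>. (polytope_pyramid ^^ k) (convex hull A) P \<and> prism_over_simplex \<Delta> \<phi> P \<and>
    nonvertex_points A \<subseteq> \<Union>(vertical_edges \<Delta> \<phi> P)"
proof -
  have finJ: "finite J" using A J(1) finite_subset by blast
  define pt where "pt j r = (1 / (1 + r * \<eta>)) *\<^sub>R (r *\<^sub>R u + j)" for j r
  have pt_scale: "(1 + r * \<eta>) *\<^sub>R pt j r = r *\<^sub>R u + j" if "1 + r * \<eta> > 0" for j r
    using that by (simp add: pt_def)
  have pt0: "pt j 0 = j" for j by (simp add: pt_def)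
  have pt_param: "1 + (s / \<gamma>) * \<eta> > 0 \<and> x = pt j (s / \<gamma>)"
    if "\<gamma> > 0" "s * \<eta> + \<gamma> = 1" "x = s *\<^sub>R u + \<gamma> *\<^sub>R j" for s \<gamma> j x
  proof -
    have "1 + (s / \<gamma>) * \<eta> = 1 / \<gamma>"
      using that(1,2) by (simp add: field_simps)
    then show ?thesis using that(1,3) by (simp add: pt_def scaleR_add_right)
  qed
  have points: "\<exists>j\<in>J. \<exists>r. 1 + r * \<eta> > 0 \<and> x = pt j r" if "x \<in> A" for x
    using lines[OF that] pt_param by metis
  define R where "R j = {r. 1 + r * \<eta> > 0 \<and> pt j r \<in> A}" for j
  have R: "finite (R j)" "0 \<in> R j" if j: "j \<in> J" for j
  proof -
    \<comment> \<open>Two parameters of the same point would force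
      \<open>u = \<eta> *\<^sub>R j\<close>, that is, \<open>j\<close> would be the common point of
      the lines, which is not in \<open>A\<close>.\<close>
    have "inj_on (pt j) (R j)"
    proof (rule inj_onI)
      fix r r' assume r: "r \<in> R j" "r' \<in> R j" "pt j r = pt j r'"
      then have "1 + r * \<eta> > 0" "1 + r' * \<eta> > 0" by (simp_all add: R_def)
      note pt_scale[OF this(1), of j] pt_scale[OF this(2), of j]
      moreover have "(1 + r * \<eta>) *\<^sub>R (1 + r' * \<eta>) *\<^sub>R pt j r' = (1 + r' * \<eta>) *\<^sub>R (1 + r * \<eta>) *\<^sub>R pt j r"
        using r(3) by simp
      ultimately have "(1 + r * \<eta>) *\<^sub>R (r' *\<^sub>R u + j) = (1 + r' * \<eta>) *\<^sub>R (r *\<^sub>R u + j)"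
        by simp
      then have "(r' - r) *\<^sub>R u = (r' - r) *\<^sub>R (\<eta> *\<^sub>R j)"
        by (simp add: algebra_simps)
      then have "r' - r = 0 \<or> u = \<eta> *\<^sub>R j" unfolding scaleR_cancel_left by blast
      then show "r = r'" using u[of j] j J(1) by auto
    qed
    moreover have "pt j ` R j \<subseteq> A" by (auto simp: R_def)
    ultimately show "finite (R j)" using A inj_on_finite by blast
    show "0 \<in> R j" using j J(1) by (auto simp: R_def pt0)
  qed
  define lo where "lo j = Min (R j)" for j
  define hi where "hi j = Max (R j)" for j
  have lohi: "lo j \<in> R j" "hi j \<in> R j" if "j \<in> J" for j
    unfolding lo_def hi_def using R[OF that] by (auto intro: Min_in Max_in)
  have between: "lo j \<le> r" "r \<le> hi j" if "j \<in> J" "r \<in> R j" for j r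
    unfolding lo_def hi_def using R[OF that(1)] that(2) by auto
  have pos: "1 + lo j * \<eta> > 0" "1 + hi j * \<eta> > 0" if "j \<in> J" for j
    using lohi[OF that] by (auto simp: R_def)
  define p where "p j = pt j (lo j)" for j
  define q where "q j = pt j (hi j)" for j
  have pqA: "p j \<in> A" "q j \<in> A" if "j \<in> J" for j
    using lohi[OF that] by (auto simp: R_def p_def q_def)
  define J1 where "J1 = {j \<in> J. lo j < hi j}"
  define K where "K = J - J1"
  have J1: "J1 \<subseteq> J" "finite J1" using finJ by (auto simp: J1_def)
  have K: "p k = k" if "k \<in> K" for k
  proof -
    have "k \<in> J" "\<not> lo k < hi k" using that by (auto simp: K_def J1_def)
    then have "lo k = 0" using between[of k 0] R(2)[of k] by force
    then show ?thesis by (simp add: p_def pt0)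
  qed
  \<comment> \<open>The point \<open>z\<close> has a non-zero parameter on the line of
    \<open>j0\<close>, where \<open>j0\<close> has parameter 0; this makes the prism
    non-degenerate.\<close>
  have zR: "sz / \<gamma>z \<in> R j0"
    using pt_param[OF z(3-5)] z(1) by (auto simp: R_def)
  have "sz / \<gamma>z < 0 \<or> sz / \<gamma>z > 0"
    using z(2,3) by (auto simp: divide_less_0_iff zero_less_divide_iff)
  then have "lo j0 < hi j0"
    using between[OF j0 zR] between[OF j0 R(2)[OF j0]] by linarith
  then have j01: "j0 \<in> J1"
    using j0 by (simp add: J1_def)
  \<comment> \<open>Subtracting \<open>pt_scale\<close> at the two ends gives
    \<open>(1 + hi \<eta>) q - (1 + lo \<eta>) p = (hi - lo) u\<close>; division by
    \<open>hi - lo\<close> yields weights with exactly the right-hand side \<open>u\<close> and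
    difference \<open>\<eta>\<close>.\<close>
  define l where "l j = (1 + lo j * \<eta>) / (hi j - lo j)" for j
  define m where "m j = (1 + hi j * \<eta>) / (hi j - lo j)" for j
  have lm: "l j > 0" "m j > 0" "m j - l j = \<eta>" "m j *\<^sub>R q j - l j *\<^sub>R p j = u" if "j \<in> J1" for j
  proof -
    have j: "j \<in> J" "hi j - lo j > 0" using that by (auto simp: J1_def)
    show "l j > 0" "m j > 0" using pos[OF j(1)] j(2) by (auto simp: l_def m_def)
    show "m j - l j = \<eta>"
      using j(2) by (simp add: l_def m_def flip: diff_divide_distrib) (simp add: field_simps)
    have "m j *\<^sub>R q j - l j *\<^sub>R p j = (1 / (hi j - lo j)) *\<^sub>R ((1 + hi j * \<eta>) *\<^sub>R q j - (1 + lo j * \<eta>) *\<^sub>R p j)"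
      by (simp add: l_def m_def scaleR_diff_right)
    also have "\<dots> = (1 / (hi j - lo j)) *\<^sub>R ((hi j - lo j) *\<^sub>R u)"
      unfolding p_def q_def pt_scale[OF pos(1)[OF j(1)]] pt_scale[OF pos(2)[OF j(1)]] by (simp add: algebra_simps)
    finally show "m j *\<^sub>R q j - l j *\<^sub>R p j = u" using j(2) by simp
  qed
  \<comment> \<open>The vector \<open>u\<close> is a combination of \<open>q j0\<close> and
    \<open>p j0\<close>, so one end of a line and both ends of the line of \<open>j0\<close>
    determine the whole line.\<close>
  have pt_hull: "pt j r \<in> affine hull {p j, q j0, p j0}" if j: "j \<in> J" and r: "1 + r * \<eta> > 0" for j r
  proof -
    let ?D = "1 + r * \<eta>"
    have "?D *\<^sub>R pt j r = (1 + lo j * \<eta>) *\<^sub>R p j + (r - lo j) *\<^sub>R u"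
      unfolding pt_scale[OF r] p_def pt_scale[OF pos(1)[OF j]] by (simp add: algebra_simps)
    also have "\<dots> = (1 + lo j * \<eta>) *\<^sub>R p j + ((r - lo j) * m j0) *\<^sub>R q j0 + (- (r - lo j) * l j0) *\<^sub>R p j0"
      unfolding lm(4)[OF j01, symmetric] by (simp add: algebra_simps)
    finally have "pt j r = (1 / ?D) *\<^sub>R \<dots>" using r by (metis less_irrefl pt_def pt_scale scaleR_one scaleR_scaleR divide_self times_divide_eq_left mult_1 mult.commute)
    then have "pt j r = ((1 + lo j * \<eta>) / ?D) *\<^sub>R p j + ((r - lo j) * m j0 / ?D) *\<^sub>R q j0 + (- (r - lo j) * l j0 / ?D) *\<^sub>R p j0"
      by (simp add: scaleR_add_right)
    moreover have "(1 + lo j * \<eta>) / ?D + (r - lo j) * m j0 / ?D + - (r - lo j) * l j0 / ?D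
        = (1 + lo j * \<eta> + (r - lo j) * (m j0 - l j0)) / ?D"
      by (simp add: algebra_simps flip: add_divide_distrib diff_divide_distrib)
    then have "(1 + lo j * \<eta>) / ?D + (r - lo j) * m j0 / ?D + - (r - lo j) * l j0 / ?D = 1"
      unfolding lm(3)[OF j01] using r by (simp add: algebra_simps)
    moreover have "p j \<in> affine hull {p j, q j0, p j0}" "q j0 \<in> affine hull {p j, q j0, p j0}"
      "p j0 \<in> affine hull {p j, q j0, p j0}" by (simp_all add: hull_inc)
    ultimately show ?thesis
      using mem_affine_3[OF affine_affine_hull] by metis
  qed
  \<comment> \<open>At most \<open>card J + 1\<close> points span the
    \<open>card J\<close>-dimensional hull of \<open>A\<close>; equality throughout gives
    independence and excludes coincidences.\<close>
  have G0: "\<not> affine_dependent (insert (q j0) (p ` J))" "inj_on p J" "q j0 \<notin> p ` J"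
  proof -
    let ?G = "insert (q j0) (p ` J)"
    have "A \<subseteq> affine hull ?G"
    proof
      fix x assume "x \<in> A"
      then obtain j r where "j \<in> J" "1 + r * \<eta> > 0" "x = pt j r" using points by blast
      then show "x \<in> affine hull ?G"
        using pt_hull[of j r] hull_mono[of "{p j, q j0, p j0}" ?G affine] j0 by auto
    qed
    then have "aff_dim A \<le> aff_dim ?G" by (metis aff_dim_affine_hull aff_dim_subset)
    moreover have c: "card ?G \<le> card (p ` J) + 1" "card (p ` J) \<le> card J"
      using finJ by (auto simp: card_insert_if card_image_le)
    ultimately have le: "int (card ?G) \<le> aff_dim ?G + 1" "aff_dim ?G \<le> int (card ?G) - 1" "int (card J) \<le> aff_dim ?G"
      using J(2) aff_dim_le_card[of ?G] finJ by auto
    then show "\<not> affine_dependent ?G" using finJ by (intro independent_if_card_le) auto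
    have eq: "card (p ` J) = card J" "card ?G = card (p ` J) + 1" using le c by linarith+
    then show "inj_on p J" using finJ by (simp add: eq_card_imp_inj_on)
    show "q j0 \<notin> p ` J"
    proof
      assume "q j0 \<in> p ` J"
      then have "?G = p ` J" by blast
      then show False using eq by simp
    qed
  qed
  let ?V = "p ` J1 \<union> q ` J1" and ?G = "insert (q j0) (p ` J1)"
  interpret prism_vertices J1 p q l m u \<eta>
  proof
    fix \<alpha> \<beta> :: "'a \<Rightarrow> real" and c
    assume "\<And>j. j \<in> J1 \<Longrightarrow> m j * \<beta> j - l j * \<alpha> j = c"
    moreover have "\<not> affine_dependent ?G"
      using affine_dependent_subset[OF _ , of ?G "insert (q j0) (p ` J)"] G0(1) J1(1) by blast
    moreover have "inj_on p J1" "q j0 \<notin> p ` J1"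
      using G0(2,3) J1(1) inj_on_subset by blast+
    ultimately show "\<exists>w e. \<forall>j\<in>J1. w \<bullet> p j + e = \<alpha> j \<and> w \<bullet> q j + e = \<beta> j"
      using lm j01 by (intro prism_vertices_functional[of J1 m q l p u \<eta> j0]) auto
  qed (use lm J1 in auto)
  have "\<not> affine_dependent (p ` J1)"
    using affine_dependent_subset[of "p ` J1" "insert (q j0) (p ` J)"] G0(1) J1(1) by blast
  then obtain \<Delta> \<phi> where prism: "prism_over_simplex \<Delta> \<phi> (convex hull ?V)"
    and edges: "\<And>j. j \<in> J1 \<Longrightarrow> convex hull {p j, q j} \<in> vertical_edges \<Delta> \<phi> (convex hull ?V)"
    using prism_over_simplex_exists j01 by blast
  have hullV: "affine hull ?V = affine hull ?G"
  proof
    have "q j \<in> affine hull ?G" if "j \<in> J1" for j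
    proof -
      have j: "j \<in> J" using that J1(1) by blast
      then have "q j \<in> affine hull {p j, q j0, p j0}"
        unfolding q_def[of j] using pt_hull[OF j] pos[OF j] by blast
      then show ?thesis using hull_mono[of "{p j, q j0, p j0}" ?G affine] that j01 by auto
    qed
    then have "?V \<subseteq> affine hull ?G" by (auto intro: hull_inc)
    then show "affine hull ?V \<subseteq> affine hull ?G" by (simp add: hull_minimal)
    show "affine hull ?G \<subseteq> affine hull ?V" using j01 by (intro hull_mono) auto
  qed
  have GK: "insert (q j0) (p ` J) = ?G \<union> K"
  proof -
    have "p ` J = p ` J1 \<union> p ` K" using J1(1) by (auto simp: K_def)
    moreover have "p ` K = K" using K by force
    ultimately show ?thesis by blast
  qed
  have disj: "?G \<inter> K = {}"
  proof -
    have "k \<noteq> q j0" if "k \<in> K" for k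
      using G0(3) K[OF that] that by (metis K_def DiffD1 imageI)
    moreover have "k \<noteq> p j" if "k \<in> K" "j \<in> J1" for k j
      using G0(2) K[OF that(1)] that J1(1) unfolding K_def inj_on_def by (metis DiffE subsetD)
    ultimately show ?thesis by blast
  qed
  have finV: "finite ?V" "finite K" using J1(2) finJ by (auto simp: K_def)
  have pyr: "(polytope_pyramid ^^ card K) (convex hull (?V \<union> K)) (convex hull ?V)"
    using polytope_pyramid_iterate[OF finV(2) _ disj hullV finV(1)] G0(1) unfolding GK by blast
  have loc: "(\<exists>j\<in>J1. x \<in> convex hull {p j, q j}) \<or> x \<in> K" if x: "x \<in> A" for x
  proof -
    obtain j r where j: "j \<in> J" "1 + r * \<eta> > 0" "x = pt j r" using points[OF x] by blast
    then have rR: "r \<in> R j" using x by (simp add: R_def)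
    show ?thesis
    proof (cases "j \<in> J1")
      case True
      then have d: "hi j - lo j > 0" by (simp add: J1_def)
      let ?D = "1 + r * \<eta>"
      define t where "t = (r - lo j) / (hi j - lo j)"
      have t: "0 \<le> t" "t \<le> 1" using between[OF j(1) rR] d by (auto simp: t_def)
      have "t * (hi j - lo j) = r - lo j" using d by (simp add: t_def)
      then have rt: "r = (1 - t) * lo j + t * hi j" by (simp add: algebra_simps)
      let ?a = "(1 - t) * (1 + lo j * \<eta>) / ?D" and ?b = "t * (1 + hi j * \<eta>) / ?D"
      have "(1 - t) * (1 + lo j * \<eta>) + t * (1 + hi j * \<eta>) = ?D"
        unfolding rt by (simp add: algebra_simps)
      then have ab: "?a + ?b = 1" using j(2) by (simp flip: add_divide_distrib)
      have "r *\<^sub>R u + j = (1 - t) *\<^sub>R (lo j *\<^sub>R u + j) + t *\<^sub>R (hi j *\<^sub>R u + j)"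
        unfolding rt by (simp add: algebra_simps)
      also have "\<dots> = ((1 - t) * (1 + lo j * \<eta>)) *\<^sub>R p j + (t * (1 + hi j * \<eta>)) *\<^sub>R q j"
        unfolding p_def q_def pt_scale[OF pos(1)[OF j(1)], symmetric] pt_scale[OF pos(2)[OF j(1)], symmetric]
        by simp
      finally have "x = ?a *\<^sub>R p j + ?b *\<^sub>R q j"
        unfolding j(3) pt_def by (simp add: scaleR_add_right)
      moreover have "?a \<ge> 0" "?b \<ge> 0" using t j(2) pos[OF j(1)] by auto
      ultimately have "x \<in> convex hull {p j, q j}"
        using ab unfolding convex_hull_2 by blast
      then show ?thesis using True by blast
    next
      case False
      then have "lo j = hi j" "j \<in> K"
        using j(1) between[OF j(1) rR] by (auto simp: J1_def K_def)
      then have "r = lo j" using between[OF j(1) rR] by simp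
      then have "x = j" using K[OF \<open>j \<in> K\<close>] j(3) by (simp add: p_def)
      then show ?thesis using \<open>j \<in> K\<close> by blast
    qed
  qed
  have VKA: "?V \<union> K \<subseteq> A" using pqA J1(1) J(1) by (auto simp: K_def)
  have "A \<subseteq> convex hull (?V \<union> K)"
  proof
    fix x assume "x \<in> A"
    then consider j where "j \<in> J1" "x \<in> convex hull {p j, q j}" | "x \<in> K" using loc by blast
    then show "x \<in> convex hull (?V \<union> K)"
    proof cases
      case 1
      then show ?thesis using hull_mono[of "{p j, q j}" "?V \<union> K" convex] by blast
    qed (simp add: hull_inc)
  qed
  then have hull: "convex hull A = convex hull (?V \<union> K)"
    using VKA by (metis hull_hull hull_mono subset_antisym)
  have "nonvertex_points A \<subseteq> \<Union>(vertical_edges \<Delta> \<phi> (convex hull ?V))"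
  proof
    fix x assume "x \<in> nonvertex_points A"
    then have x: "x \<in> A" "\<not> x extreme_point_of (convex hull A)" by (auto simp: nonvertex_points_def)
    \<comment> \<open>An apex is outside the affine hull of all other generators and is therefore a
      vertex.\<close>
    have "x \<notin> K"
    proof
      assume xK: "x \<in> K"
      have "x \<notin> affine hull (?V \<union> (K - {x}))"
      proof (rule pyramid_apex_not_in_hull[OF _ _ hullV])
        have "?G \<union> insert x (K - {x}) = ?G \<union> K" using xK by blast
        then show "\<not> affine_dependent (?G \<union> insert x (K - {x}))" using G0(1) unfolding GK by simp
        show "x \<notin> ?G \<union> (K - {x})" using disj xK by blast
      qed
      then have "x \<notin> convex hull (?V \<union> (K - {x}))"
        using convex_hull_subset_affine_hull by blast
      then have "x extreme_point_of (convex hull (insert x (?V \<union> (K - {x}))))"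
        using finV by (intro extreme_point_of_convex_hull_insert) auto
      moreover have "insert x (?V \<union> (K - {x})) = ?V \<union> K" using xK by blast
      ultimately show False using x(2) hull by simp
    qed
    then obtain j where "j \<in> J1" "x \<in> convex hull {p j, q j}" using loc[OF x(1)] by blast
    then show "x \<in> \<Union>(vertical_edges \<Delta> \<phi> (convex hull ?V))" using edges by blast
  qed
  then show ?thesis using pyr prism unfolding hull by blast
qed

section \<open>Affine dependencies of a configuration of degree at most one\<close>

lemma pos_combination_in_rel_interior_convex_hull:
  fixes C :: "'a::euclidean_space set"
  assumes "finite C" "\<And>x. x \<in> C \<Longrightarrow> c x > 0" "sum c C = 1"
  shows "(\<Sum>x\<in>C. c x *\<^sub>R x) \<in> rel_interior (convex hull C)"
proof -
  have "rel_interior (convex hull (\<Union>x\<in>C. {x})) =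
      {\<Sum>x\<in>C. c x *\<^sub>R s x |c s. (\<forall>x\<in>C. 0 < c x) \<and> sum c C = 1 \<and> (\<forall>x\<in>C. s x \<in> rel_interior {x})}"
    by (rule rel_interior_convex_hull_union) (use assms in auto)
  moreover have "(\<Sum>x\<in>C. c x *\<^sub>R x) \<in>
      {\<Sum>x\<in>C. c x *\<^sub>R s x |c s. (\<forall>x\<in>C. 0 < c x) \<and> sum c C = 1 \<and> (\<forall>x\<in>C. s x \<in> rel_interior {x})}"
    using assms by (intro CollectI exI[of _ c] exI[of _ "\<lambda>x. x"]) auto
  ultimately show ?thesis by simp
qed

text \<open>A basis of the support of the dependency is completed by a set \<open>E\<close> of further points of \<open>A\<close>;
  moving along the dependency then exhibits \<open>E\<close> together with the negative points as an interior face.\<close>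

lemma degree_le_one_dependency:
  fixes A :: "'a::euclidean_space set"
  assumes A: "finite A" "degree_le_one A"
    and c: "sum c A = 0" "(\<Sum>x\<in>A. c x *\<^sub>R x) = 0"
  shows "aff_dim {x \<in> A. c x \<noteq> 0} \<le> int (card {x \<in> A. c x < 0})"
proof (cases "\<forall>x\<in>A. c x = 0")
  case True
  then have e: "{x \<in> A. c x \<noteq> 0} = {}" by auto
  show ?thesis unfolding e by simp
next
  case False
  define C where "C = {x \<in> A. c x \<noteq> 0}"
  define N where "N = {x \<in> A. c x < 0}"
  have fin: "finite C" "finite N" using A by (auto simp: C_def N_def)
  have "C \<subseteq> A" by (auto simp: C_def)
  obtain D where D: "D \<subseteq> C" "\<not> affine_dependent D" "affine hull C = affine hull D"
    using affine_basis_exists[of C] by blast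
  obtain T where T: "\<not> affine_dependent T" "D \<subseteq> T" "T \<subseteq> A" "affine hull T = affine hull A"
    using extend_to_affine_basis[OF D(2)] D(1) \<open>C \<subseteq> A\<close> by (metis order_trans)
  define E where "E = T - D"
  define S where "S = N \<union> E"
  define U where "U = C \<union> E"
  have finT: "finite T" using T(1) aff_independent_finite by blast
  have sub: "S \<subseteq> U" "U \<subseteq> A" "S \<subseteq> A" and finU: "finite U" "finite S"
    using T(3) A(1) finT fin by (auto simp: S_def U_def N_def C_def E_def)
  have "N \<noteq> {}"
  proof
    assume "N = {}"
    then have "\<forall>x\<in>A. c x \<ge> 0" by (auto simp: N_def not_less)
    then have "\<forall>x\<in>A. c x = 0" using c(1) A(1) by (simp add: sum_nonneg_eq_0_iff)
    then show False using False by blast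
  qed
  then have "S \<noteq> {}" by (simp add: S_def)
  then have S0: "card S > 0" using finU by (simp add: card_gt_0_iff)
  define M where "M = (\<Sum>x\<in>A. \<bar>c x\<bar>)"
  \<comment> \<open>Small enough for \<open>1 + \<epsilon> * c x\<close> to stay positive on
    \<open>A\<close>, since \<open>\<bar>c x\<bar> \<le> M\<close>.\<close>
  define \<epsilon> where "\<epsilon> = 1 / (1 + M)"
  have M0: "M \<ge> 0" by (simp add: M_def sum_nonneg)
  then have \<epsilon>0: "\<epsilon> > 0" by (simp add: \<epsilon>_def)
  have small: "1 + \<epsilon> * c x > 0" if "x \<in> A" for x
  proof -
    have "\<bar>c x\<bar> \<le> M" unfolding M_def using that A(1) by (intro member_le_sum) auto
    then show ?thesis using M0 by (simp add: \<epsilon>_def field_simps)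
  qed
  \<comment> \<open>The uniform weights of the barycentre of \<open>S\<close>, perturbed along the
    dependency: the point stays the same, but every point of \<open>U\<close> now has positive
    weight.\<close>
  define h where "h x = ((if x \<in> S then 1 else 0) + \<epsilon> * c x) / card S" for x
  have hpos: "h x > 0" if "x \<in> U" for x
  proof (cases "x \<in> S")
    case True
    then show ?thesis using small[of x] sub S0 by (auto simp: h_def)
  next
    case False
    then have "x \<in> A" "c x \<noteq> 0" "\<not> c x < 0"
      using that by (auto simp: S_def U_def C_def N_def)
    then show ?thesis using False \<epsilon>0 S0 by (simp add: h_def)
  qed
  have c0: "c x = 0" if "x \<in> A - U" for x
    using that by (auto simp: U_def C_def)
  have "sum c U = 0"
    using c(1) sum.mono_neutral_left[of A U c] A(1) sub(2) c0 by simp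
  then have "sum h U = (\<Sum>x\<in>U. (if x \<in> S then 1 else 0)) / card S"
    by (simp add: h_def sum.distrib flip: sum_divide_distrib sum_distrib_left)
  also have "(\<Sum>x\<in>U. (if x \<in> S then 1 else 0)) = real (card S)"
    using sub(1) finU by (simp add: sum.If_cases inf.absorb2)
  finally have sumh: "sum h U = 1" using S0 by simp
  have "(\<Sum>x\<in>U. c x *\<^sub>R x) = 0"
    using c(2) sum.mono_neutral_left[of A U "\<lambda>x. c x *\<^sub>R x"] A(1) sub(2) c0 by simp
  moreover have "(\<Sum>x\<in>U. (\<epsilon> * c x / card S) *\<^sub>R x) = (\<epsilon> / card S) *\<^sub>R (\<Sum>x\<in>U. c x *\<^sub>R x)"
    by (simp add: scaleR_sum_right)
  moreover have "h x *\<^sub>R x = (if x \<in> S then (1 / card S) *\<^sub>R x else 0) + (\<epsilon> * c x / card S) *\<^sub>R x" for x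
    by (auto simp: h_def add_divide_distrib scaleR_add_left)
  ultimately have "(\<Sum>x\<in>U. h x *\<^sub>R x) = (\<Sum>x\<in>U. if x \<in> S then (1 / card S) *\<^sub>R x else 0)"
    by (simp add: sum.distrib)
  also have "\<dots> = (\<Sum>x\<in>S. (1 / card S) *\<^sub>R x)"
    using sub(1) finU by (simp add: sum.If_cases inf.absorb2)
  finally have eq: "(\<Sum>x\<in>U. h x *\<^sub>R x) = (\<Sum>x\<in>S. (1 / card S) *\<^sub>R x)" .
  have "(\<Sum>x\<in>S. (1 / card S) *\<^sub>R x) \<in> convex hull S"
    using S0 finU by (intro convex_sum) (auto intro: hull_inc)
  moreover have "(\<Sum>x\<in>U. h x *\<^sub>R x) \<in> rel_interior (convex hull U)"
    using finU hpos sumh by (intro pos_combination_in_rel_interior_convex_hull)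
  \<comment> \<open>Equal affine hulls make the relative interior of \<open>convex hull U\<close>
    part of that of \<open>convex hull A\<close>.\<close>
  moreover have "affine hull U = affine hull A"
  proof
    show "affine hull U \<subseteq> affine hull A" using sub(2) by (rule hull_mono)
    have "T \<subseteq> affine hull U"
      using D(1) by (auto simp: U_def E_def intro: hull_inc)
    then show "affine hull A \<subseteq> affine hull U"
      unfolding T(4)[symmetric] by (simp add: hull_minimal)
  qed
  then have "rel_interior (convex hull U) \<subseteq> rel_interior (convex hull A)"
    using sub(2) by (intro subset_rel_interior) (simp_all add: hull_mono)
  ultimately have "\<not> convex hull S \<subseteq> rel_frontier (convex hull A)"
    unfolding eq rel_frontier_def by blast
  then have "aff_dim A \<le> aff_dim S + 1"
    using A(2) sub(3) \<open>S \<noteq> {}\<close> unfolding degree_le_one_def by blast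
  moreover have "aff_dim S \<le> int (card S) - 1"
    using finU by (intro aff_dim_le_card)
  moreover have "card S \<le> card N + card E"
    unfolding S_def by (rule card_Un_le)
  moreover have "int (card E) = aff_dim A - aff_dim C"
  proof -
    have "int (card T) = aff_dim A + 1" "int (card D) = aff_dim C + 1"
      using T(1,4) D(2,3) aff_dim_affine_independent[of T] aff_dim_affine_independent[of D]
      by (metis aff_dim_affine_hull)+
    moreover have "card E = card T - card D" "card D \<le> card T"
      using T(2) finT by (auto simp: E_def card_Diff_subset finite_subset card_mono)
    ultimately show ?thesis by linarith
  qed
  ultimately have "aff_dim C \<le> int (card N)" by linarith
  then show ?thesis
    by (simp add: C_def N_def)
qed

text \<open>The bound for \<open>c\<close> and for \<open>- c\<close>, and their sum. The dimension
  of the support enters through an independent set \<open>D\<close> in its affine hull, which need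
  not consist of support points.\<close>

lemma degree_le_one_dependency_card:
  fixes A :: "'a::euclidean_space set"
  assumes A: "finite A" "degree_le_one A"
    and c: "sum c A = 0" "(\<Sum>x\<in>A. c x *\<^sub>R x) = 0"
    and D: "\<not> affine_dependent D" "D \<subseteq> affine hull {x \<in> A. c x \<noteq> 0}"
  shows "card D \<le> card {x \<in> A. c x < 0} + 1" "card D \<le> card {x \<in> A. c x > 0} + 1"
    "2 * card D \<le> card {x \<in> A. c x \<noteq> 0} + 2"
proof -
  have "aff_dim D \<le> aff_dim {x \<in> A. c x \<noteq> 0}"
    using D(2) by (metis aff_dim_affine_hull aff_dim_subset)
  moreover have "int (card D) = aff_dim D + 1"
    using D(1) by (rule aff_dim_affine_independent)
  moreover have "aff_dim {x \<in> A. - c x \<noteq> 0} \<le> int (card {x \<in> A. - c x < 0})"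
    by (rule degree_le_one_dependency) (use A c in \<open>simp_all add: sum_negf\<close>)
  ultimately show *: "card D \<le> card {x \<in> A. c x < 0} + 1" "card D \<le> card {x \<in> A. c x > 0} + 1"
    using degree_le_one_dependency[OF A c] by simp_all
  have "{x \<in> A. c x \<noteq> 0} = {x \<in> A. c x < 0} \<union> {x \<in> A. c x > 0}" by auto
  then have "card {x \<in> A. c x \<noteq> 0} = card {x \<in> A. c x < 0} + card {x \<in> A. c x > 0}"
    using A(1) by (simp add: card_Un_disjoint disjoint_iff)
  then show "2 * card D \<le> card {x \<in> A. c x \<noteq> 0} + 2" using * by linarith
qed

lemma affine_dependency_in_hull:
  fixes C :: "'a::real_vector set"
  assumes "finite C" "sum c C = 0" "(\<Sum>x\<in>C. c x *\<^sub>R x) = 0" "b \<in> C" "c b \<noteq> 0"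
  shows "b \<in> affine hull (C - {b})"
proof -
  have s: "sum c (C - {b}) = - c b" "(\<Sum>x\<in>C - {b}. c x *\<^sub>R x) = - c b *\<^sub>R b"
    using assms by (simp_all add: sum_diff1 eq_neg_iff_add_eq_0)
  have "(\<Sum>x\<in>C - {b}. - c x / c b) = 1"
    using s(1) assms(5) by (simp add: sum_negf flip: sum_divide_distrib)
  moreover have "(\<Sum>x\<in>C - {b}. (- c x / c b) *\<^sub>R x) = (- 1 / c b) *\<^sub>R (\<Sum>x\<in>C - {b}. c x *\<^sub>R x)"
    by (simp add: scaleR_sum_right)
  then have "(\<Sum>x\<in>C - {b}. (- c x / c b) *\<^sub>R x) = b"
    unfolding s(2) using assms(5) by simp
  ultimately show ?thesis
    using assms(1) by (auto simp: affine_hull_finite intro!: exI[of _ "\<lambda>x. - c x / c b"])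
qed

section \<open>Barycentric coordinates and supports relative to an affine basis\<close>

locale degree_one_basis =
  fixes A B :: "'a::euclidean_space set"
  assumes finite_A: "finite A" and degree: "degree_le_one A"
    and B_subset: "B \<subseteq> A" and independent: "\<not> affine_dependent B" and A_subset: "A \<subseteq> affine hull B"
begin

text \<open>Barycentric coordinates with respect to \<open>B\<close>. The value 0 off
  \<open>B\<close> allows the same function to be summed over \<open>A\<close>.\<close>

definition coord :: "'a \<Rightarrow> 'a \<Rightarrow> real" where
  "coord x = (SOME u. (\<forall>b. b \<notin> B \<longrightarrow> u b = 0) \<and> sum u B = 1 \<and> (\<Sum>b\<in>B. u b *\<^sub>R b) = x)"

definition supp :: "'a \<Rightarrow> 'a set" where
  "supp x = {b \<in> B. coord x b \<noteq> 0}"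

text \<open>The affine dependency that expresses \<open>x\<close> in the basis: coefficient -1 at an
  \<open>x\<close> outside \<open>B\<close>, and identically 0 for \<open>x\<close> in
  \<open>B\<close>.\<close>

definition dep :: "'a \<Rightarrow> 'a \<Rightarrow> real" where
  "dep x y = coord x y - (if y = x then 1 else 0)"

lemma finite_B: "finite B"
  using B_subset finite_A finite_subset by blast

lemma finite_supp: "finite (supp x)"
  using finite_B by (simp add: supp_def)

lemma supp_subset: "supp x \<subseteq> B"
  by (auto simp: supp_def)

lemma
  assumes "x \<in> A"
  shows coord_outside: "b \<notin> B \<Longrightarrow> coord x b = 0"
    and sum_coord: "sum (coord x) B = 1"
    and sum_coord_scaleR: "(\<Sum>b\<in>B. coord x b *\<^sub>R b) = x"
proof -
  have "x \<in> affine hull B" using assms A_subset by blast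
  then obtain u where u: "sum u B = 1" "(\<Sum>b\<in>B. u b *\<^sub>R b) = x"
    using finite_B by (auto simp: affine_hull_finite)
  have "\<exists>u. (\<forall>b. b \<notin> B \<longrightarrow> u b = 0) \<and> sum u B = 1 \<and> (\<Sum>b\<in>B. u b *\<^sub>R b) = x"
    using u by (intro exI[of _ "\<lambda>b. if b \<in> B then u b else 0"]) auto
  from someI_ex[OF this, folded coord_def]
  show "b \<notin> B \<Longrightarrow> coord x b = 0" "sum (coord x) B = 1" "(\<Sum>b\<in>B. coord x b *\<^sub>R b) = x" by blast+
qed

lemma coord_unique:
  assumes "x \<in> A" "sum u B = 1" "(\<Sum>b\<in>B. u b *\<^sub>R b) = x" "b \<in> B"
  shows "coord x b = u b"
proof (rule ccontr)
  assume ne: "coord x b \<noteq> u b"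
  have "(\<Sum>b\<in>B. coord x b - u b) = 0"
    using sum_coord[OF assms(1)] assms(2) by (simp add: sum_subtractf)
  moreover have "(\<Sum>b\<in>B. (coord x b - u b) *\<^sub>R b) = 0"
    using sum_coord_scaleR[OF assms(1)] assms(3) by (simp add: sum_subtractf scaleR_diff_left)
  ultimately have "affine_dependent B"
    unfolding affine_dependent_explicit_finite[OF finite_B]
    using ne assms(4) by (intro exI[of _ "\<lambda>b. coord x b - u b"]) auto
  then show False using independent by blast
qed

lemma coord_basis: "b \<in> B \<Longrightarrow> b' \<in> B \<Longrightarrow> coord b b' = (if b' = b then 1 else 0)"
  using B_subset finite_B
  by (intro coord_unique[of b "\<lambda>y. if y = b then 1 else 0"]) (auto simp: if_distrib[of "\<lambda>r. r *\<^sub>R _"] cong: if_cong)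

lemma sum_coord_A: "x \<in> A \<Longrightarrow> sum (coord x) A = 1"
  using sum.mono_neutral_right[of A B "coord x"] finite_A B_subset coord_outside sum_coord by auto

lemma sum_coord_scaleR_A: "x \<in> A \<Longrightarrow> (\<Sum>b\<in>A. coord x b *\<^sub>R b) = x"
  using sum.mono_neutral_right[of A B "\<lambda>b. coord x b *\<^sub>R b"] finite_A B_subset coord_outside sum_coord_scaleR
  by auto

lemma sum_dep: "x \<in> A \<Longrightarrow> sum (dep x) A = 0"
  using finite_A by (simp add: dep_def sum_subtractf sum_coord_A)

lemma sum_dep_scaleR: "x \<in> A \<Longrightarrow> (\<Sum>y\<in>A. dep x y *\<^sub>R y) = 0"
  using finite_A
  by (simp add: dep_def scaleR_diff_left sum_subtractf sum_coord_scaleR_A if_distrib[of "\<lambda>r. r *\<^sub>R _"] cong: if_cong)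

lemma
  assumes "x \<in> A" "y \<in> A" "z \<in> A"
  shows sum_dep_comb: "(\<Sum>w\<in>A. r * dep x w + s * dep y w + t * dep z w) = 0"
    and sum_dep_comb_scaleR: "(\<Sum>w\<in>A. (r * dep x w + s * dep y w + t * dep z w) *\<^sub>R w) = 0"
proof -
  show "(\<Sum>w\<in>A. r * dep x w + s * dep y w + t * dep z w) = 0"
    using assms by (simp add: sum.distrib sum_dep flip: sum_distrib_left)
  have "(\<Sum>w\<in>A. (r * dep x w + s * dep y w + t * dep z w) *\<^sub>R w) =
      r *\<^sub>R (\<Sum>w\<in>A. dep x w *\<^sub>R w) + s *\<^sub>R (\<Sum>w\<in>A. dep y w *\<^sub>R w) + t *\<^sub>R (\<Sum>w\<in>A. dep z w *\<^sub>R w)"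
    by (simp add: scaleR_add_left sum.distrib scaleR_sum_right)
  then show "(\<Sum>w\<in>A. (r * dep x w + s * dep y w + t * dep z w) *\<^sub>R w) = 0"
    using assms by (simp add: sum_dep_scaleR)
qed

text \<open>Combinations of fewer than three dependencies are obtained with zero
  coefficients.\<close>

lemmas comb_card = degree_le_one_dependency_card[OF finite_A degree sum_dep_comb sum_dep_comb_scaleR]

lemma independent_subset: "S \<subseteq> B \<Longrightarrow> \<not> affine_dependent S"
  using independent affine_dependent_subset by blast

lemma dep_extra: "x \<in> A - B \<Longrightarrow> b \<in> B \<Longrightarrow> dep x b = coord x b"
  by (auto simp: dep_def)

lemma dep_outside: "x \<in> A \<Longrightarrow> y \<notin> B \<Longrightarrow> dep x y = (if y = x then - 1 else 0)"
  by (simp add: dep_def coord_outside)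

lemma dep_support: "x \<in> A - B \<Longrightarrow> {y \<in> A. dep x y \<noteq> 0} = insert x (supp x)"
  using B_subset coord_outside[of x] by (auto simp: dep_def supp_def split: if_splits)

lemma supp_in_hull:
  assumes "x \<in> A - B" "b \<in> supp x"
  shows "b \<in> affine hull (insert x (supp x - {b}))"
proof -
  have *: "insert x (supp x) \<subseteq> A" using assms supp_subset B_subset by blast
  have 0: "dep x y = 0" if "y \<in> A - insert x (supp x)" for y
    using dep_support[OF assms(1)] that by blast
  have "sum (dep x) (insert x (supp x)) = 0"
    using sum.mono_neutral_left[OF finite_A *, of "dep x"] 0 assms sum_dep by auto
  moreover have "(\<Sum>y\<in>insert x (supp x). dep x y *\<^sub>R y) = 0"
    using sum.mono_neutral_left[OF finite_A *, of "\<lambda>y. dep x y *\<^sub>R y"] 0 assms sum_dep_scaleR by auto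
  moreover have "dep x b \<noteq> 0" using dep_support[OF assms(1)] assms(2) by blast
  ultimately have "b \<in> affine hull (insert x (supp x) - {b})"
    using assms(2) finite_supp by (intro affine_dependency_in_hull[of _ "dep x"]) auto
  moreover have "insert x (supp x) - {b} = insert x (supp x - {b})"
    using assms supp_subset by blast
  ultimately show ?thesis by simp
qed

lemma not_in_hull_if_coord:
  assumes "x \<in> A" "b \<in> B" "coord x b \<noteq> 0" "S \<subseteq> B - {b}"
  shows "x \<notin> affine hull S"
proof
  assume "x \<in> affine hull S"
  then have "x \<in> affine hull (B - {b})" using hull_mono[OF assms(4), of affine] by blast
  then obtain u where u: "sum u (B - {b}) = 1" "(\<Sum>y\<in>B - {b}. u y *\<^sub>R y) = x"
    using finite_B by (auto simp: affine_hull_finite)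
  define u' where "u' = u(b := 0)"
  have "sum u' B = sum u' (B - {b})" "(\<Sum>y\<in>B. u' y *\<^sub>R y) = (\<Sum>y\<in>B - {b}. u' y *\<^sub>R y)"
    using finite_B by (intro sum.mono_neutral_right; auto simp: u'_def)+
  moreover have "sum u' (B - {b}) = sum u (B - {b})" "(\<Sum>y\<in>B - {b}. u' y *\<^sub>R y) = (\<Sum>y\<in>B - {b}. u y *\<^sub>R y)"
    by (auto intro!: sum.cong simp: u'_def)
  ultimately have "sum u' B = 1" "(\<Sum>y\<in>B. u' y *\<^sub>R y) = x"
    using u by auto
  from coord_unique[OF assms(1) this assms(2)] show False
    using assms(3) by (simp add: u'_def)
qed

lemma card_supp_ge_2:
  assumes "x \<in> A - B"
  shows "card (supp x) \<ge> 2"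
proof (rule ccontr)
  assume "\<not> card (supp x) \<ge> 2"
  then have "card (supp x) = 0 \<or> card (supp x) = 1" by linarith
  moreover have supp: "sum (coord x) (supp x) = 1" "(\<Sum>b\<in>supp x. coord x b *\<^sub>R b) = x"
    using sum.mono_neutral_right[OF finite_B supp_subset, of x "coord x"]
      sum.mono_neutral_right[OF finite_B supp_subset, of x "\<lambda>b. coord x b *\<^sub>R b"]
      sum_coord[of x] sum_coord_scaleR[of x] assms by (auto simp: supp_def)
  ultimately obtain b where "supp x = {b}"
    using finite_supp[of x] by (auto simp: card_1_singleton_iff)
  then have "x = b" using supp by simp
  then show False using \<open>supp x = {b}\<close> supp_subset assms by blast
qed

text \<open>The dependency of \<open>x\<close> involves \<open>x\<close> and its \<open>k\<close>
  support elements, and the latter are independent: \<open>2 * k \<le> (k + 1) + 2\<close>.\<close>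

lemma card_supp_le_3:
  assumes "x \<in> A - B"
  shows "card (supp x) \<le> 3"
proof -
  have xA: "x \<in> A" and xB: "x \<notin> B" using assms by auto
  have "{w \<in> A. 1 * dep x w + 0 * dep x w + 0 * dep x w \<noteq> 0} = insert x (supp x)"
    using dep_support[OF assms] by simp
  then have "2 * card (supp x) \<le> card (insert x (supp x)) + 2"
    using comb_card(3)[OF xA xA xA xA xA xA, of "supp x" 1 0 0] independent_subset[OF supp_subset] hull_subset[of "insert x (supp x)" affine] by fastforce
  then show ?thesis
    using xB supp_subset finite_supp by (simp add: card_insert_if split: if_splits)
qed

text \<open>With disjoint supports of sizes \<open>k\<close> and \<open>k'\<close>, suitable signs
  make the sum of the two dependencies have at most \<open>(k - 1) + (k' - 1)\<close> negative
  coefficients, one too few for the \<open>k + k'\<close> independent points in its hull.\<close>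

lemma supp_Int_nonempty:
  assumes "x \<in> A - B" "y \<in> A - B"
  shows "supp x \<inter> supp y \<noteq> {}"
proof
  assume disj: "supp x \<inter> supp y = {}"
  have A: "x \<in> A" "y \<in> A" and B: "x \<notin> B" "y \<notin> B" using assms by auto
  have xy: "x \<noteq> y" using disj card_supp_ge_2[OF assms(1)] by fastforce
  \<comment> \<open>The \<open>k + 1\<close> non-zero coefficients split by sign; both parts having
    at least \<open>k\<close> elements would mean \<open>k \<le> 1\<close>.\<close>
  have sgn: "\<exists>s::real. s \<noteq> 0 \<and> card {w \<in> A. s * dep z w < 0} + 1 \<le> card (supp z)" if z: "z \<in> A - B" for z
  proof -
    have "{w \<in> A. 1 * dep z w < 0} \<union> {w \<in> A. - 1 * dep z w < 0} = insert z (supp z)"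
      using dep_support[OF z] by force
    moreover have "card ({w \<in> A. 1 * dep z w < 0} \<union> {w \<in> A. - 1 * dep z w < 0})
        = card {w \<in> A. 1 * dep z w < 0} + card {w \<in> A. - 1 * dep z w < 0}"
      using finite_A by (intro card_Un_disjoint) auto
    moreover have "card (insert z (supp z)) = card (supp z) + 1"
      using z supp_subset finite_supp by (subst card_insert_disjoint) auto
    ultimately have "card {w \<in> A. 1 * dep z w < 0} + card {w \<in> A. - 1 * dep z w < 0} = card (supp z) + 1"
      by simp
    then have "card {w \<in> A. 1 * dep z w < 0} + 1 \<le> card (supp z) \<or> card {w \<in> A. - 1 * dep z w < 0} + 1 \<le> card (supp z)"
      using card_supp_ge_2[OF z] by linarith
    then show ?thesis
    proof
      assume "card {w \<in> A. 1 * dep z w < 0} + 1 \<le> card (supp z)"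
      then show ?thesis by (intro exI[of _ 1]) simp
    next
      assume "card {w \<in> A. - 1 * dep z w < 0} + 1 \<le> card (supp z)"
      then show ?thesis by (intro exI[of _ "- 1"]) simp
    qed
  qed
  from sgn[OF assms(1)] sgn[OF assms(2)] obtain s t :: real where st: "s \<noteq> 0" "t \<noteq> 0"
    "card {w \<in> A. s * dep x w < 0} + 1 \<le> card (supp x)"
    "card {w \<in> A. t * dep y w < 0} + 1 \<le> card (supp y)"
    by (elim exE conjE)
  let ?c = "\<lambda>w. s * dep x w + t * dep y w + 0 * dep x w"
  have or: "dep x w = 0 \<or> dep y w = 0" if "w \<in> A" for w
  proof (rule ccontr)
    assume "\<not> ?thesis"
    then have "w \<in> {w \<in> A. dep x w \<noteq> 0}" "w \<in> {w \<in> A. dep y w \<noteq> 0}" using that by simp_all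
    then show False
      unfolding dep_support[OF assms(1)] dep_support[OF assms(2)]
      using disj B xy supp_subset[of x] supp_subset[of y] by auto
  qed
  have "{w \<in> A. ?c w \<noteq> 0} = {w \<in> A. dep x w \<noteq> 0} \<union> {w \<in> A. dep y w \<noteq> 0}"
  proof (intro set_eqI iffI)
    fix w assume "w \<in> {w \<in> A. dep x w \<noteq> 0} \<union> {w \<in> A. dep y w \<noteq> 0}"
    then show "w \<in> {w \<in> A. ?c w \<noteq> 0}" using or[of w] st(1,2) by auto
  qed auto
  then have "supp x \<union> supp y \<subseteq> affine hull {w \<in> A. ?c w \<noteq> 0}"
    using dep_support[OF assms(1)] dep_support[OF assms(2)]
      hull_subset[of "{w \<in> A. ?c w \<noteq> 0}" affine] by auto
  then have "card (supp x \<union> supp y) \<le> card {w \<in> A. ?c w < 0} + 1"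
    by (intro comb_card(1)) (use A supp_subset in \<open>auto intro!: independent_subset\<close>)
  moreover have "card {w \<in> A. ?c w < 0} \<le> card {w \<in> A. s * dep x w < 0} + card {w \<in> A. t * dep y w < 0}"
  proof -
    have "{w \<in> A. ?c w < 0} \<subseteq> {w \<in> A. s * dep x w < 0} \<union> {w \<in> A. t * dep y w < 0}"
    proof
      fix w assume "w \<in> {w \<in> A. ?c w < 0}"
      then show "w \<in> {w \<in> A. s * dep x w < 0} \<union> {w \<in> A. t * dep y w < 0}"
        using or[of w] by auto
    qed
    then have "card {w \<in> A. ?c w < 0} \<le> card ({w \<in> A. s * dep x w < 0} \<union> {w \<in> A. t * dep y w < 0})"
      using finite_A by (intro card_mono) auto
    then show ?thesis using card_Un_le order_trans by blast
  qed
  moreover have "card (supp x \<union> supp y) = card (supp x) + card (supp y)"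
    using disj finite_supp by (intro card_Un_disjoint)
  ultimately show False using st(3,4) by linarith
qed

text \<open>Eliminating \<open>b\<close> between the two dependencies leaves \<open>x\<close>,
  \<open>y\<close> and the set \<open>Z\<close> of non-proportional coordinates as support. Since
  \<open>{x} \<union> Z\<close> is independent,
  \<open>2 * (card Z + 1) \<le> (card Z + 2) + 2\<close>.\<close>

lemma card_nonproportional_le_2:
  assumes "x \<in> A - B" "y \<in> A - B" "x \<noteq> y" "b \<in> supp x" "b \<in> supp y"
  shows "card {b' \<in> B. coord y b * coord x b' \<noteq> coord x b * coord y b'} \<le> 2"
proof -
  let ?Z = "{b' \<in> B. coord y b * coord x b' \<noteq> coord x b * coord y b'}"
  let ?c = "\<lambda>w. coord y b * dep x w + (- coord x b) * dep y w + 0 * dep x w"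
  have A: "x \<in> A" "y \<in> A" and B: "x \<notin> B" "y \<notin> B" using assms by auto
  have b: "b \<in> B" "coord x b \<noteq> 0" "coord y b \<noteq> 0" using assms(4,5) by (auto simp: supp_def)
  have c: "{w \<in> A. ?c w \<noteq> 0} = insert x (insert y ?Z)"
  proof (rule set_eqI)
    fix w
    show "w \<in> {w \<in> A. ?c w \<noteq> 0} \<longleftrightarrow> w \<in> insert x (insert y ?Z)"
    proof (cases "w \<in> B")
      case True
      then show ?thesis
        using B B_subset dep_extra[OF assms(1)] dep_extra[OF assms(2)] by auto
    next
      case False
      then show ?thesis
        using A b assms(3) by (auto simp: dep_outside)
    qed
  qed
  \<comment> \<open>The eliminated element is outside \<open>?Z\<close> but has a non-zero
    coordinate in \<open>x\<close>, which keeps \<open>x\<close> independent of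
    \<open>?Z\<close>.\<close>
  have "?Z \<subseteq> B - {b}" by auto
  then have "\<not> affine_dependent (insert x ?Z)"
    using A(1) b not_in_hull_if_coord independent_subset[of ?Z] by (intro affine_independent_insert) auto
  moreover have "insert x ?Z \<subseteq> affine hull {w \<in> A. ?c w \<noteq> 0}"
    unfolding c using hull_subset[of "insert x (insert y ?Z)" affine] by blast
  ultimately have "2 * card (insert x ?Z) \<le> card {w \<in> A. ?c w \<noteq> 0} + 2"
    by (intro comb_card(3)) (use A in auto)
  moreover have "card (insert x ?Z) = card ?Z + 1" "card (insert x (insert y ?Z)) = card ?Z + 2"
    using B finite_B assms(3) by auto
  ultimately show ?thesis unfolding c by linarith
qed

end

section \<open>Supports of the points outside a basis\<close>

context degree_one_basis
begin

lemma card_B: "int (card B) = aff_dim A + 1"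
proof -
  have "affine hull B = affine hull A"
    using B_subset A_subset by (meson hull_mono hull_minimal affine_affine_hull subset_antisym)
  then show ?thesis
    using aff_dim_affine_independent[OF independent] by (metis aff_dim_affine_hull)
qed

lemma
  assumes "x \<in> A"
  shows sum_coord_supp: "sum (coord x) (supp x) = 1"
    and sum_coord_supp_scaleR: "(\<Sum>b\<in>supp x. coord x b *\<^sub>R b) = x"
  using sum.mono_neutral_right[OF finite_B supp_subset, of x "coord x"]
    sum.mono_neutral_right[OF finite_B supp_subset, of x "\<lambda>b. coord x b *\<^sub>R b"]
    sum_coord[OF assms] sum_coord_scaleR[OF assms] by (auto simp: supp_def)

lemma in_affine_hull_supp:
  assumes "x \<in> A" "supp x \<subseteq> S" "finite S"
  shows "x \<in> affine hull S"
proof -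
  have "x \<in> affine hull (supp x)"
    using sum_coord_supp[OF assms(1)] sum_coord_supp_scaleR[OF assms(1)] finite_supp
    by (auto simp: affine_hull_finite)
  then show ?thesis using hull_mono[OF assms(2), of affine] by blast
qed

text \<open>Coordinates in the symmetric difference of the supports are not proportional, so there
  are at most two of them: \<open>3 + card (supp y) - 2 * card (supp x \<inter> supp y) \<le>
  2\<close>.\<close>

lemma card_Int_supp_ge_2:
  assumes x: "x \<in> A - B" "card (supp x) = 3" and y: "y \<in> A - B"
  shows "card (supp x \<inter> supp y) \<ge> 2"
proof (cases "x = y")
  case False
  let ?X = "supp x" and ?Y = "supp y"
  obtain b where b: "b \<in> ?X" "b \<in> ?Y" using supp_Int_nonempty[OF x(1) y] by blast
  have "(?X - ?Y) \<union> (?Y - ?X) \<subseteq> {b' \<in> B. coord y b * coord x b' \<noteq> coord x b * coord y b'}"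
    using b by (auto simp: supp_def)
  then have "card ((?X - ?Y) \<union> (?Y - ?X)) \<le> card {b' \<in> B. coord y b * coord x b' \<noteq> coord x b * coord y b'}"
    using finite_B by (intro card_mono) auto
  then have "card ((?X - ?Y) \<union> (?Y - ?X)) \<le> 2"
    using card_nonproportional_le_2[OF x(1) y False b] by linarith
  moreover have "card ((?X - ?Y) \<union> (?Y - ?X)) = card (?X - ?Y) + card (?Y - ?X)"
    using finite_supp by (intro card_Un_disjoint) auto
  moreover have "card (?X - ?Y) + card (?X \<inter> ?Y) = card ?X" "card (?Y - ?X) + card (?X \<inter> ?Y) = card ?Y"
    using finite_supp by (metis card_Diff_subset_Int card_mono finite_Int inf_le1 le_add_diff_inverse2 inf_commute)+
  ultimately show ?thesis using x(2) card_supp_ge_2[OF y] by linarith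
qed (use x in simp)

text \<open>The two permitted exceptions are already used up by \<open>b2\<close> and
  \<open>b3\<close>.\<close>

lemma coord_proportional:
  assumes "x \<in> A - B" "y \<in> A - B" "b \<in> supp x" "b \<in> supp y"
    "b2 \<in> supp x - supp y" "b3 \<in> supp y - supp x" "b' \<in> B - {b2, b3}"
  shows "coord y b * coord x b' = coord x b * coord y b'"
proof (rule ccontr)
  assume ne: "coord y b * coord x b' \<noteq> coord x b * coord y b'"
  have "x \<noteq> y" using assms(5) by blast
  have "{b', b2, b3} \<subseteq> {b' \<in> B. coord y b * coord x b' \<noteq> coord x b * coord y b'}"
    using assms(3-7) ne by (auto simp: supp_def)
  then have "card {b', b2, b3} \<le> card {b' \<in> B. coord y b * coord x b' \<noteq> coord x b * coord y b'}"
    using finite_B by (intro card_mono) auto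
  also have "\<dots> \<le> 2"
    using card_nonproportional_le_2[OF assms(1,2) \<open>x \<noteq> y\<close> assms(3,4)] .
  also have "card {b', b2, b3} = 3"
    using assms(5-7) by (auto simp: card_insert_if)
  finally show False by simp
qed

text \<open>Three such points would give the circuit \<open>{x, y, z, b0, b1}\<close>, in which \<open>b1\<close> occurs with twice
  the common ratio of its coordinate to that of \<open>b0\<close>.\<close>

lemma no_three_triples:
  assumes xyz: "x \<in> A - B" "y \<in> A - B" "z \<in> A - B" and b: "distinct [b0, b1, b2, b3]"
    and supp: "supp x = {b0, b1, b2}" "supp y = {b0, b1, b3}" "supp z = {b0, b2, b3}"
  shows False
proof -
  have B: "b0 \<in> B" "b1 \<in> B" "b2 \<in> B" "b3 \<in> B"
    using supp supp_subset by blast+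
  have A: "x \<in> A" "y \<in> A" "z \<in> A" and nB: "x \<notin> B" "y \<notin> B" "z \<notin> B" using xyz by auto
  have neq: "x \<noteq> y" "x \<noteq> z" "y \<noteq> z" using supp b by force+
  have nz: "coord x b0 \<noteq> 0" "coord y b0 \<noteq> 0" "coord z b0 \<noteq> 0" "coord x b1 \<noteq> 0"
    using supp by (auto simp: supp_def set_eq_iff)
  have xy: "coord y b0 * coord x b1 = coord x b0 * coord y b1"
    using b B by (intro coord_proportional[OF xyz(1,2), of b0 b2 b3]) (auto simp: supp)
  have xz: "coord z b0 * coord x b2 = coord x b0 * coord z b2"
    using b B by (intro coord_proportional[OF xyz(1,3), of b0 b1 b3]) (auto simp: supp)
  have yz: "coord z b0 * coord y b3 = coord y b0 * coord z b3"
    using b B by (intro coord_proportional[OF xyz(2,3), of b0 b1 b2]) (auto simp: supp)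
  \<comment> \<open>By proportionality the third term cancels \<open>b2\<close> against the first
    and \<open>b3\<close> against the second; the normalisation leaves coefficient
    \<open>1 + 1 - 1\<close> at \<open>b0\<close>.\<close>
  let ?c = "\<lambda>w. (1 / coord x b0) * dep x w + (1 / coord y b0) * dep y w + (- 1 / coord z b0) * dep z w"
  let ?C = "{x, y, z, b0, b1}"
  have zero: "coord v w = 0" if "w \<in> B" "w \<notin> supp v" for v w using that by (simp add: supp_def)
  have c0: "?c w = 0" if w: "w \<in> A" "w \<notin> ?C" for w
  proof (cases "w \<in> B")
    case True
    then have e: "?c w = coord x w / coord x b0 + coord y w / coord y b0 - coord z w / coord z b0"
      using xyz by (simp add: dep_extra)
    consider "w = b2" | "w = b3" | "w \<notin> {b0, b1, b2, b3}" using w by blast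
    then show ?thesis
    proof cases
      case 1
      have "coord y w = 0" using 1 B b supp by (intro zero) auto
      then show ?thesis unfolding e using 1 xz nz by (simp add: field_simps)
    next
      case 2
      have "coord x w = 0" using 2 B b supp by (intro zero) auto
      then show ?thesis unfolding e using 2 yz nz by (simp add: field_simps)
    next
      case 3
      then have "coord x w = 0" "coord y w = 0" "coord z w = 0" using True supp by (auto intro!: zero)
      then show ?thesis unfolding e by simp
    qed
  next
    case False
    then show ?thesis using w A by (simp add: dep_outside)
  qed
  have c1: "?c w \<noteq> 0" if "w \<in> ?C" for w
  proof -
    have "coord z b1 = 0" using B b supp by (intro zero) auto
    then have "?c b1 = coord x b1 / coord x b0 + coord y b1 / coord y b0"
      using xyz B by (simp add: dep_extra)
    also have "coord y b1 / coord y b0 = coord x b1 / coord x b0"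
      using xy nz by (simp add: field_simps)
    finally have "?c b1 \<noteq> 0" using nz by simp
    moreover have "?c b0 = 1" using xyz B nz by (simp add: dep_extra)
    moreover have "?c x \<noteq> 0" "?c y \<noteq> 0" "?c z \<noteq> 0"
      using A nB neq nz by (simp_all add: dep_outside)
    ultimately show ?thesis using that by auto
  qed
  have "?C \<subseteq> A" using A B B_subset by blast
  then have C: "{w \<in> A. ?c w \<noteq> 0} = ?C" using c0 c1 by blast
  \<comment> \<open>The cancelled elements are recovered from \<open>x\<close> and \<open>y\<close>,
    so five points span a set of four independent ones, against the bound
    \<open>2 * 4 \<le> 5 + 2\<close>.\<close>
  have "b2 \<in> affine hull ?C"
    using supp_in_hull[OF xyz(1), of b2] supp(1) b hull_mono[of "insert x (supp x - {b2})" ?C affine] by auto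
  moreover have "b3 \<in> affine hull ?C"
    using supp_in_hull[OF xyz(2), of b3] supp(2) b hull_mono[of "insert y (supp y - {b3})" ?C affine] by auto
  ultimately have "{b0, b1, b2, b3} \<subseteq> affine hull {w \<in> A. ?c w \<noteq> 0}"
    unfolding C by (simp add: hull_inc)
  moreover have "\<not> affine_dependent {b0, b1, b2, b3}" using B by (intro independent_subset) auto
  ultimately have "2 * card {b0, b1, b2, b3} \<le> card {w \<in> A. ?c w \<noteq> 0} + 2"
    by (intro comb_card(3)) (use A in auto)
  moreover have "card ?C \<le> 5" by (simp add: card_insert_if)
  moreover have "card {b0, b1, b2, b3} = 4" using b by simp
  ultimately show False unfolding C by linarith
qed

section \<open>Positions of the points on lines through a common point\<close>

lemma line_pairs_same_sign:
  assumes pts: "x1 \<in> A" "y1 \<in> A" "x2 \<in> A" "y2 \<in> A" "distinct [x1, y1, x2, y2]"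
    and comb: "r1 *\<^sub>R x1 + s1 *\<^sub>R y1 = u" "r1 + s1 = \<eta>" "r2 *\<^sub>R x2 + s2 *\<^sub>R y2 = u" "r2 + s2 = \<eta>"
    and pos: "r1 > 0" "s1 > 0" and nz: "r2 \<noteq> 0" "s2 \<noteq> 0"
    and D: "\<not> affine_dependent D" "card D = 3" "D \<subseteq> affine hull {x1, y1, x2, y2}"
  shows "r2 > 0 \<and> s2 > 0"
proof -
  define \<delta> :: "'a \<Rightarrow> 'a \<Rightarrow> real" where "\<delta> p z = (if z = p then 1 else 0)" for p z
  have \<delta>: "sum (\<delta> p) A = 1" "(\<Sum>z\<in>A. \<delta> p z *\<^sub>R z) = p" if "p \<in> A" for p
    using that finite_A by (simp_all add: \<delta>_def if_distrib[of "\<lambda>r. r *\<^sub>R _"] cong: if_cong)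
  define c where "c z = r1 * \<delta> x1 z + s1 * \<delta> y1 z - r2 * \<delta> x2 z - s2 * \<delta> y2 z" for z
  have "sum c A = r1 * sum (\<delta> x1) A + s1 * sum (\<delta> y1) A - r2 * sum (\<delta> x2) A - s2 * sum (\<delta> y2) A"
    by (simp add: c_def sum.distrib sum_subtractf sum_distrib_left)
  then have c0: "sum c A = 0" using \<delta> pts comb by simp
  have "(\<Sum>z\<in>A. c z *\<^sub>R z) = r1 *\<^sub>R (\<Sum>z\<in>A. \<delta> x1 z *\<^sub>R z) + s1 *\<^sub>R (\<Sum>z\<in>A. \<delta> y1 z *\<^sub>R z)
      - r2 *\<^sub>R (\<Sum>z\<in>A. \<delta> x2 z *\<^sub>R z) - s2 *\<^sub>R (\<Sum>z\<in>A. \<delta> y2 z *\<^sub>R z)"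
    by (simp add: c_def sum.distrib sum_subtractf scaleR_add_left scaleR_diff_left scaleR_sum_right)
  then have "(\<Sum>z\<in>A. c z *\<^sub>R z) = (r1 *\<^sub>R x1 + s1 *\<^sub>R y1) - (r2 *\<^sub>R x2 + s2 *\<^sub>R y2)"
    using \<delta> pts by simp
  also have "\<dots> = 0" unfolding comb by simp
  finally have c1: "(\<Sum>z\<in>A. c z *\<^sub>R z) = 0" .
  have val: "c x1 = r1" "c y1 = s1" "c x2 = - r2" "c y2 = - s2" "\<And>z. z \<notin> {x1, y1, x2, y2} \<Longrightarrow> c z = 0"
    using pts(5) by (auto simp: c_def \<delta>_def)
  have "{x1, y1, x2, y2} \<subseteq> {z \<in> A. c z \<noteq> 0}"
    using pts(1-4) val pos nz by auto
  then have "D \<subseteq> affine hull {z \<in> A. c z \<noteq> 0}"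
    using D(3) hull_mono[of "{x1, y1, x2, y2}" "{z \<in> A. c z \<noteq> 0}" affine] by blast
  \<comment> \<open>The difference of the two representations of (\<open>u\<close>,
    \<open>\<eta>\<close>) is a dependency spanning at least a plane, so it has two negative
    coefficients; these can only be \<open>- r2\<close> and \<open>- s2\<close>.\<close>
  then have two: "2 \<le> card {z \<in> A. c z < 0}"
    using degree_le_one_dependency_card(1)[OF finite_A degree c0 c1 D(1)] D(2) by simp
  have sub: "{z \<in> A. c z < 0} \<subseteq> {x2, y2}"
  proof
    fix z assume z: "z \<in> {z \<in> A. c z < 0}"
    then have "z \<in> {x1, y1, x2, y2}" using val(5)[of z] by force
    then show "z \<in> {x2, y2}" using z val pos by auto
  qed
  show ?thesis
  proof (rule ccontr)
    assume "\<not> ?thesis"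
    then have "r2 < 0 \<or> s2 < 0" using nz by linarith
    then have "{z \<in> A. c z < 0} \<subseteq> {y2} \<or> {z \<in> A. c z < 0} \<subseteq> {x2}"
      using sub val by force
    then have "card {z \<in> A. c z < 0} \<le> 1"
      by (metis card.empty card_1_singleton_iff card_mono finite.emptyI finite_insert One_nat_def is_singletonI is_singleton_altdef order_refl)
    then show False using two by linarith
  qed
qed

text \<open>Three segments crossing in a common point that are affinely independent otherwise form an
  octahedron, whose diagonals are interior segments.\<close>

lemma no_octahedron:
  assumes pts: "x1 \<in> A" "y1 \<in> A" "x2 \<in> A" "y2 \<in> A" "x3 \<in> A" "y3 \<in> A" "distinct [x1, y1, x2, y2, x3, y3]"
    and comb: "r1 *\<^sub>R x1 + s1 *\<^sub>R y1 = u" "r1 + s1 = \<eta>" "r2 *\<^sub>R x2 + s2 *\<^sub>R y2 = u" "r2 + s2 = \<eta>"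
      "r3 *\<^sub>R x3 + s3 *\<^sub>R y3 = u" "r3 + s3 = \<eta>"
    and pos: "r1 > 0" "s1 > 0" "r2 > 0" "s2 > 0" "r3 > 0" "s3 > 0"
    and D: "\<not> affine_dependent D" "card D = 4" "D \<subseteq> affine hull {x1, y1, x2, y2, x3, y3}"
  shows False
proof -
  define \<delta> :: "'a \<Rightarrow> 'a \<Rightarrow> real" where "\<delta> p z = (if z = p then 1 else 0)" for p z
  have \<delta>: "sum (\<delta> p) A = 1" "(\<Sum>z\<in>A. \<delta> p z *\<^sub>R z) = p" if "p \<in> A" for p
    using that finite_A by (simp_all add: \<delta>_def if_distrib[of "\<lambda>r. r *\<^sub>R _"] cong: if_cong)
  \<comment> \<open>Doubling the first segment balances the other two, so only its two end points
    are negative although the support has dimension at least 3.\<close>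
  define c where "c z = r2 * \<delta> x2 z + s2 * \<delta> y2 z + r3 * \<delta> x3 z + s3 * \<delta> y3 z
      - (2 * r1) * \<delta> x1 z - (2 * s1) * \<delta> y1 z" for z
  have "sum c A = r2 * sum (\<delta> x2) A + s2 * sum (\<delta> y2) A + r3 * sum (\<delta> x3) A + s3 * sum (\<delta> y3) A
      - (2 * r1) * sum (\<delta> x1) A - (2 * s1) * sum (\<delta> y1) A"
    by (simp add: c_def sum.distrib sum_subtractf sum_distrib_left)
  then have c0: "sum c A = 0" using \<delta> pts comb by simp
  have "(\<Sum>z\<in>A. c z *\<^sub>R z) = r2 *\<^sub>R (\<Sum>z\<in>A. \<delta> x2 z *\<^sub>R z) + s2 *\<^sub>R (\<Sum>z\<in>A. \<delta> y2 z *\<^sub>R z)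
      + r3 *\<^sub>R (\<Sum>z\<in>A. \<delta> x3 z *\<^sub>R z) + s3 *\<^sub>R (\<Sum>z\<in>A. \<delta> y3 z *\<^sub>R z)
      - (2 * r1) *\<^sub>R (\<Sum>z\<in>A. \<delta> x1 z *\<^sub>R z) - (2 * s1) *\<^sub>R (\<Sum>z\<in>A. \<delta> y1 z *\<^sub>R z)"
    by (simp add: c_def sum.distrib sum_subtractf scaleR_add_left scaleR_diff_left scaleR_sum_right)
  then have "(\<Sum>z\<in>A. c z *\<^sub>R z) = (r2 *\<^sub>R x2 + s2 *\<^sub>R y2) + (r3 *\<^sub>R x3 + s3 *\<^sub>R y3) - 2 *\<^sub>R (r1 *\<^sub>R x1 + s1 *\<^sub>R y1)"
    using \<delta> pts by (simp add: scaleR_add_right)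
  also have "\<dots> = 0" unfolding comb by (simp add: scaleR_2)
  finally have c1: "(\<Sum>z\<in>A. c z *\<^sub>R z) = 0" .
  have val: "c x1 = - 2 * r1" "c y1 = - 2 * s1" "c x2 = r2" "c y2 = s2" "c x3 = r3" "c y3 = s3"
    "\<And>z. z \<notin> {x1, y1, x2, y2, x3, y3} \<Longrightarrow> c z = 0"
    using pts(7) by (auto simp: c_def \<delta>_def)
  have "{x1, y1, x2, y2, x3, y3} \<subseteq> {z \<in> A. c z \<noteq> 0}"
    using pts(1-6) val pos by auto
  then have "D \<subseteq> affine hull {z \<in> A. c z \<noteq> 0}"
    using D(3) hull_mono[of "{x1, y1, x2, y2, x3, y3}" "{z \<in> A. c z \<noteq> 0}" affine] by blast
  then have "3 \<le> card {z \<in> A. c z < 0}"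
    using degree_le_one_dependency_card(1)[OF finite_A degree c0 c1 D(1)] D(2) by simp
  also have "card {z \<in> A. c z < 0} \<le> card {x1, y1}"
  proof (rule card_mono)
    show "{z \<in> A. c z < 0} \<subseteq> {x1, y1}"
    proof
      fix z assume z: "z \<in> {z \<in> A. c z < 0}"
      then have "z \<in> {x1, y1, x2, y2, x3, y3}" using val(7)[of z] by force
      then show "z \<in> {x1, y1}" using z val pos by auto
    qed
  qed simp
  also have "\<dots> \<le> 2" by (simp add: card_insert_if)
  finally show False by simp
qed

text \<open>If \<open>\<gamma>1 < 0\<close>, the common point is finite and lies strictly between
  \<open>x1\<close> and \<open>k1\<close>. Comparing two lines at a time puts it between the chosen
  points on the other two lines as well, and the three segments form the forbidden
  octahedron.\<close>

lemma same_side: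
  assumes A: "x1 \<in> A" "x2 \<in> A" "x3 \<in> A" and B: "k1 \<in> B" "k2 \<in> B" "k3 \<in> B" "b \<in> B"
    and dist: "distinct [b, k1, k2, k3]" "distinct [x1, x2, x3]"
    and b: "coord x1 b \<noteq> 0" "coord x2 b \<noteq> 0" "coord x3 b \<noteq> 0"
    and x: "x1 = s1 *\<^sub>R u + \<gamma>1 *\<^sub>R k1" "x2 = s2 *\<^sub>R u + \<gamma>2 *\<^sub>R k2" "x3 = s3 *\<^sub>R u + \<gamma>3 *\<^sub>R k3"
    and h: "s1 * \<eta> + \<gamma>1 = 1" "s2 * \<eta> + \<gamma>2 = 1" "s3 * \<eta> + \<gamma>3 = 1"
    and s: "s1 \<noteq> 0" "s2 \<noteq> 0" "s3 \<noteq> 0" and \<gamma>: "\<gamma>1 \<noteq> 0" "\<gamma>2 \<noteq> 0" "\<gamma>3 \<noteq> 0"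
  shows "\<gamma>1 > 0"
proof (rule ccontr)
  assume "\<not> \<gamma>1 > 0"
  then have neg: "\<gamma>1 < 0" using \<gamma>(1) by linarith
  \<comment> \<open>normalises the coefficients on the first line to be positive\<close>
  define \<sigma> where "\<sigma> = sgn s1"
  have \<sigma>: "\<sigma> \<noteq> 0" "\<sigma> / s1 > 0" using s(1) by (auto simp: \<sigma>_def sgn_real_def)
  have k: "k1 \<in> A" "k2 \<in> A" "k3 \<in> A" using B B_subset by auto
  have xk: "x1 \<notin> {k1, k2, k3}" "x2 \<notin> {k1, k2, k3}" "x3 \<notin> {k1, k2, k3}"
    using b dist(1) B coord_basis by auto
  have distinct: "distinct [x1, k1, x2, k2, x3, k3]" using xk dist by auto
  have comb: "(\<sigma> / s) *\<^sub>R x + (- \<sigma> * \<gamma> / s) *\<^sub>R k = \<sigma> *\<^sub>R u \<and> \<sigma> / s + - \<sigma> * \<gamma> / s = \<sigma> * \<eta>"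
    if "x = s *\<^sub>R u + \<gamma> *\<^sub>R k" "s * \<eta> + \<gamma> = 1" "s \<noteq> 0" for x s \<gamma> k
  proof -
    have "\<gamma> = 1 - s * \<eta>" using that(2) by linarith
    then have "\<sigma> * (1 - \<gamma>) / s = \<sigma> * \<eta>" using that(3) by simp
    then have "\<sigma> / s + - \<sigma> * \<gamma> / s = \<sigma> * \<eta>" by (simp add: right_diff_distrib diff_divide_distrib)
    moreover have "(\<sigma> / s) *\<^sub>R x + (- \<sigma> * \<gamma> / s) *\<^sub>R k = \<sigma> *\<^sub>R u"
      unfolding that(1) using that(3) by (simp add: scaleR_add_right)
    ultimately show ?thesis by blast
  qed
  note c1 = comb[OF x(1) h(1) s(1)] and c2 = comb[OF x(2) h(2) s(2)] and c3 = comb[OF x(3) h(3) s(3)]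
  have "- \<sigma> * \<gamma>1 / s1 = (- \<gamma>1) * (\<sigma> / s1)" by (simp add: mult.commute)
  moreover have "(- \<gamma>1) * (\<sigma> / s1) > 0" using \<sigma>(2) neg by (intro mult_pos_pos) auto
  ultimately have pos: "\<sigma> / s1 > 0" "- \<sigma> * \<gamma>1 / s1 > 0"
    using \<sigma>(2) by linarith+
  \<comment> \<open>The coordinate at \<open>b\<close> separates \<open>x1\<close> from the basis
    elements on the lines.\<close>
  have ind: "\<not> affine_dependent (insert x1 S)" if "S \<subseteq> B - {b}" for S
    using that not_in_hull_if_coord[OF A(1) B(4) b(1) that] independent_subset[of S]
    by (intro affine_independent_insert) auto
  have nz: "\<sigma> / s2 \<noteq> 0" "- \<sigma> * \<gamma>2 / s2 \<noteq> 0" "\<sigma> / s3 \<noteq> 0" "- \<sigma> * \<gamma>3 / s3 \<noteq> 0"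
    using s \<gamma> \<sigma> by auto
  have "\<sigma> / s2 > 0 \<and> - \<sigma> * \<gamma>2 / s2 > 0"
  proof (rule line_pairs_same_sign[of x1 k1 x2 k2, OF A(1) k(1) A(2) k(2) _
        conjunct1[OF c1] conjunct2[OF c1] conjunct1[OF c2] conjunct2[OF c2] pos nz(1,2)])
    show "\<not> affine_dependent (insert x1 {k1, k2})" using B dist by (intro ind) auto
    show "insert x1 {k1, k2} \<subseteq> affine hull {x1, k1, x2, k2}" by (simp add: hull_inc)
    show "card (insert x1 {k1, k2}) = 3" using distinct by simp
  qed (use distinct in auto)
  moreover have "\<sigma> / s3 > 0 \<and> - \<sigma> * \<gamma>3 / s3 > 0"
  proof (rule line_pairs_same_sign[of x1 k1 x3 k3, OF A(1) k(1) A(3) k(3) _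
        conjunct1[OF c1] conjunct2[OF c1] conjunct1[OF c3] conjunct2[OF c3] pos nz(3,4)])
    show "\<not> affine_dependent (insert x1 {k1, k3})" using B dist by (intro ind) auto
    show "insert x1 {k1, k3} \<subseteq> affine hull {x1, k1, x3, k3}" by (simp add: hull_inc)
    show "card (insert x1 {k1, k3}) = 3" using distinct by simp
  qed (use distinct in auto)
  ultimately show False
  proof (intro no_octahedron[of x1 k1 x2 k2 x3 k3, OF A(1) k(1) A(2) k(2) A(3) k(3) distinct
        conjunct1[OF c1] conjunct2[OF c1] conjunct1[OF c2] conjunct2[OF c2] conjunct1[OF c3] conjunct2[OF c3] pos])
    show "\<not> affine_dependent (insert x1 {k1, k2, k3})" using B dist by (intro ind) auto
    show "insert x1 {k1, k2, k3} \<subseteq> affine hull {x1, k1, x2, k2, x3, k3}" by (simp add: hull_inc)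
    show "card (insert x1 {k1, k2, k3}) = 4" using distinct by simp
  qed auto
qed

text \<open>An interior point is a positive combination of all of \<open>C\<close>; the resulting
  dependency has that point as its only negative element, which allows dimension at most 1.\<close>

lemma no_interior_point:
  assumes C: "C \<subseteq> A" "aff_dim C \<ge> 2"
  shows "without_interior_points C"
  unfolding without_interior_points_def
proof (rule ccontr)
  assume "C \<inter> rel_interior (convex hull C) \<noteq> {}"
  then obtain x where x: "x \<in> C" "x \<in> rel_interior (convex hull C)" by blast
  have fin: "finite C" using C(1) finite_A finite_subset by blast
  have "x \<in> rel_interior (convex hull (\<Union>y\<in>C. {y}))" using x(2) by simp
  also have "\<dots> = {\<Sum>y\<in>C. e y *\<^sub>R s y |e s. (\<forall>y\<in>C. 0 < e y) \<and> sum e C = 1 \<and> (\<forall>y\<in>C. s y \<in> rel_interior {y})}"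
    by (rule rel_interior_convex_hull_union) (use fin in auto)
  finally obtain e s where es: "x = (\<Sum>y\<in>C. e y *\<^sub>R s y)" "\<forall>y\<in>C. 0 < e y" "sum e C = 1"
    "\<forall>y\<in>C. s y \<in> rel_interior {y}" by (elim CollectE exE conjE)
  then have e: "\<And>y. y \<in> C \<Longrightarrow> 0 < e y" "sum e C = 1" by auto
  have xe: "x = (\<Sum>y\<in>C. e y *\<^sub>R y)" unfolding es(1) using es(4) by (intro sum.cong) auto
  have xA: "x \<in> A" using x C by blast
  define c where "c y = (if y \<in> C then e y else 0) - (if y = x then 1 else 0)" for y
  have "(\<Sum>y\<in>A. if y \<in> C then e y else 0) = 1"
    using finite_A C(1) e(2) by (simp add: sum.If_cases inf.absorb2)
  then have c0: "sum c A = 0"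
    using finite_A xA by (simp add: c_def sum_subtractf)
  have "(\<Sum>y\<in>A. if y \<in> C then e y *\<^sub>R y else 0) = x"
    using finite_A C(1) xe by (simp add: sum.If_cases inf.absorb2)
  then have c1: "(\<Sum>y\<in>A. c y *\<^sub>R y) = 0"
    using finite_A xA
    by (simp add: c_def scaleR_diff_left sum_subtractf if_distrib[of "\<lambda>r. r *\<^sub>R _"] cong: if_cong)
  have "C \<noteq> {x}" using C(2) by auto
  then obtain y where y: "y \<in> C" "y \<noteq> x" using x(1) by blast
  have "e x + e y \<le> sum e C"
    using sum_mono2[of C "{x, y}" e] fin e(1) x(1) y by (auto intro: less_imp_le)
  then have "e x < 1" using e(1)[OF y(1)] e(2) by linarith
  then have cx: "c x < 0" using x(1) by (simp add: c_def)
  have cC: "c z > 0" if "z \<in> C" "z \<noteq> x" for z using that e(1) by (simp add: c_def)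
  have out: "c z = 0" if "z \<notin> C" for z using that x(1) by (auto simp: c_def)
  have "c z \<noteq> 0 \<longleftrightarrow> z \<in> C" for z using cx cC[of z] out[of z] by fastforce
  then have "{y \<in> A. c y \<noteq> 0} = C" using C(1) by blast
  moreover have "{y \<in> A. c y < 0} \<subseteq> {x}" using cC out by (force simp: not_less_iff_gr_or_eq)
  then have "card {y \<in> A. c y < 0} \<le> card {x}" by (intro card_mono) simp_all
  ultimately show False
    using degree_le_one_dependency[OF finite_A degree c0 c1] C(2) by simp
qed

section \<open>Assembling the cases of the classification\<close>

lemma polygon_pyramid_exists:
  assumes supp: "\<And>x. x \<in> A - B \<Longrightarrow> supp x \<subseteq> B0" and B0: "B0 \<subseteq> B" "card B0 = 3"
  shows "\<exists>k C. (config_pyramid ^^ k) A C \<and> aff_dim C = 2 \<and> without_interior_points C"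
proof -
  define C where "C = B0 \<union> (A - B)"
  have finB0: "finite B0" using B0 finite_B finite_subset by blast
  have "C \<subseteq> affine hull B0"
    using supp finB0 by (auto simp: C_def intro: hull_inc in_affine_hull_supp)
  then have hull: "affine hull C = affine hull B0"
    by (intro subset_antisym hull_minimal hull_mono) (auto simp: C_def)
  have "aff_dim B0 = 2"
    using aff_dim_affine_independent[OF independent_subset[OF B0(1)]] B0(2) by simp
  then have dim: "aff_dim C = 2" using hull by (metis aff_dim_affine_hull)
  have "(config_pyramid ^^ card (B - B0)) (C \<union> (B - B0)) C"
  proof (rule config_pyramid_iterate[OF _ _ _ hull])
    show "\<not> affine_dependent (B0 \<union> (B - B0))" by (intro independent_subset) (use B0 in auto)
  qed (use finite_B in auto)
  moreover have "C \<union> (B - B0) = A" using B_subset B0 by (auto simp: C_def)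
  moreover have "C \<subseteq> A" using B_subset B0 by (auto simp: C_def)
  ultimately show ?thesis using dim no_interior_point[of C] by auto
qed

lemma supp_eqI: "S \<subseteq> supp x \<Longrightarrow> card S = card (supp x) \<Longrightarrow> supp x = S"
  using card_subset_eq[OF finite_supp] by metis

text \<open>Pairwise meeting two-element sets have a common element unless they lie within three
  elements, which the size of the union excludes. The lines then pass through the common element
  \<open>v\<close>, so \<open>same_side\<close> applies with homogeneous coordinates
  (\<open>v\<close>, 1).\<close>

lemma star_case:
  assumes pairs: "\<And>x. x \<in> A - B \<Longrightarrow> card (supp x) = 2" and U: "card (\<Union>x\<in>A - B. supp x) \<ge> 4"
  shows "aff_dim A simplex (convex hull A) \<and>
    (\<exists>v. v extreme_point_of (convex hull A) \<and> nonvertex_points A \<subseteq> \<Union>{E. E edge_of (convex hull A) \<and> v \<in> E})"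
proof -
  let ?U = "\<Union>x\<in>A - B. supp x"
  have new: "\<exists>y\<in>A - B. \<exists>e\<in>supp y. e \<notin> S" if "finite S" "card S \<le> 3" for S
  proof (rule ccontr)
    assume "\<not> ?thesis"
    then have "?U \<subseteq> S" by blast
    then have "card ?U \<le> card S" using that(1) by (rule card_mono[rotated])
    then show False using that(2) U by linarith
  qed
  have pair: "\<exists>f. f \<noteq> e \<and> supp x = {e, f}" if "x \<in> A - B" "e \<in> supp x" for x e
    using pairs[OF that(1)] that(2) by (auto simp: card_2_iff)
  have meet: "supp x \<inter> supp y \<noteq> {}" if "x \<in> A - B" "y \<in> A - B" for x y
    by (rule supp_Int_nonempty[OF that])
  obtain x where x: "x \<in> A - B" using new[of "{}"] by auto
  then obtain a0 b0 where ab0: "a0 \<noteq> b0" "supp x = {a0, b0}" using pairs card_2_iff by metis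
  obtain y c where y: "y \<in> A - B" "c \<in> supp y" "c \<notin> {a0, b0}"
    using new[of "{a0, b0}"] ab0(1) by auto
  obtain f where f: "supp y = {c, f}" using pair[OF y(1,2)] by blast
  have "f \<in> {a0, b0}" using meet[OF x y(1)] f y(3) ab0 by auto
  then obtain v b where v: "v \<noteq> b" "supp x = {v, b}" "supp y = {v, c}" "c \<notin> {v, b}"
    using ab0 f y(3) by (metis insert_commute insert_iff singletonD)
  obtain z e where z: "z \<in> A - B" "e \<in> supp z" "e \<notin> {v, b, c}"
    using new[of "{v, b, c}"] v by auto
  have zs: "supp z = {v, e}"
  proof -
    obtain f where f: "supp z = {e, f}" using pair[OF z(1,2)] by blast
    then have "f \<in> {v, b}" "f \<in> {v, c}" using meet[OF x z(1)] meet[OF y(1) z(1)] v z(3) by auto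
    then show ?thesis using f v by auto
  qed
  \<comment> \<open>A support avoiding \<open>v\<close> would have to meet \<open>{v, b}\<close>,
    \<open>{v, c}\<close> and \<open>{v, e}\<close> in three different elements.\<close>
  have vsupp: "v \<in> supp w" if w: "w \<in> A - B" for w
  proof (rule ccontr)
    assume "v \<notin> supp w"
    then have "{b, c, e} \<subseteq> supp w"
      using meet[OF x w] meet[OF y(1) w] meet[OF z(1) w] v zs by auto
    then have "card {b, c, e} \<le> card (supp w)" using finite_supp by (intro card_mono)
    moreover have "card {b, c, e} = 3" using v(4) z(3) by auto
    ultimately show False using pairs[OF w] by simp
  qed
  have vB: "v \<in> B" using v supp_subset[of x] by blast
  have point: "\<exists>k. k \<in> B - {v} \<and> supp w = {v, k} \<and> coord w v \<noteq> 0 \<and> coord w k \<noteq> 0 \<and>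
      w = coord w v *\<^sub>R v + coord w k *\<^sub>R k \<and> coord w v * 1 + coord w k = 1" if w: "w \<in> A - B" for w
  proof -
    obtain k where k: "k \<noteq> v" "supp w = {v, k}" using pair[OF w vsupp[OF w]] by blast
    have "v \<in> supp w" "k \<in> supp w" using k by auto
    then have "k \<in> B" "coord w v \<noteq> 0" "coord w k \<noteq> 0" by (auto simp: supp_def)
    moreover have "w = coord w v *\<^sub>R v + coord w k *\<^sub>R k" "coord w v * 1 + coord w k = 1"
      using sum_coord_supp[of w] sum_coord_supp_scaleR[of w] w k by auto
    ultimately show ?thesis using k by blast
  qed
  have positive: "coord w k > 0" if w: "w \<in> A - B" "k \<noteq> v" "supp w = {v, k}" for w k
  proof -
    \<comment> \<open>Points on two further lines, as required for \<open>same_side\<close>.\<close>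
    obtain w2 k2 where w2: "w2 \<in> A - B" "k2 \<in> supp w2" "k2 \<notin> {v, k}"
      using new[of "{v, k}"] w(2) by auto
    obtain w3 k3 where w3: "w3 \<in> A - B" "k3 \<in> supp w3" "k3 \<notin> {v, k, k2}"
      using new[of "{v, k, k2}"] w(2) w2(3) by auto
    have s2: "supp w2 = {v, k2}" using pair[OF w2(1) vsupp[OF w2(1)]] w2 by auto
    have s3: "supp w3 = {v, k3}" using pair[OF w3(1) vsupp[OF w3(1)]] w3 by auto
    have P: "k' \<in> B \<and> coord w' v \<noteq> 0 \<and> coord w' k' \<noteq> 0 \<and>
      w' = coord w' v *\<^sub>R v + coord w' k' *\<^sub>R k' \<and> coord w' v * 1 + coord w' k' = 1"
      if "w' \<in> A - B" "supp w' = {v, k'}" "k' \<noteq> v" for w' k'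
      using point[OF that(1)] that(2,3) by (metis DiffD1 doubleton_eq_iff)
    note P1 = P[OF w(1,3,2)] and P2 = P[OF w2(1) s2] and P3 = P[OF w3(1) s3]
    show ?thesis
      by (rule same_side[of w w2 w3 k k2 k3 v "coord w v" v "coord w k" "coord w2 v" "coord w2 k2" "coord w3 v" "coord w3 k3" 1])
         (use P1 P2 P3 w w2 w3 s2 s3 vB in \<open>auto simp: doubleton_eq_iff\<close>)
  qed
  show ?thesis
  proof (rule simplex_star_exists[OF finite_A])
    show "v \<in> A" using vB B_subset by blast
    show "B - {v} \<subseteq> A" using B_subset by blast
    show "int (card (B - {v})) = aff_dim A"
      using card_B vB finite_B card_Suc_Diff1[OF finite_B vB] by linarith
    fix w assume wA: "w \<in> A"
    consider "w = v" | "w \<in> B" "w \<noteq> v" | "w \<in> A - B" using wA by blast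
    then show "\<exists>j\<in>B - {v}. \<exists>t\<ge>0. w = (1 - t) *\<^sub>R v + t *\<^sub>R j"
    proof cases
      case 1
      have "b \<in> B - {v}" using v supp_subset[of x] by blast
      then show ?thesis using 1 by (intro bexI[of _ b] exI[of _ 0]) auto
    next
      case 2
      then show ?thesis by (intro bexI[of _ w] exI[of _ 1]) auto
    next
      case 3
      then obtain k where k: "k \<in> B - {v}" "supp w = {v, k}"
        "w = coord w v *\<^sub>R v + coord w k *\<^sub>R k" "coord w v * 1 + coord w k = 1" using point by blast
      have "coord w k > 0" using positive[OF 3 _ k(2)] k(1) by blast
      moreover have "1 - coord w k = coord w v" using k(4) by simp
      ultimately show ?thesis
        using k(1,3) by (intro bexI[of _ k] exI[of _ "coord w k"]) auto
    qed
  qed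
qed

text \<open>One three-element support and one element outside it produce a second triple that shares
  a pair \<open>{b0, b1}\<close> with the first; this pair then belongs to every support. The star
  alternative arises when the common point of the lines is itself in \<open>A\<close>.\<close>

lemma prism_case:
  assumes x: "x \<in> A - B" "card (supp x) = 3" and U: "card (\<Union>x\<in>A - B. supp x) \<ge> 4"
  shows "(\<exists>k P \<Delta> \<phi>. (polytope_pyramid ^^ k) (convex hull A) P \<and> prism_over_simplex \<Delta> \<phi> P \<and>
      nonvertex_points A \<subseteq> \<Union>(vertical_edges \<Delta> \<phi> P)) \<or>
    (aff_dim A simplex (convex hull A) \<and>
    (\<exists>v. v extreme_point_of (convex hull A) \<and> nonvertex_points A \<subseteq> \<Union>{E. E edge_of (convex hull A) \<and> v \<in> E}))"
proof -
  let ?U = "\<Union>x\<in>A - B. supp x"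
  have "\<not> ?U \<subseteq> supp x"
  proof
    assume "?U \<subseteq> supp x"
    then have "card ?U \<le> card (supp x)" using finite_supp by (rule card_mono[rotated])
    then show False using x(2) U by linarith
  qed
  then obtain y b3 where y: "y \<in> A - B" "b3 \<in> supp y" "b3 \<notin> supp x" by blast
  have card2: "2 \<le> card (supp x \<inter> supp y)" using card_Int_supp_ge_2[OF x y(1)] .
  have "insert b3 (supp x \<inter> supp y) \<subseteq> supp y" using y(2) by blast
  then have "card (insert b3 (supp x \<inter> supp y)) \<le> card (supp y)"
    using finite_supp by (rule card_mono[rotated])
  then have cardI: "card (supp x \<inter> supp y) = 2" "card (supp y) = 3"
    using card2 card_supp_le_3[OF y(1)] y(3) finite_supp by auto
  then obtain b0 b1 where b01: "supp x \<inter> supp y = {b0, b1}" "b0 \<noteq> b1" by (metis card_2_iff)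
  have ys: "supp y = {b0, b1, b3}"
  proof (rule supp_eqI)
    show "{b0, b1, b3} \<subseteq> supp y" using b01(1) y(2) by blast
    have "b3 \<noteq> b0" "b3 \<noteq> b1" using b01(1) y(3) by blast+
    then show "card {b0, b1, b3} = card (supp y)" using b01(2) cardI(2) by simp
  qed
  have "{b0, b1} \<subseteq> supp x" using b01(1) by blast
  then have "card (supp x - {b0, b1}) = 1"
    using b01(2) x(2) by (simp add: card_Diff_subset)
  then obtain b2 where b2: "supp x - {b0, b1} = {b2}" by (metis card_1_singleton_iff One_nat_def)
  then have xs: "supp x = {b0, b1, b2}" using b01 by blast
  have dist: "distinct [b0, b1, b2, b3]" using b01 b2 y(3) xs by auto
  have B: "b0 \<in> B" "b1 \<in> B" "b2 \<in> B" "b3 \<in> B"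
    using xs ys supp_subset by blast+
  have Int: "2 \<le> card (supp x \<inter> supp z) \<and> 2 \<le> card (supp y \<inter> supp z)" if "z \<in> A - B" for z
    using card_Int_supp_ge_2[OF x that] card_Int_supp_ge_2[OF y(1) cardI(2) that] by blast
  \<comment> \<open>A support that misses \<open>b0\<close> or \<open>b1\<close> still meets both
    triples in two elements. It is then the third triple excluded by
    \<open>no_three_triples\<close>.\<close>
  have common: "{b0, b1} \<subseteq> supp z" if z: "z \<in> A - B" for z
  proof (rule ccontr)
    assume no: "\<not> {b0, b1} \<subseteq> supp z"
    have two: "p \<in> S \<and> q \<in> S" if "2 \<le> card ({p, q, r} \<inter> S)" "r \<notin> S" for p q r :: 'a and S
    proof -
      have "{p, q, r} \<inter> S = {p, q} \<inter> S" using that(2) by blast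
      then show ?thesis using that(1) by (auto simp: Int_insert_left split: if_splits)
    qed
    have eq: "{b1, b2, b0} = supp x" "{b1, b3, b0} = supp y" "{b0, b2, b1} = supp x" "{b0, b3, b1} = supp y"
      unfolding xs ys by blast+
    have cases: "b1 \<in> supp z \<and> b2 \<in> supp z \<and> b3 \<in> supp z" if "b0 \<notin> supp z"
      using two[of b1 b2 b0 "supp z"] two[of b1 b3 b0 "supp z"] Int[OF z] that unfolding eq by blast
    have cases': "b0 \<in> supp z \<and> b2 \<in> supp z \<and> b3 \<in> supp z" if "b1 \<notin> supp z"
      using two[of b0 b2 b1 "supp z"] two[of b0 b3 b1 "supp z"] Int[OF z] that unfolding eq by blast
    have triple: "supp z = S" if "S \<subseteq> supp z" "card S = 3" for S
      using that card_supp_le_3[OF z] card_mono[OF finite_supp that(1)]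
      by (intro supp_eqI) auto
    show False
    proof (cases "b0 \<in> supp z")
      case True
      then have "supp z = {b0, b2, b3}" using no cases' dist by (intro triple) auto
      then show False using no_three_triples[OF x(1) y(1) z dist xs ys] by blast
    next
      case False
      then have "supp z = {b1, b2, b3}" using cases dist by (intro triple) auto
      moreover have "supp x = {b1, b0, b2}" "supp y = {b1, b0, b3}" "distinct [b1, b0, b2, b3]"
        using xs ys dist by auto
      ultimately show False using no_three_triples[OF x(1) y(1) z, of b1 b0 b2 b3] by blast
    qed
  qed
  define \<alpha> where "\<alpha> = coord x b0"
  define \<beta> where "\<beta> = coord x b1"
  have \<alpha>\<beta>: "\<alpha> \<noteq> 0" "\<beta> \<noteq> 0" using xs by (auto simp: \<alpha>_def \<beta>_def supp_def set_eq_iff)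
  \<comment> \<open>homogeneous coordinates of the point or direction common to all the lines\<close>
  define u where "u = \<alpha> *\<^sub>R b0 + \<beta> *\<^sub>R b1"
  define \<eta> where "\<eta> = \<alpha> + \<beta>"
  have shape: "supp z = {b0, b1} \<or> (\<exists>k. k \<notin> {b0, b1} \<and> supp z = {b0, b1, k})" if z: "z \<in> A - B" for z
  proof -
    have "card (supp z - {b0, b1}) \<le> 1"
      using common[OF z] card_supp_le_3[OF z] b01(2) by (subst card_Diff_subset) auto
    then have "supp z - {b0, b1} = {} \<or> (\<exists>k. supp z - {b0, b1} = {k})"
      using finite_supp by (metis card_0_eq card_1_singletonE finite_Diff le_neq_implies_less less_one)
    then show ?thesis using common[OF z] by blast
  qed
  have prop_xy: "coord y b0 * \<beta> = \<alpha> * coord y b1"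
    unfolding \<alpha>_def \<beta>_def using dist B
    by (intro coord_proportional[OF x(1) y(1), of b0 b2 b3]) (auto simp: xs ys)
  \<comment> \<open>\<open>x\<close> serves for comparison unless \<open>z\<close> has the same
    support; then \<open>y\<close> does, and the ratio is carried over by
    \<open>prop_xy\<close>.\<close>
  have proportional: "coord z b0 * \<beta> = \<alpha> * coord z b1" if z: "z \<in> A - B" "k \<notin> {b0, b1}" "supp z = {b0, b1, k}" for z k
  proof (cases "k = b2")
    case True
    have nz: "coord y b0 \<noteq> 0" using ys by (auto simp: supp_def set_eq_iff)
    have zy: "coord z b0 * coord y b1 = coord y b0 * coord z b1"
      using dist B True z(2)
      by (intro coord_proportional[OF y(1) z(1), of b0 b3 b2]) (auto simp: ys z(3))
    have "coord y b0 * (coord z b0 * \<beta>) = coord z b0 * (coord y b0 * \<beta>)" by simp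
    also have "\<dots> = \<alpha> * (coord z b0 * coord y b1)" unfolding prop_xy by simp
    also have "\<dots> = coord y b0 * (\<alpha> * coord z b1)" unfolding zy by simp
    finally show ?thesis using nz by simp
  next
    case False
    then show ?thesis
      unfolding \<alpha>_def \<beta>_def using dist B z(2)
      by (intro coord_proportional[OF x(1) z(1), of b0 b2 k]) (auto simp: xs z(3))
  qed
  have line: "\<exists>s. s \<noteq> 0 \<and> z = s *\<^sub>R u + coord z k *\<^sub>R k \<and> s * \<eta> + coord z k = 1 \<and> coord z k \<noteq> 0 \<and> coord z b1 \<noteq> 0 \<and> k \<in> B"
    if z: "z \<in> A - B" "k \<notin> {b0, b1}" "supp z = {b0, b1, k}" for z k
  proof -
    have "b0 \<in> supp z" "b1 \<in> supp z" "k \<in> supp z" using z(3) by auto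
    then have nz: "coord z b0 \<noteq> 0" "coord z b1 \<noteq> 0" "coord z k \<noteq> 0" "k \<in> B" by (auto simp: supp_def)
    define s where "s = coord z b0 / \<alpha>"
    have "s \<noteq> 0" "coord z b0 = s * \<alpha>" "coord z b1 = s * \<beta>"
      using nz \<alpha>\<beta> proportional[OF z] by (simp_all add: s_def field_simps)
    moreover have "z = coord z b0 *\<^sub>R b0 + (coord z b1 *\<^sub>R b1 + coord z k *\<^sub>R k)"
      "coord z b0 + (coord z b1 + coord z k) = 1"
      using sum_coord_supp[of z] sum_coord_supp_scaleR[of z] z b01(2) by auto
    ultimately show ?thesis
      using nz by (intro exI[of _ s]) (auto simp: u_def \<eta>_def algebra_simps)
  qed
  have line0: "\<exists>s \<gamma>. s \<noteq> 0 \<and> z = s *\<^sub>R u + \<gamma> *\<^sub>R b0 \<and> s * \<eta> + \<gamma> = 1"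
    if z: "coord z b1 \<noteq> 0" "z = coord z b0 *\<^sub>R b0 + coord z b1 *\<^sub>R b1" "coord z b0 + coord z b1 = 1" for z
  proof -
    define s where "s = coord z b1 / \<beta>"
    define \<gamma> where "\<gamma> = coord z b0 - s * \<alpha>"
    have s: "s \<noteq> 0" "coord z b1 = s * \<beta>" "coord z b0 = s * \<alpha> + \<gamma>"
      using z(1) \<alpha>\<beta> by (simp_all add: s_def \<gamma>_def)
    have "z = s *\<^sub>R u + \<gamma> *\<^sub>R b0"
      by (subst z(2)) (simp add: s u_def algebra_simps)
    moreover have "s * \<eta> + \<gamma> = 1" using z(3) s by (simp add: \<eta>_def algebra_simps)
    ultimately show ?thesis using s(1) by blast
  qed
  obtain sx where lx: "sx \<noteq> 0" "x = sx *\<^sub>R u + coord x b2 *\<^sub>R b2" "sx * \<eta> + coord x b2 = 1" "coord x b2 \<noteq> 0" "coord x b1 \<noteq> 0"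
    using line[OF x(1) _ xs] dist by auto
  obtain sy where ly: "sy \<noteq> 0" "y = sy *\<^sub>R u + coord y b3 *\<^sub>R b3" "sy * \<eta> + coord y b3 = 1" "coord y b3 \<noteq> 0" "coord y b1 \<noteq> 0"
    using line[OF y(1) _ ys] dist by auto
  \<comment> \<open>\<open>b1\<close> is a second point on the line through \<open>b0\<close> and
    the common point, so this line always carries two points of \<open>A\<close>.\<close>
  have b1_line: "b1 = (1 / \<beta>) *\<^sub>R u + (- \<alpha> / \<beta>) *\<^sub>R b0" "(1 / \<beta>) * \<eta> + (- \<alpha> / \<beta>) = 1"
    using \<alpha>\<beta> by (simp_all add: u_def \<eta>_def scaleR_add_right field_simps)
  have cb1: "coord b1 b1 \<noteq> 0" using coord_basis[OF B(2,2)] by simp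
  have AB: "b1 \<in> A" "x \<in> A" "y \<in> A" "x \<noteq> b1" "y \<noteq> b1" "x \<noteq> y"
    using B B_subset x y xs ys dist by auto
  \<comment> \<open>The comparison uses the line of \<open>b0\<close>, represented by
    \<open>b1\<close>, and whichever of the lines of \<open>x\<close> and \<open>y\<close> differs
    from that of \<open>z\<close>; the separating coordinate is the one at
    \<open>b1\<close>.\<close>
  have pos: "coord z k > 0" if z: "z \<in> A - B" "k \<notin> {b0, b1}" "supp z = {b0, b1, k}" for z k
  proof -
    obtain s where s: "s \<noteq> 0" "z = s *\<^sub>R u + coord z k *\<^sub>R k" "s * \<eta> + coord z k = 1" "coord z k \<noteq> 0" "coord z b1 \<noteq> 0" "k \<in> B"
      using line[OF z] by blast
    have zb1: "z \<noteq> b1" using z(1) B by blast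
    have zA: "z \<in> A" using z(1) by blast
    have nz: "1 / \<beta> \<noteq> 0" "- \<alpha> / \<beta> \<noteq> 0" using \<alpha>\<beta> by auto
    show ?thesis
    proof (cases "k = b2")
      case True
      then have "z \<noteq> y" using z(3) ys dist by auto
      then show ?thesis
        using True zA zb1 AB B dist
        by (intro same_side[OF zA AB(3,1) s(6) B(4,1,2) _ _ s(5) ly(5) cb1 s(2) ly(2) b1_line(1) s(3) ly(3) b1_line(2)
              s(1) ly(1) nz(1) s(4) ly(4) nz(2)]) auto
    next
      case False
      then have "z \<noteq> x" using z(2,3) xs dist by auto
      then show ?thesis
        using False z(2) zA zb1 AB B dist
        by (intro same_side[OF zA AB(2,1) s(6) B(3,1,2) _ _ s(5) lx(5) cb1 s(2) lx(2) b1_line(1) s(3) lx(3) b1_line(2)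
              s(1) lx(1) nz(1) s(4) lx(4) nz(2)]) auto
    qed
  qed
  have pos0: "\<gamma> > 0" if z: "z \<in> A" "z \<noteq> x" "z \<noteq> y" "s \<noteq> 0" "z = s *\<^sub>R u + \<gamma> *\<^sub>R b0" "s * \<eta> + \<gamma> = 1" "\<gamma> \<noteq> 0" "coord z b1 \<noteq> 0" for z s \<gamma>
    using AB B dist z(2,3)
    by (intro same_side[OF z(1) AB(2,3) B(1,3,4,2) _ _ z(8) lx(5) ly(5) z(5) lx(2) ly(2) z(6) lx(3) ly(3)
          z(4) lx(1) ly(1) z(7) lx(4) ly(4)]) auto
  \<comment> \<open>Since \<open>b1\<close> lies on the line of \<open>b0\<close>, the remaining
    basis elements give exactly \<open>d\<close> lines.\<close>
  define J where "J = B - {b1}"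
  have J: "J \<subseteq> A" "int (card J) = aff_dim A" "b0 \<in> J"
    using B B_subset b01(2) card_B card_Suc_Diff1[OF finite_B B(2)] by (auto simp: J_def)
  have lines: "\<exists>j\<in>J. \<exists>s \<gamma>. \<gamma> \<ge> 0 \<and> s * \<eta> + \<gamma> = 1 \<and> z = s *\<^sub>R u + \<gamma> *\<^sub>R j" if z: "z \<in> A" for z
  proof -
    consider "z \<in> J" | "z \<notin> J" "z = b1 \<or> z \<in> A - B \<and> supp z = {b0, b1}"
      | k where "z \<in> A - B" "k \<notin> {b0, b1}" "supp z = {b0, b1, k}"
      using z shape[of z] by (auto simp: J_def)
    then show ?thesis
    proof cases
      case 1
      then show ?thesis by (intro bexI[of _ z] exI[of _ 0] exI[of _ 1]) auto
    next
      case 2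
      have "coord z b1 \<noteq> 0 \<and> z = coord z b0 *\<^sub>R b0 + coord z b1 *\<^sub>R b1 \<and> coord z b0 + coord z b1 = 1"
        using 2(2)
      proof
        assume "z = b1"
        then show ?thesis using coord_basis[OF B(2,1)] coord_basis[OF B(2,2)] b01(2) by simp
      next
        assume zs: "z \<in> A - B \<and> supp z = {b0, b1}"
        then have "b1 \<in> supp z" by blast
        then have "coord z b1 \<noteq> 0" by (simp add: supp_def)
        moreover have "z = coord z b0 *\<^sub>R b0 + coord z b1 *\<^sub>R b1" "coord z b0 + coord z b1 = 1"
          using sum_coord_supp[OF z] sum_coord_supp_scaleR[OF z] zs b01(2) by auto
        ultimately show ?thesis by blast
      qed
      then obtain s \<gamma> where s: "s \<noteq> 0" "z = s *\<^sub>R u + \<gamma> *\<^sub>R b0" "s * \<eta> + \<gamma> = 1" "coord z b1 \<noteq> 0"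
        using line0[of z] by blast
      have "z \<noteq> x" "z \<noteq> y" using 2(2) AB xs ys dist by (auto simp: insert_eq_iff)
      then have "\<gamma> \<ge> 0" using pos0[OF z _ _ s(1-3) _ s(4)] by (cases "\<gamma> = 0") auto
      then show ?thesis using s J(3) by (intro bexI[of _ b0] exI[of _ s] exI[of _ \<gamma>]) auto
    next
      case 3
      obtain s where s: "z = s *\<^sub>R u + coord z k *\<^sub>R k" "s * \<eta> + coord z k = 1" "k \<in> B"
        using line[OF 3] by blast
      have "k \<in> J" using s(3) 3(2) by (auto simp: J_def)
      then show ?thesis
        using s pos[OF 3] by (intro bexI[of _ k] exI[of _ s] exI[of _ "coord z k"]) auto
    qed
  qed
  show ?thesis
  \<comment> \<open>A point \<open>v\<close> with \<open>u = \<eta> *\<^sub>R v\<close> turns the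
    lines into rays from \<open>v\<close>; without one, \<open>\<gamma> = 0\<close> is impossible,
    since such a point would be \<open>v\<close>.\<close>
  proof (cases "\<exists>v\<in>A. u = \<eta> *\<^sub>R v")
    case True
    then obtain v where v: "v \<in> A" "u = \<eta> *\<^sub>R v" by blast
    have "\<exists>j\<in>J. \<exists>t\<ge>0. z = (1 - t) *\<^sub>R v + t *\<^sub>R j" if z: "z \<in> A" for z
    proof -
      obtain j s \<gamma> where j: "j \<in> J" "\<gamma> \<ge> 0" "s * \<eta> + \<gamma> = 1" "z = s *\<^sub>R u + \<gamma> *\<^sub>R j"
        using lines[OF z] by blast
      have "s * \<eta> = 1 - \<gamma>" using j(3) by linarith
      then have "z = (1 - \<gamma>) *\<^sub>R v + \<gamma> *\<^sub>R j" using j(4) v(2) by simp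
      then show ?thesis using j(1,2) by blast
    qed
    then show ?thesis using simplex_star_exists[OF finite_A v(1) J(1,2)] by blast
  next
    case False
    have "\<exists>j\<in>J. \<exists>s \<gamma>. \<gamma> > 0 \<and> s * \<eta> + \<gamma> = 1 \<and> z = s *\<^sub>R u + \<gamma> *\<^sub>R j" if z: "z \<in> A" for z
    proof -
      obtain j s \<gamma> where j: "j \<in> J" "\<gamma> \<ge> 0" "s * \<eta> + \<gamma> = 1" "z = s *\<^sub>R u + \<gamma> *\<^sub>R j"
        using lines[OF z] by blast
      have "\<gamma> \<noteq> 0"
      proof
        assume "\<gamma> = 0"
        then have "\<eta> *\<^sub>R z = (s * \<eta>) *\<^sub>R u" "s * \<eta> = 1" using j by (simp_all add: mult.commute)
        then have "u = \<eta> *\<^sub>R z" by simp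
        then show False using False z by blast
      qed
      then have "\<gamma> > 0" using j(2) by linarith
      then show ?thesis using j by blast
    qed
    \<comment> \<open>This is the coefficient of \<open>b0\<close> in \<open>b1\<close>; its
      positivity qualifies \<open>b1\<close> as the second point \<open>z\<close> on the line of
      \<open>b0\<close>.\<close>
    moreover have "- \<alpha> / \<beta> > 0"
      using \<alpha>\<beta> AB(4,5) by (intro pos0[OF AB(1) _ _ _ b1_line _ cb1]) auto
    ultimately show ?thesis
      using prism_pyramid_exists[OF finite_A J(1,2), of u \<eta> b0 b1 "1 / \<beta>" "- \<alpha> / \<beta>"] False J(3) AB(1) \<alpha>\<beta> b1_line
      by auto
  qed
qed

lemma classification:
  assumes "aff_dim A = int d" "d \<ge> 2"
  shows "(\<exists>k C. (config_pyramid ^^ k) A C \<and> aff_dim C = 2 \<and> without_interior_points C) \<or>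
    (d \<ge> 3 \<and> (\<exists>k P \<Delta> \<phi>. (polytope_pyramid ^^ k) (convex hull A) P \<and> prism_over_simplex \<Delta> \<phi> P \<and>
      nonvertex_points A \<subseteq> \<Union>(vertical_edges \<Delta> \<phi> P))) \<or>
    (d \<ge> 3 \<and> int d simplex (convex hull A) \<and>
      (\<exists>v. v extreme_point_of (convex hull A) \<and> nonvertex_points A \<subseteq> \<Union>{E. E edge_of (convex hull A) \<and> v \<in> E}))"
proof -
  let ?U = "\<Union>x\<in>A - B. supp x"
  have UB: "?U \<subseteq> B" using supp_subset by blast
  have cB: "card B = d + 1" using card_B assms(1) by linarith
  show ?thesis
  proof (cases "card ?U \<le> 3")
    case True
    have "\<exists>B0. ?U \<subseteq> B0 \<and> B0 \<subseteq> B \<and> card B0 = 3"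
      using True cB assms(2) by (intro exists_subset_between UB finite_B) auto
    then obtain B0 where B0: "?U \<subseteq> B0" "B0 \<subseteq> B" "card B0 = 3" by blast
    have "\<exists>k C. (config_pyramid ^^ k) A C \<and> aff_dim C = 2 \<and> without_interior_points C"
      by (rule polygon_pyramid_exists[OF _ B0(2,3)]) (use B0(1) in blast)
    then show ?thesis by blast
  next
    case False
    then have U: "card ?U \<ge> 4" by linarith
    moreover have "card ?U \<le> card B" using UB finite_B by (rule card_mono[rotated])
    ultimately have d: "d \<ge> 3" using cB by linarith
    show ?thesis
    proof (cases "\<exists>x\<in>A - B. card (supp x) = 3")
      case True
      then obtain x where "x \<in> A - B" "card (supp x) = 3" by blast
      from prism_case[OF this U] show ?thesis using d assms(1) by simp
    next
      case False
      have "card (supp x) = 2" if "x \<in> A - B" for x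
        using False card_supp_ge_2[OF that] card_supp_le_3[OF that] that by force
      from star_case[OF this U] show ?thesis using d assms(1) by simp
    qed
  qed
qed

end

theorem theorem2:
  fixes I :: "'i set" and a :: "'i \<Rightarrow> 'a::euclidean_space" and d n :: nat and A :: "'a set"
  assumes "finite I" and "card I = n" and "aff_dim (a ` I) = int d"
    and "A = a ` I"
  shows "config_degree I a \<le> 1 \<longleftrightarrow>
      d \<le> 1
    \<or> (d \<ge> 2 \<and> (\<exists>k B. (config_pyramid ^^ k) A B \<and> aff_dim B = 2 \<and> without_interior_points B))
    \<or> (d \<ge> 3 \<and> (\<exists>k P \<Delta> \<phi>. (polytope_pyramid ^^ k) (convex hull A) P \<and> prism_over_simplex \<Delta> \<phi> P
          \<and> nonvertex_points A \<subseteq> \<Union>(vertical_edges \<Delta> \<phi> P)))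
    \<or> (d \<ge> 3 \<and> int d simplex (convex hull A)
          \<and> (\<exists>v. v extreme_point_of (convex hull A)
              \<and> nonvertex_points A \<subseteq> \<Union>{E. E edge_of (convex hull A) \<and> v \<in> E}))"
proof -
  have fin: "finite A" using assms by simp
  have dim: "aff_dim A = int d" using assms(3,4) by simp
  then have "A \<noteq> {}" by auto
  then have "I \<noteq> {}" using assms(4) by blast
  then have deg: "config_degree I a \<le> 1 \<longleftrightarrow> degree_le_one A"
    using config_degree_le_one_iff[OF assms(1), of a] assms(4) by simp
  show ?thesis
    unfolding deg
  proof (intro iffI; (elim disjE conjE exE)?)
    assume "degree_le_one A"
    obtain B where "B \<subseteq> A" "\<not> affine_dependent B" "affine hull A = affine hull B"
      using affine_basis_exists[of A] by blast
    then interpret degree_one_basis A B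
      using fin \<open>degree_le_one A\<close> by unfold_locales (auto intro: hull_inc)
    show "d \<le> 1
      \<or> (d \<ge> 2 \<and> (\<exists>k B. (config_pyramid ^^ k) A B \<and> aff_dim B = 2 \<and> without_interior_points B))
      \<or> (d \<ge> 3 \<and> (\<exists>k P \<Delta> \<phi>. (polytope_pyramid ^^ k) (convex hull A) P \<and> prism_over_simplex \<Delta> \<phi> P
            \<and> nonvertex_points A \<subseteq> \<Union>(vertical_edges \<Delta> \<phi> P)))
      \<or> (d \<ge> 3 \<and> int d simplex (convex hull A)
            \<and> (\<exists>v. v extreme_point_of (convex hull A)
                \<and> nonvertex_points A \<subseteq> \<Union>{E. E edge_of (convex hull A) \<and> v \<in> E}))"
    proof (cases "d \<le> 1")
      case False
      then show ?thesis using classification[OF dim] by auto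
    qed simp
  next
    assume "d \<le> 1"
    then show "degree_le_one A" using dim by (intro degree_le_one_if_aff_dim_le_one) simp
  next
    fix k B assume B: "(config_pyramid ^^ k) A B" "aff_dim B = 2" "without_interior_points B"
    have "B \<subseteq> A" using config_pyramid_subset[OF B(1)] .
    then have "finite B" using fin finite_subset by blast
    then show "degree_le_one A"
      using degree_le_one_config_pyramid[OF B(1) fin degree_le_one_polygon] B(2,3) by blast
  next
    fix k P \<Delta> \<phi>
    assume "(polytope_pyramid ^^ k) (convex hull A) P" "prism_over_simplex \<Delta> \<phi> P"
      "nonvertex_points A \<subseteq> \<Union>(vertical_edges \<Delta> \<phi> P)"
    then show "degree_le_one A" by (rule degree_le_one_prism_pyramid[OF fin])
  next
    fix v
    assume "int d simplex (convex hull A)" "v extreme_point_of (convex hull A)"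
      "nonvertex_points A \<subseteq> \<Union>{E. E edge_of (convex hull A) \<and> v \<in> E}"
    then show "degree_le_one A" by (rule degree_le_one_simplex_star[OF fin])
  qed
qed

end
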